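(* Let $p\in(0,1)$ be arbitrary. For the zero-temperature Glauber dynamics on the slab $S_3=\mathbb{Z}^2\times\{0,1,2\}$ with periodic boundary conditions in the third coordinate, started from the i.i.d. product measure with density $p$ of $+1$ spins, almost surely all sites fixate; that is, $$\mathbb{P}_p\big(\text{for every } v\in S_3 \text{ there is } T<\infty \text{ with } \sigma_v(t)=\sigma_v(T)\text{ for all } t\ge T\big)=1 .$$
   Context: Slab with periodic boundary conditions: the vertex set of $S_3$ is $\mathbb{Z}^2\times\{0,1,2\}$; two vertices are neighbors if they are at $\ell_1$-distance $1$, and in addition $(x,y,2)$ and $(x,y,0)$ are neighbors for every $(x,y)\in\mathbb{Z}^2$. So every vertex has exactly six neighbors. Let $\mathcal{E}_3$ be the edge set. Dynamics: spins are $\sigma_v(t)\in\{-1,+1\}$, $v\in S_3$, $t\ge 0$. The initial spins $\sigma_v(0)$ are i.i.d. with probability $p$ of being $+1$ and $1-p$ of being $-1$. Each vertex has an independent rate-one exponential clock (Poisson process). The energy of $v$ at time $t$ is $e_v(t)=-\sum_{w:\{v,w\}\in\mathcal{E}_3}\sigma_v(t)\sigma_w(t)$. When the clock at $v$ rings at time $t$, the spin at $v$ is updated: $\sigma_v(t)=-\sigma_v(t^-)$ if $e_v(t^-)>0$; $\sigma_v(t)=\pm1$ with probability $1/2$ each (independent fair coin) if $e_v(t^-)=0$; $\sigma_v(t)=\sigma_v(t^-)$ if $e_v(t^-)<0$. $\mathbb{P}_p$ denotes the joint law of the initial spins and the dynamics realization $\omega$ (clocks and coins). *)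

theory Defs
  imports "HOL-Probability.Probability"
begin

type_synonym vertex = "int \<times> int \<times> int"
type_synonym config = "vertex \<Rightarrow> int"

definition slab :: "vertex set" where
  "slab = UNIV \<times> UNIV \<times> {0, 1, 2}"

fun l1_dist :: "vertex \<Rightarrow> vertex \<Rightarrow> int" where
  "l1_dist (x, y, z) (x', y', z') = \<bar>x - x'\<bar> + \<bar>y - y'\<bar> + \<bar>z - z'\<bar>"

definition slab_edges :: "vertex set set" where
  "slab_edges =
     {{u, v} | u v. u \<in> slab \<and> v \<in> slab \<and> l1_dist u v = 1} \<union>
     {{(x, y, 2), (x, y, 0)} | x y. True}"

definition neighbors :: "vertex \<Rightarrow> vertex set" where
  "neighbors v = {w. {v, w} \<in> slab_edges}"

lemma l1_dist_commute: "l1_dist u v = l1_dist v u"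
  by (cases u; cases v) simp

lemma mem_neighbors_iff:
  "(x', y', z') \<in> neighbors (x, y, z) \<longleftrightarrow>
     z \<in> {0, 1, 2} \<and> z' \<in> {0, 1, 2} \<and>
     (\<bar>x - x'\<bar> + \<bar>y - y'\<bar> + \<bar>z - z'\<bar> = 1 \<or> x = x' \<and> y = y' \<and> {z, z'} = {0, 2})"
proof -
  have "w \<in> neighbors v \<longleftrightarrow> v \<in> slab \<and> w \<in> slab \<and> l1_dist v w = 1 \<or>
      (\<exists>x y. {v, w} = {(x, y, 2), (x, y, 0)})" for v w
    unfolding neighbors_def slab_edges_def mem_Collect_eq Un_iff
    using l1_dist_commute by (auto simp only: doubleton_eq_iff)
  then show ?thesis
    by (auto simp: slab_def doubleton_eq_iff)
qed

lemma neighbors_eq: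
  assumes "z \<in> {0, 1, 2}"
  shows "neighbors (x, y, z) =
     {(x+1, y, z), (x-1, y, z), (x, y+1, z), (x, y-1, z)} \<union> (\<lambda>z'. (x, y, z')) ` ({0, 1, 2} - {z})"
proof -
  have "(a, b, c) \<in> neighbors (x, y, z) \<longleftrightarrow> (a, b, c) \<in>
     {(x+1, y, z), (x-1, y, z), (x, y+1, z), (x, y-1, z)} \<union> (\<lambda>z'. (x, y, z')) ` ({0, 1, 2} - {z})" for a b c
    unfolding mem_neighbors_iff doubleton_eq_iff Un_iff insert_iff image_iff
    using assms by simp smt
  then show ?thesis by (metis prod_cases3 subsetI subset_antisym)
qed

lemma card_neighbors:
  assumes "v \<in> slab"
  shows "card (neighbors v) = 6"
proof -
  obtain x y z where v: "v = (x, y, z)" and z: "z \<in> {0, 1, 2}"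
    using assms by (auto simp: slab_def)
  from z show ?thesis
    unfolding v neighbors_eq[OF z] by (auto simp: insert_Diff_if)
qed

definition energy :: "config \<Rightarrow> vertex \<Rightarrow> int" where
  "energy \<eta> v = - (\<Sum>w\<in>neighbors v. \<eta> v * \<eta> w)"

definition updated_spin :: "config \<Rightarrow> vertex \<Rightarrow> int \<Rightarrow> int" where
  "updated_spin \<eta> v c =
     (if energy \<eta> v > 0 then - \<eta> v else if energy \<eta> v = 0 then c else \<eta> v)"

definition spin_pmf :: "real \<Rightarrow> int pmf" where
  "spin_pmf p = map_pmf (\<lambda>b. if b then 1 else - 1) (bernoulli_pmf p)"

text \<open>
  A sample point consists of the initial spins, the waiting times between successive rings
  of each clock (i.i.d. exponential of rate one, so that the rings at each vertex form a
  rate-one Poisson process), and one fair coin for every ring of every clock.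
  The coin is consulted only if the energy vanishes at that ring.
\<close>

type_synonym sample = "config \<times> (vertex \<times> nat \<Rightarrow> real) \<times> (vertex \<times> nat \<Rightarrow> int)"

definition glauber_measure :: "real \<Rightarrow> sample measure" where
  "glauber_measure p =
     (\<Pi>\<^sub>M v\<in>slab. measure_pmf (spin_pmf p)) \<Otimes>\<^sub>M
     ((\<Pi>\<^sub>M i\<in>slab \<times> UNIV. density lborel (\<lambda>x. ennreal (exponential_density 1 x))) \<Otimes>\<^sub>M
      (\<Pi>\<^sub>M i\<in>slab \<times> UNIV. measure_pmf (spin_pmf (1/2))))"

lemma prob_space_glauber_measure: "prob_space (glauber_measure p)"
proof -
  let ?S = "\<Pi>\<^sub>M v\<in>slab. measure_pmf (spin_pmf p)"
  let ?W = "\<Pi>\<^sub>M i\<in>slab \<times> (UNIV :: nat set). density lborel (\<lambda>x. ennreal (exponential_density 1 x))"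
  let ?C = "\<Pi>\<^sub>M i\<in>slab \<times> (UNIV :: nat set). measure_pmf (spin_pmf (1/2))"
  interpret S: prob_space ?S by (intro prob_space_PiM measure_pmf.prob_space_axioms)
  interpret W: prob_space ?W by (intro prob_space_PiM prob_space_exponential_density) simp
  interpret C: prob_space ?C by (intro prob_space_PiM measure_pmf.prob_space_axioms)
  interpret WC: pair_prob_space ?W ?C ..
  interpret SWC: pair_prob_space ?S "?W \<Otimes>\<^sub>M ?C" ..
  show ?thesis unfolding glauber_measure_def by (rule SWC.prob_space_axioms)
qed

definition initial_spin :: "sample \<Rightarrow> config" where
  "initial_spin \<omega> = fst \<omega>"

definition waiting_time :: "sample \<Rightarrow> vertex \<Rightarrow> nat \<Rightarrow> real" where
  "waiting_time \<omega> v n = fst (snd \<omega>) (v, n)"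

definition coin :: "sample \<Rightarrow> vertex \<Rightarrow> nat \<Rightarrow> int" where
  "coin \<omega> v n = snd (snd \<omega>) (v, n)"

definition ring_time :: "sample \<Rightarrow> vertex \<Rightarrow> nat \<Rightarrow> real" where
  "ring_time \<omega> v n = (\<Sum>k\<le>n. waiting_time \<omega> v k)"

text \<open>
  The configuration just before time \<open>t\<close>. As spins are integers, the limit is taken in a
  discrete space.
\<close>

definition config_before :: "(vertex \<Rightarrow> real \<Rightarrow> int) \<Rightarrow> real \<Rightarrow> config" where
  "config_before \<sigma> t w = Lim (at_left t) (\<sigma> w)"

definition glauber_trajectory :: "sample \<Rightarrow> (vertex \<Rightarrow> real \<Rightarrow> int) \<Rightarrow> bool" where
  "glauber_trajectory \<omega> \<sigma> \<longleftrightarrow> (\<forall>v\<in>slab.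
     \<sigma> v 0 = initial_spin \<omega> v \<and>
     (\<forall>s t. 0 \<le> s \<and> s \<le> t \<and> (\<forall>n. ring_time \<omega> v n \<notin> {s<..t}) \<longrightarrow> \<sigma> v t = \<sigma> v s) \<and>
     (\<forall>n. \<sigma> v (ring_time \<omega> v n) =
            updated_spin (config_before \<sigma> (ring_time \<omega> v n)) v (coin \<omega> v n)))"

text \<open>
  By Harris' graphical construction, for almost every sample point there is a trajectory, and
  any two trajectories agree on the vertices of the slab at all times \<open>t \<ge> 0\<close>. Hence the
  choice below determines the process up to a null set; only its values on the slab at
  nonnegative times are meaningful. If there were no trajectory, nothing would be known
  about the chosen function.
\<close>

definition glauber :: "sample \<Rightarrow> vertex \<Rightarrow> real \<Rightarrow> int" where
  "glauber \<omega> = (SOME \<sigma>. glauber_trajectory \<omega> \<sigma>)"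

end

theory Submission
  imports Defs "HOL-Library.Transitive_Closure_Table" "HOL-Real_Asymp.Real_Asymp"
begin

text \<open>
  The energy in a large box cannot become negative, and only sites near its boundary can raise it.
  By translation invariance, the expected number of rings at a given site that strictly lower the
  energy is therefore finite. Suppose that at some time a strict descent can be reached by flipping
  a sequence of ties inside a fixed finite set. Resampling the clocks and coins after that time shows
  that, with probability bounded below, the energy is lowered in that set within one unit of time.
  So the expected total time during which a descent is reachable is finite, and by Borel-Cantelli a
  given site eventually never rings while one is.

  It remains to see that a site that can flip always has a reachable descent near it. A two by two
  block of columns that starts with spins \<open>+1\<close> keeps them, since each of its sites has four
  neighbours in the block, and almost surely there are such blocks along every lattice ray; they
  enclose each site in a finite region. If no descent were reachable in the region, a maximal
  sequence of ties lowering the spins followed by a maximal one raising them would rank its sites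
  such that each ranked site has exactly three neighbours of smaller and three of larger rank. The
  interaction of the three layers of a column propagates such a ranking along a ray without
  end, which the blocks forbid.
\<close>

section \<open>Rankings of columns\<close>

text \<open>Every site has six neighbours, so a tie means three on each side, and as soon as three
  neighbours of a ranked site are known to be lower, the other three must be higher. All steps on
  rankings use this rigidity, mostly around a unit square of columns. It leaves three shapes for a
  column with a site of intermediate rank: two bottom sites, two top sites, or one of each. Each
  shape is inherited by some adjacent column, and so on along a ray, while the columns of the blocks
  have rank 0. Both sequences of ties are needed because each is maximal at one end of the ranking
  only.

  Two obstacles shape the probabilistic half. Infinitely many clocks ring in any time interval, so
  the process is defined by following dependencies backwards, which is well-founded because the
  sites ringing within a short time form finite clusters. And the bounds on reachable descents hold
  at fixed times, whereas flips occur at random ones; grids of decreasing mesh bridge this, a cell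
  of length \<delta> containing a ring of a given site with probability at most \<delta>,
  independently of the configuration at its left end.\<close>

definition dirs :: "(int \<times> int) set" where
  "dirs = {(1, 0), (-1, 0), (0, 1), (0, -1)}"

definition perp :: "int \<times> int \<Rightarrow> int \<times> int \<Rightarrow> bool" where
  "perp d e \<longleftrightarrow> d \<in> dirs \<and> e \<in> dirs \<and> e \<noteq> d \<and> e \<noteq> - d"

lemma perp_cases:
  assumes "perp d e"
  shows "dirs = {d, - d, e, - e}" "distinct [d, - d, e, - e]"
proof -
  have "dirs = {d, - d, e, - e} \<and> distinct [d, - d, e, - e]"
    using assms unfolding perp_def dirs_def
    by (elim conjE insertE emptyE; simp; blast)
  then show "dirs = {d, - d, e, - e}" "distinct [d, - d, e, - e]" by blast+
qed

lemma uminus_dirs: "d \<in> dirs \<Longrightarrow> - d \<in> dirs"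
  unfolding dirs_def by (elim insertE emptyE; simp)

lemma perp_uminus: "perp d e \<Longrightarrow> perp d (- e)" "perp d e \<Longrightarrow> perp (- d) e"
  unfolding perp_def dirs_def by (elim conjE insertE emptyE; simp)+

lemma perp_commute: "perp d e \<Longrightarrow> perp e d"
  unfolding perp_def dirs_def by (elim conjE insertE emptyE; simp)

lemma perp_dirs: "perp d e \<Longrightarrow> d \<in> dirs" "perp d e \<Longrightarrow> e \<in> dirs"
  by (simp_all add: perp_def)

lemma perp_swap: "d \<in> dirs \<Longrightarrow> perp d (snd d, fst d)"
  unfolding perp_def dirs_def by (elim insertE emptyE; simp)

text \<open>Names the three levels of a column in any order, so that one statement covers all orders
  of their ranks.\<close>

definition perm3 :: "int \<Rightarrow> int \<Rightarrow> int \<Rightarrow> bool" where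
  "perm3 a b c \<longleftrightarrow> distinct [a, b, c] \<and> {a, b, c} = {0, 1, 2}"

lemma perm3_distinct: "perm3 a b c \<Longrightarrow> a \<noteq> b \<and> a \<noteq> c \<and> b \<noteq> c"
  unfolding perm3_def by simp

lemma perm3_rot: "perm3 a b c \<Longrightarrow> perm3 b a c" "perm3 a b c \<Longrightarrow> perm3 c b a" "perm3 a b c \<Longrightarrow> perm3 a c b"
  "perm3 a b c \<Longrightarrow> perm3 b c a" "perm3 a b c \<Longrightarrow> perm3 c a b"
  by (auto simp: perm3_def insert_commute)

lemma perm3_set: "perm3 a b c \<Longrightarrow> {0, 1, 2} = {a, b, c}"
  by (simp add: perm3_def)

lemma perm3_mem: "perm3 a b c \<Longrightarrow> l \<in> {0, 1, 2} \<longleftrightarrow> l = a \<or> l = b \<or> l = c"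
  by (simp only: perm3_set insert_iff empty_iff simp_thms)

lemma perm3_all: "perm3 a b c \<Longrightarrow> (\<forall>l\<in>{0, 1, 2}. P l) \<longleftrightarrow> P a \<and> P b \<and> P c"
  by (simp add: perm3_set)

section \<open>Counting lower and higher neighbours\<close>

definition num_low :: "(int \<times> int \<Rightarrow> int \<Rightarrow> int) \<Rightarrow> int \<times> int \<Rightarrow> int \<Rightarrow> nat" where
  "num_low f x l = (\<Sum>m\<in>{0, 1, 2} - {l}. of_bool (f x m < f x l)) + (\<Sum>d\<in>dirs. of_bool (f (x + d) l < f x l))"

definition num_high :: "(int \<times> int \<Rightarrow> int \<Rightarrow> int) \<Rightarrow> int \<times> int \<Rightarrow> int \<Rightarrow> nat" where
  "num_high f x l = (\<Sum>m\<in>{0, 1, 2} - {l}. of_bool (f x m > f x l)) + (\<Sum>d\<in>dirs. of_bool (f (x + d) l > f x l))"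

lemma perm3_sum:
  assumes "perm3 a b c"
  shows "(\<Sum>m\<in>{0, 1, 2} - {a}. g m) = (g b + g c :: nat)"
proof -
  have "{0, 1, 2} - {a} = {b, c}" using perm3_distinct[OF assms] by (auto simp only: perm3_set[OF assms])
  then show ?thesis using perm3_distinct[OF assms] by simp
qed

lemma perp_sum:
  assumes "perp d e"
  shows "(\<Sum>m\<in>dirs. g m) = (g d + g (- d) + g e + g (- e) :: nat)"
proof -
  have *: "sum g {p, q, r, s} = g p + g q + g r + g s" if "distinct [p, q, r, s]" for p q r s
    using that by simp
  show ?thesis
    unfolding perp_cases(1)[OF assms] by (rule *[OF perp_cases(2)[OF assms]])
qed

lemma num_low_eq:
  assumes "perm3 a b c" "perp d e"
  shows "num_low f x a = of_bool (f x b < f x a) + of_bool (f x c < f x a)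
    + of_bool (f (x + d) a < f x a) + of_bool (f (x - d) a < f x a)
    + of_bool (f (x + e) a < f x a) + of_bool (f (x - e) a < f x a)"
  unfolding num_low_def perm3_sum[OF assms(1)] perp_sum[OF assms(2)] by (simp only: diff_conv_add_uminus add.assoc)

lemma num_high_eq:
  assumes "perm3 a b c" "perp d e"
  shows "num_high f x a = of_bool (f x b > f x a) + of_bool (f x c > f x a)
    + of_bool (f (x + d) a > f x a) + of_bool (f (x - d) a > f x a)
    + of_bool (f (x + e) a > f x a) + of_bool (f (x - e) a > f x a)"
  unfolding num_high_def perm3_sum[OF assms(1)] perp_sum[OF assms(2)] by (simp only: diff_conv_add_uminus add.assoc)

text \<open>The l1-ball of radius \<open>n\<close> about \<open>x\<close> lies in \<open>Q\<close>.
  Radius two is what the arguments below ask for: they apply the local rules only at columns within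
  two steps.\<close>

fun deep :: "(int \<times> int) set \<Rightarrow> nat \<Rightarrow> int \<times> int \<Rightarrow> bool" where
  "deep Q 0 x \<longleftrightarrow> x \<in> Q"
| "deep Q (Suc n) x \<longleftrightarrow> deep Q n x \<and> (\<forall>d\<in>dirs. deep Q n (x + d))"

lemma deep_mem: "deep Q n x \<Longrightarrow> x \<in> Q"
  by (induction n) auto

lemma deep_step:
  assumes "deep Q (Suc n) x" "d \<in> dirs"
  shows "deep Q n (x + d)" "deep Q n (x - d)" "deep Q n x"
  using assms uminus_dirs[OF assms(2)] by (auto simp del: add_uminus_conv_diff simp: diff_conv_add_uminus)

text \<open>Rank 0 is for sites that come before every flip of a list and rank \<open>N\<close> for
  those that come after all of it. The inequalities at the two extremes express that the list cannot
  be prolonged at either end.\<close>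

locale ranking =
  fixes f :: "int \<times> int \<Rightarrow> int \<Rightarrow> int" and N :: int and Q :: "(int \<times> int) set"
  assumes N_pos: "0 < N"
    and range: "0 \<le> f x l" "f x l \<le> N"
    and mid: "x \<in> Q \<Longrightarrow> l \<in> {0, 1, 2} \<Longrightarrow> 0 < f x l \<Longrightarrow> f x l < N \<Longrightarrow> num_low f x l = 3 \<and> num_high f x l = 3"
    and bot: "x \<in> Q \<Longrightarrow> l \<in> {0, 1, 2} \<Longrightarrow> f x l = 0 \<Longrightarrow> num_high f x l \<le> 2"
    and top: "x \<in> Q \<Longrightarrow> l \<in> {0, 1, 2} \<Longrightarrow> f x l = N \<Longrightarrow> num_low f x l \<le> 2"
begin

text \<open>Reversing the order exchanges lower and higher, so each fact yields its dual by
  instantiating it with the reversed ranking.\<close>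

lemma rev_ranking: "ranking (\<lambda>x l. N - f x l) N Q"
proof
  have r: "num_low (\<lambda>x l. N - f x l) = num_high f" "num_high (\<lambda>x l. N - f x l) = num_low f"
    by (auto simp: num_low_def num_high_def fun_eq_iff)
  show "x \<in> Q \<Longrightarrow> l \<in> {0, 1, 2} \<Longrightarrow> 0 < N - f x l \<Longrightarrow> N - f x l < N \<Longrightarrow>
    num_low (\<lambda>x l. N - f x l) x l = 3 \<and> num_high (\<lambda>x l. N - f x l) x l = 3" for x l
    using mid[of x l] r by simp
qed (use N_pos range bot top in \<open>auto simp: num_low_def num_high_def\<close>)

abbreviation (input) ind :: "bool \<Rightarrow> int" where
  "ind P \<equiv> (if P then 1 else 0)"

text \<open>The counts become integer sums of indicators over six named neighbours, so that
  knowledge about a few of them can be used by linear arithmetic. Both bounds hold at all ranks, as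
  nothing is below 0 or above \<open>N\<close>. At an intermediate rank three lower and three higher
  neighbours exhaust the six, so none can tie.\<close>

lemma site:
  assumes "x \<in> Q" "perm3 a b c" "perp d e"
  shows "ind (f x b < f x a) + ind (f x c < f x a)
    + ind (f (x + d) a < f x a) + ind (f (x - d) a < f x a)
    + ind (f (x + e) a < f x a) + ind (f (x - e) a < f x a) \<le> (if f x a = N then 2 else 3)"
   "ind (f x b > f x a) + ind (f x c > f x a)
    + ind (f (x + d) a > f x a) + ind (f (x - d) a > f x a)
    + ind (f (x + e) a > f x a) + ind (f (x - e) a > f x a) \<le> (if f x a = 0 then 2 else 3)"
  "0 < f x a \<Longrightarrow> f x a < N \<Longrightarrow> f x b \<noteq> f x a \<and> f x c \<noteq> f x a \<and> f (x + d) a \<noteq> f x a \<and> f (x - d) a \<noteq> f x a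
    \<and> f (x + e) a \<noteq> f x a \<and> f (x - e) a \<noteq> f x a"
proof -
  have a: "a \<in> {0, 1, 2}" using perm3_mem[OF assms(2)] by simp
  have l: "int (num_low f x a) = ind (f x b < f x a) + ind (f x c < f x a)
    + ind (f (x + d) a < f x a) + ind (f (x - d) a < f x a)
    + ind (f (x + e) a < f x a) + ind (f (x - e) a < f x a)"
    unfolding num_low_eq[OF assms(2,3)] by (simp add: of_bool_def)
  have h: "int (num_high f x a) = ind (f x b > f x a) + ind (f x c > f x a)
    + ind (f (x + d) a > f x a) + ind (f (x - d) a > f x a)
    + ind (f (x + e) a > f x a) + ind (f (x - e) a > f x a)"
    unfolding num_high_eq[OF assms(2,3)] by (simp add: of_bool_def)
  have l0: "int (num_low f x a) = 0" if "f x a = 0"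
    unfolding l using that range(1) by (simp add: not_less)
  have hN: "int (num_high f x a) = 0" if "f x a = N"
    unfolding h using that range(2) by (simp add: not_less)
  consider "f x a = 0" | "f x a = N" | "0 < f x a" "f x a < N"
    using range[of x a] by linarith
  then have *: "int (num_low f x a) \<le> (if f x a = N then 2 else 3) \<and> int (num_high f x a) \<le> (if f x a = 0 then 2 else 3)"
    using bot[OF assms(1) a] top[OF assms(1) a] mid[OF assms(1) a] l0 hN N_pos by cases simp_all
  then show "ind (f x b < f x a) + ind (f x c < f x a)
    + ind (f (x + d) a < f x a) + ind (f (x - d) a < f x a)
    + ind (f (x + e) a < f x a) + ind (f (x - e) a < f x a) \<le> (if f x a = N then 2 else 3)"
   "ind (f x b > f x a) + ind (f x c > f x a)
    + ind (f (x + d) a > f x a) + ind (f (x - d) a > f x a)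
    + ind (f (x + e) a > f x a) + ind (f (x - e) a > f x a) \<le> (if f x a = 0 then 2 else 3)"
    unfolding l h by blast+
  show "f x b \<noteq> f x a \<and> f x c \<noteq> f x a \<and> f (x + d) a \<noteq> f x a \<and> f (x - d) a \<noteq> f x a
    \<and> f (x + e) a \<noteq> f x a \<and> f (x - e) a \<noteq> f x a" if "0 < f x a" "f x a < N"
  proof -
    have s: "int (num_low f x a) = 3" "int (num_high f x a) = 3"
      using mid[OF assms(1) a that] by simp_all
    have e: "ind (u < f x a) + ind (u > f x a) = 1 - ind (u = f x a)" for u
      by simp
    have "ind (f x b = f x a) + ind (f x c = f x a) + ind (f (x + d) a = f x a) + ind (f (x - d) a = f x a)
      + ind (f (x + e) a = f x a) + ind (f (x - e) a = f x a) = 0"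
      using s e[of "f x b"] e[of "f x c"] e[of "f (x + d) a"] e[of "f (x - d) a"] e[of "f (x + e) a"] e[of "f (x - e) a"]
      unfolding l h by linarith
    then show ?thesis by (simp split: if_splits)
  qed
qed

text \<open>Three lower neighbours are one too many for rank \<open>N\<close> and all that an
  intermediate rank allows, so the other three are strictly higher. In \<open>lowB\<close> two of
  the known neighbours lie in the same column.\<close>

lemma lowA:
  assumes "x \<in> Q" "perm3 t b c" "perp d e" "f x b < f x t" "f (x + d) t < f x t" "f (x + e) t < f x t"
  shows "f x t < N \<and> f x t < f x c \<and> f x t < f (x - d) t \<and> f x t < f (x - e) t"
  using site[OF assms(1-3)] assms(4-) range[of x t] range(1)[of x b] by (smt (verit))

lemma lowB:
  assumes "x \<in> Q" "perm3 t b c" "perp d e" "f x b < f x t" "f x c < f x t" "f (x + d) t < f x t"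
  shows "f x t < N \<and> f x t < f (x - d) t \<and> f x t < f (x + e) t \<and> f x t < f (x - e) t"
  using site[OF assms(1-3)] assms(4-) range[of x t] range(1)[of x b] by (smt (verit))

text \<open>At rank \<open>N\<close> two lower neighbours are already the maximum, so the other four
  cannot be below \<open>N\<close>.\<close>

lemma lowC:
  assumes "x \<in> Q" "perm3 t b c" "perp d e" "f x t = N" "f (x + d) t < N" "f (x + e) t < N"
  shows "f x b = N \<and> f x c = N \<and> f (x - d) t = N \<and> f (x - e) t = N"
  using site(1)[OF assms(1-3)] assms(4-) range(2)[of x b] range(2)[of x c] range(2)[of "x - d" t] range(2)[of "x - e" t]
  by (smt (verit))

lemma lowD:
  assumes "x \<in> Q" "perm3 t b c" "perp d e" "f x t = N" "f x b < N" "f (x + d) t < N"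
  shows "f x c = N \<and> f (x - d) t = N \<and> f (x + e) t = N \<and> f (x - e) t = N"
  using site(1)[OF assms(1-3)] assms(4-) range(2)[of x c] range(2)[of "x - d" t] range(2)[of "x + e" t] range(2)[of "x - e" t]
  by (smt (verit))

lemma lowE:
  assumes "x \<in> Q" "perm3 t b c" "perp d e" "f x t = N" "f x b < N" "f x c < N"
  shows "f (x + d) t = N \<and> f (x - d) t = N \<and> f (x + e) t = N \<and> f (x - e) t = N"
  using site(1)[OF assms(1-3)] assms(4-) range(2)[of "x + d" t] range(2)[of "x - d" t] range(2)[of "x + e" t] range(2)[of "x - e" t]
  by (smt (verit))

lemma highA:
  assumes "x \<in> Q" "perm3 t b c" "perp d e" "f x b > f x t" "f (x + d) t > f x t" "f (x + e) t > f x t"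
  shows "f x t > 0 \<and> f x t > f x c \<and> f x t > f (x - d) t \<and> f x t > f (x - e) t"
  using ranking.lowA[OF rev_ranking assms(1-3)] assms(4-) by simp

lemma highB:
  assumes "x \<in> Q" "perm3 t b c" "perp d e" "f x b > f x t" "f x c > f x t" "f (x + d) t > f x t"
  shows "f x t > 0 \<and> f x t > f (x - d) t \<and> f x t > f (x + e) t \<and> f x t > f (x - e) t"
  using ranking.lowB[OF rev_ranking assms(1-3)] assms(4-) by simp

lemma highD:
  assumes "x \<in> Q" "perm3 t b c" "perp d e" "f x t = 0" "f x b > 0" "f (x + d) t > 0"
  shows "f x c = 0 \<and> f (x - d) t = 0 \<and> f (x + e) t = 0 \<and> f (x - e) t = 0"
  using ranking.lowD[OF rev_ranking assms(1-3)] assms(4-) by simp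

lemma highE:
  assumes "x \<in> Q" "perm3 t b c" "perp d e" "f x t = 0" "f x b > 0" "f x c > 0"
  shows "f (x + d) t = 0 \<and> f (x - d) t = 0 \<and> f (x + e) t = 0 \<and> f (x - e) t = 0"
  using ranking.lowE[OF rev_ranking assms(1-3)] assms(4-) by simp

text \<open>By periodicity any two sites of a column are neighbours, and a site of intermediate rank
  ties with no neighbour.\<close>

lemma between:
  assumes "x \<in> Q" "perm3 a b c" "f x a = f x b"
  shows "f x a = 0 \<or> f x a = N"
proof -
  have "perp (1, 0) (0, 1)" by (simp add: perp_def dirs_def)
  from site(3)[OF assms(1,2) this] show ?thesis using assms(3) range[of x a] by linarith
qed

text \<open>By \<open>lowA\<close> the third site of the column ranks above \<open>a\<close>, by
  \<open>highA\<close> it ranks below \<open>b\<close>, although \<open>b\<close> ranks below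
  \<open>a\<close>.\<close>

lemma pinch:
  assumes "x \<in> Q" "perm3 a b c" "perp d e"
    "f x b < f x a" "f (x + d) a < f x a" "f (x + e) a < f x a" "f x b < f (x + d) b" "f x b < f (x + e) b"
  shows False
  using lowA[OF assms(1-3)] highA[OF assms(1) perm3_rot(1)[OF assms(2)] assms(3)] assms(4-) by linarith

text \<open>\<open>t\<close> has three lower neighbours, so \<open>m\<close> ranks above
  \<open>t\<close>. Then \<open>b\<close> and the two outer sites at level \<open>m\<close> are
  below \<open>m\<close> as well, and the same rule places \<open>t\<close> above
  \<open>m\<close>.\<close>

lemma roof:
  assumes "x \<in> Q" "perm3 b m t" "perp d e"
    "f x b < f x t" "f (x + d) t < f x t" "f (x + e) t < f x t" "f (x + d) m < f x t" "f (x + e) m < f x t"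
  shows False
proof -
  have 1: "f x t < f x m"
    using lowA[OF assms(1) perm3_rot(5)[OF assms(2)] assms(3)] assms(4-) by blast
  then show False
    using lowA[OF assms(1) perm3_rot(1)[OF assms(2)] assms(3)] assms(4-) by linarith
qed

text \<open>By \<open>roof\<close> the other two sites are not below \<open>t\<close>. Were
  \<open>t\<close> below \<open>N\<close>, both would be strictly above it and each would have three
  lower neighbours, \<open>t\<close> among them, so that neither exceeds the other; the tie forces
  rank \<open>N\<close>, where \<open>lowC\<close> would put \<open>t\<close> at \<open>N\<close>
  too.\<close>

lemma corner:
  assumes "x \<in> Q" "perm3 a b t" "perp d e"
    "\<forall>l\<in>{0, 1, 2}. f (x + d) l < f x t \<and> f (x + e) l < f x t"
  shows "\<forall>l\<in>{0, 1, 2}. f x l = N"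
proof -
  have p: "f (x + d) l < f x t \<and> f (x + e) l < f x t" if "l = a \<or> l = b \<or> l = t" for l
    using assms(4) that perm3_mem[OF assms(2)] by blast
  have *: "f x t \<le> f x a" if "perm3 a b t" "f (x + d) b < f x t" "f (x + e) b < f x t" for a b
    using roof[OF assms(1) that(1) assms(3)] that p by force
  have 1: "f x t \<le> f x a" "f x t \<le> f x b"
    using *[OF assms(2)] *[OF perm3_rot(1)[OF assms(2)]] p by blast+
  have "f x t = N"
  proof (rule ccontr)
    assume "f x t \<noteq> N"
    then have t: "0 < f x t" "f x t < N"
      using range(2)[of x t] range(1)[of "x + d" t] p[of t] by auto
    then have 2: "f x t < f x a" "f x t < f x b"
      using 1 site(3)[OF assms(1) perm3_rot(5)[OF assms(2)] assms(3)] by auto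
    have "f x b \<le> f x a" if "perm3 a b t" "f x t < f x a" "f x t < f x b" "f (x + d) b < f x t" "f (x + e) b < f x t" for a b
      using lowA[OF assms(1) perm3_rot(4)[OF that(1)] assms(3)] that by linarith
    from this[of a b] this[of b a] have "f x a = f x b"
      using 2 p assms(2) perm3_rot(1)[OF assms(2)] by force
    moreover have "f x a = N"
      using between[OF assms(1,2)] calculation t 2 by linarith
    ultimately show False
      using lowC[OF assms(1,2,3)] p[of a] t 2 by linarith
  qed
  then show ?thesis
    using 1 range(2)[of x a] range(2)[of x b] unfolding perm3_all[OF assms(2)] by force
qed

lemma perm3_sorted:
  fixes g :: "int \<Rightarrow> int"
  obtains a b c where "perm3 a b c" "g a \<le> g b" "g b \<le> g c"
proof -
  have p: "perm3 0 1 2" by (simp add: perm3_def)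
  have "(g 0 \<le> g 1 \<and> g 1 \<le> g 2) \<or> (g 0 \<le> g 2 \<and> g 2 \<le> g 1) \<or> (g 1 \<le> g 0 \<and> g 0 \<le> g 2)
    \<or> (g 1 \<le> g 2 \<and> g 2 \<le> g 0) \<or> (g 2 \<le> g 0 \<and> g 0 \<le> g 1) \<or> (g 2 \<le> g 1 \<and> g 1 \<le> g 0)"
    by linarith
  then show ?thesis
    using that[OF p] that[OF perm3_rot(3)[OF p]] that[OF perm3_rot(1)[OF p]] that[OF perm3_rot(4)[OF p]]
      that[OF perm3_rot(5)[OF p]] that[OF perm3_rot(2)[OF p]] by blast
qed

text \<open>The range of ranks in a column widens around the unit square \<open>x\<close>,
  \<open>y\<close>, \<open>n\<close>, \<open>s\<close>: from \<open>y\<close> to \<open>n\<close>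
  because the outer sites of \<open>y\<close> already have three neighbours on one side, and for the
  same reason from \<open>n\<close> to \<open>s\<close>. Since \<open>x\<close> lies strictly inside
  these ranges, \<open>pinch\<close> applies at \<open>s\<close>.\<close>

lemma no_nested:
  assumes "deep Q (Suc (Suc 0)) x" "perp d e" "perm3 b m t"
    "f (x + d) b < f (x + d) m" "f (x + d) m < f (x + d) t"
    "\<forall>l\<in>{0, 1, 2}. f (x + d) b < f x l \<and> f x l < f (x + d) t"
  shows False
proof -
  define y n s where "y = x + d" and "n = x + d + e" and "s = x + e"
  note dd = perp_dirs[OF assms(2)] perp_uminus(2)[OF assms(2)] perp_uminus(2)[OF perp_commute[OF assms(2)]]
    perp_uminus(1)[OF assms(2)]
  have pos: "y + - d = x" "y + e = n" "n + - e = y" "n - d = s" "s + d = n" "s + - e = x"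
    by (auto simp: y_def n_def s_def)
  note 1 = deep_step(1)[OF assms(1) dd(1)] deep_step(1)[OF assms(1) dd(2)]
  have Q: "y \<in> Q" "n \<in> Q" "s \<in> Q"
    unfolding n_def y_def s_def by (rule deep_mem[OF 1(1)] deep_mem[OF deep_step(1)[OF 1(1) dd(2)]] deep_mem[OF 1(2)])+
  have x: "f y b < f x l \<and> f x l < f y t \<and> f y b \<le> f y l \<and> f y l \<le> f y t" if "l \<in> {0, 1, 2}" for l
  proof -
    have "\<forall>l\<in>{0, 1, 2}. f y b \<le> f y l \<and> f y l \<le> f y t"
      unfolding perm3_all[OF assms(3)] using assms(4,5) by (simp add: y_def)
    then show ?thesis using assms(6) that unfolding y_def by blast
  qed
  have mem: "b \<in> {0, 1, 2}" "t \<in> {0, 1, 2}" using perm3_mem[OF assms(3)] by simp_all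
  have bmt: "f y b < f y m" "f y m < f y t" "f y b < f y t"
    using assms(4,5) by (simp_all add: y_def)
  have nt: "f y t < f n t"
    using lowB[OF Q(1) perm3_rot(5)[OF assms(3)] dd(3), unfolded pos, OF bmt(3,2)] x[OF mem(2)] by blast
  have nb: "f n b < f y b"
    using highB[OF Q(1) assms(3) dd(3), unfolded pos, OF bmt(1,3)] x[OF mem(1)] by blast
  obtain \<beta> \<gamma> \<alpha> where p: "perm3 \<beta> \<gamma> \<alpha>" and s: "f n \<beta> \<le> f n \<gamma>" "f n \<gamma> \<le> f n \<alpha>"
    by (rule perm3_sorted)
  have "f n t \<le> f n \<alpha>" "f n \<beta> \<le> f n b"
    using mem s unfolding perm3_mem[OF p] by auto
  then have nx: "f n \<beta> < f x l" "f n \<beta> < f y l" "f x l < f n \<alpha>" "f y l < f n \<alpha>" if "l \<in> {0, 1, 2}" for l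
    using x[OF that] nt nb by linarith+
  have lev: "\<alpha> \<in> {0, 1, 2}" "\<beta> \<in> {0, 1, 2}" "\<gamma> \<in> {0, 1, 2}"
    unfolding perm3_mem[OF p] by simp_all
  have bnd: "0 < f n \<alpha>" "f n \<beta> < N"
    using nx(2,4)[OF lev(1)] range(1)[of y \<alpha>] range(2)[of y \<alpha>] by linarith+
  have up: "f n \<alpha> < f s \<alpha>" if "f n \<gamma> < f n \<alpha>"
    using lowB[OF Q(2) perm3_rot(5)[OF p] dd(4), unfolded pos, OF _ that nx(4)[OF lev(1)]] that s(1) by linarith
  have down: "f s \<beta> < f n \<beta>" if "f n \<beta> < f n \<gamma>"
    using highB[OF Q(2) p dd(4), unfolded pos, OF that _ nx(2)[OF lev(2)]] that s(2) by linarith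
  \<comment> \<open>A tie in column \<open>n\<close> sits at 0 or \<open>N\<close>. The tied pair
    passes unchanged to \<open>s\<close>, where the third level has three neighbours on one side, so
    that one of the pair would have to lie on its far side, against its extreme rank.\<close>
  consider "f n \<beta> < f n \<gamma>" "f n \<gamma> < f n \<alpha>" | "f n \<beta> = f n \<gamma>" | "f n \<gamma> = f n \<alpha>"
    using s by linarith
  then show False
  proof cases
    case 1
    have "perm3 \<alpha> \<beta> \<gamma>" using perm3_rot(5)[OF p] .
    then show False
      using pinch[OF Q(3) _ dd(5), of \<alpha> \<beta> \<gamma>, unfolded pos] up[OF 1(2)] down[OF 1(1)]
        nx(1)[OF lev(2)] nx(3)[OF lev(1)] s by linarith
  next
    case 2
    then have 0: "f n \<beta> = 0" "f n \<gamma> = 0"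
      using between[OF Q(2) p] bnd(2) by linarith+
    have lt: "f n \<gamma> < f n \<alpha>" "f n \<alpha> > 0" using 0 bnd by linarith+
    have a: "f s \<beta> = 0"
      using highD[OF Q(2) perm3_rot(3)[OF p] dd(4) 0(1), unfolded pos] lt nx(2)[OF lev(2)] 0 by simp
    have b: "f s \<gamma> = 0"
      using highD[OF Q(2) perm3_rot(5)[OF perm3_rot(3)[OF p]] dd(4) 0(2), unfolded pos] lt nx(2)[OF lev(3)] 0 
        highD[OF Q(2) perm3_rot(4)[OF p] dd(4) 0(2), unfolded pos] by simp
    have "f s \<alpha> < f s \<gamma>"
      using lowA[OF Q(3) perm3_rot(5)[OF p] dd(5), unfolded pos] up[OF lt(1)] nx(3)[OF lev(1)] bnd(1) a by simp
    then show False using b range(1)[of s \<alpha>] by linarith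
  next
    case 3
    then have 0: "f n \<gamma> = N" "f n \<alpha> = N"
      using between[OF Q(2) perm3_rot(4)[OF p]] bnd(1) by linarith+
    have lt: "f n \<beta> < f n \<gamma>" "f n \<beta> < N" using 0 bnd by linarith+
    have a: "f s \<alpha> = N"
      using lowD[OF Q(2) perm3_rot(5)[OF p] dd(4) 0(2), unfolded pos] lt nx(4)[OF lev(1)] 0 by simp
    have b: "f s \<gamma> = N"
      using lowD[OF Q(2) perm3_rot(1)[OF p] dd(4) 0(1), unfolded pos] lt nx(4)[OF lev(3)] 0 by simp
    have "f s \<gamma> < f s \<beta>"
      using highA[OF Q(3) perm3_rot(3)[OF p] dd(5), unfolded pos] down[OF lt(1)] nx(1)[OF lev(2)] bnd(2) a by simp
    then show False using b range(2)[of s \<beta>] by linarith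
  qed
qed

end

section \<open>Columns with three distinct ranks\<close>

context ranking
begin

text \<open>The two zeros pass from \<open>x + d\<close> to the corner column
  \<open>x + d + e\<close> while level \<open>t\<close> keeps rising, so that at
  \<open>x + e\<close> it exceeds both adjacent columns and \<open>corner\<close> applies.\<close>

lemma full_beside:
  assumes "deep Q (Suc (Suc 0)) x" "perp d e" "perm3 a b t" "f (x + d) a = 0" "f (x + d) b = 0"
    "\<forall>l\<in>{0, 1, 2}. 0 < f x l \<and> f x l < f (x + d) t"
  shows "\<forall>l\<in>{0, 1, 2}. f (x + e) l = N"
proof -
  define y n s where "y = x + d" and "n = x + d + e" and "s = x + e"
  note dd = perp_dirs[OF assms(2)] perp_uminus(2)[OF assms(2)] perp_uminus(2)[OF perp_commute[OF assms(2)]]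
    perp_uminus(1)[OF assms(2)]
  have pos: "y + - d = x" "y + e = n" "n + - e = y" "n - d = s" "s + d = n" "s + - e = x"
    by (auto simp: y_def n_def s_def)
  note 1 = deep_step(1)[OF assms(1) dd(1)] deep_step(1)[OF assms(1) dd(2)]
  have Q: "y \<in> Q" "n \<in> Q" "s \<in> Q"
    unfolding n_def y_def s_def by (rule deep_mem[OF 1(1)] deep_mem[OF deep_step(1)[OF 1(1) dd(2)]] deep_mem[OF 1(2)])+
  have x: "0 < f x a \<and> f x a < f y t" "0 < f x b \<and> f x b < f y t" "0 < f x t \<and> f x t < f y t"
    using assms(6) unfolding perm3_all[OF assms(3)] y_def by blast+
  have y: "f y a = 0" "f y b = 0" "f y t > 0"
    using assms(4,5) x(1) unfolding y_def by linarith+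
  have nt: "f n t > f y t"
    using lowB[OF Q(1) perm3_rot(5)[OF assms(3)] dd(3), unfolded pos] y x by simp
  have na: "f n a = 0"
    using highD[OF Q(1) perm3_rot(3)[OF assms(3)] dd(3), unfolded pos] y x by simp
  have nb: "f n b = 0"
    using highD[OF Q(1) perm3_rot(4)[OF assms(3)] dd(3), unfolded pos] y x by simp
  have st: "f s t > f n t"
    using lowB[OF Q(2) perm3_rot(5)[OF assms(3)] dd(4), unfolded pos] na nb nt y by simp
  have "\<forall>l\<in>{0, 1, 2}. f (s + d) l < f s t \<and> f (s + - e) l < f s t"
    unfolding perm3_all[OF assms(3)] pos using st nt x na nb y by simp
  from corner[OF Q(3) assms(3) dd(5) this] show ?thesis unfolding s_def .
qed

text \<open>The lowest of the three has no lower site in its column and the highest no higher one,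
  so each needs three of its four horizontal neighbours on its side, and some direction serves both.
  The column in this direction encloses the ranks of column \<open>x\<close>; if its ranks are
  distinct, \<open>no_nested\<close> applies, otherwise \<open>full_beside\<close> or its
  dual.\<close>

lemma no_open_triple:
  assumes "deep Q (Suc (Suc 0)) x" "perm3 z u w" "0 < f x z" "f x z < f x u" "f x u < f x w" "f x w < N"
  shows False
proof -
  interpret R: ranking "\<lambda>x l. N - f x l" N Q by (rule rev_ranking)
  have xQ: "x \<in> Q" by (rule deep_mem[OF assms(1)])
  obtain p q where p0: "perp p q" using perp_swap[of "(1, 0)"] by (auto simp: dirs_def)
  have "\<exists>d\<in>dirs. f (x + d) z < f x z \<and> f (x + d) w > f x w"
  proof (rule ccontr)
    assume "\<not> ?thesis"
    then have n: "\<not> (f (x + d) z < f x z \<and> f (x + d) w > f x w)" if "d \<in> dirs" for d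
      using that by blast
    note n = n[OF perp_dirs(1)[OF p0]] n[OF perp_dirs(2)[OF p0]]
      n[OF uminus_dirs[OF perp_dirs(1)[OF p0]]] n[OF uminus_dirs[OF perp_dirs(2)[OF p0]]]
    note n = n[unfolded add_uminus_conv_diff]
    show False
      using n site(2,3)[OF xQ assms(2) p0] site(1,3)[OF xQ perm3_rot(5)[OF assms(2)] p0] assms(3-6)
      by (smt (verit))
  qed
  then obtain d where d: "d \<in> dirs" "f (x + d) z < f x z" "f (x + d) w > f x w"
    by blast
  obtain e where e: "perp d e" using perp_swap[OF d(1)] by blast
  have yQ: "x + d \<in> Q" using deep_mem[OF deep_step(1)[OF assms(1) d(1)]] .
  consider "f (x + d) u = f (x + d) z" | "f (x + d) u = f (x + d) w" | "f (x + d) u < f (x + d) z"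
    | "f (x + d) z < f (x + d) u" "f (x + d) u < f (x + d) w" | "f (x + d) u > f (x + d) w"
    by linarith
  then show False
  proof cases
    case 1
    then have 0: "f (x + d) z = 0" "f (x + d) u = 0"
      using between[OF yQ assms(2)] d(2) range(2)[of x z] by linarith+
    have x: "\<forall>l\<in>{0, 1, 2}. 0 < f x l \<and> f x l < f (x + d) w"
      unfolding perm3_all[OF assms(2)] using assms(3-6) d by linarith
    have "f (x + e) z = N" "f (x + - e) z = N"
      using full_beside[OF assms(1) e assms(2) 0 x] full_beside[OF assms(1) perp_uminus(1)[OF e] assms(2) 0 x]
      unfolding perm3_all[OF assms(2)] by blast+
    then show False
      using highB[OF xQ assms(2) perp_commute[OF e]] assms(3-6) by simp
  next
    case 2
    then have 0: "N - f (x + d) u = 0" "N - f (x + d) w = 0"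
      using between[OF yQ perm3_rot(4)[OF assms(2)]] d(3) range(1)[of x w] by linarith+
    have x: "\<forall>l\<in>{0, 1, 2}. 0 < N - f x l \<and> N - f x l < N - f (x + d) z"
      unfolding perm3_all[OF assms(2)] using assms(3-6) d by linarith
    have "N - f (x + e) w = N" "N - f (x + - e) w = N"
      using R.full_beside[OF assms(1) e perm3_rot(4)[OF assms(2)] 0 x] 
        R.full_beside[OF assms(1) perp_uminus(1)[OF e] perm3_rot(4)[OF assms(2)] 0 x]
      unfolding perm3_all[OF assms(2)] by blast+
    then show False
      using lowB[OF xQ perm3_rot(5)[OF assms(2)] perp_commute[OF e]] assms(3-6) by simp
  next
    case 3
    have "\<forall>l\<in>{0, 1, 2}. f (x + d) u < f x l \<and> f x l < f (x + d) w"
      unfolding perm3_all[OF assms(2)] using 3 assms(3-6) d by linarith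
    then show False
      using no_nested[OF assms(1) e perm3_rot(1)[OF assms(2)] 3] d assms(3-6) by linarith
  next
    case 4
    have "\<forall>l\<in>{0, 1, 2}. f (x + d) z < f x l \<and> f x l < f (x + d) w"
      unfolding perm3_all[OF assms(2)] using 4 assms(3-6) d by linarith
    then show False
      using no_nested[OF assms(1) e assms(2) 4] by linarith
  next
    case 5
    have "\<forall>l\<in>{0, 1, 2}. f (x + d) z < f x l \<and> f x l < f (x + d) u"
      unfolding perm3_all[OF assms(2)] using 5 assms(3-6) d by linarith
    then show False
      using no_nested[OF assms(1) e perm3_rot(3)[OF assms(2)] _ 5] d assms(3-6) by linarith
  qed
qed

text \<open>The bottom site counts as lower for the other two, which leaves \<open>m\<close> two
  lower and \<open>t\<close> three higher horizontal neighbours; among four directions one serves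
  both. Going around a unit square that starts in this direction, with the bottom level at 0 all
  along, leads to \<open>roof\<close>.\<close>

lemma no_half_open_triple:
  assumes "deep Q (Suc (Suc 0)) x" "perm3 b m t" "f x b = 0" "0 < f x m" "f x m < f x t" "f x t < N"
  shows False
proof -
  have xQ: "x \<in> Q" by (rule deep_mem[OF assms(1)])
  obtain p q where p0: "perp p q" using perp_swap[of "(1, 0)"] by (auto simp: dirs_def)
  have "\<exists>d\<in>dirs. f (x + d) m < f x m \<and> f (x + d) t > f x t"
  proof (rule ccontr)
    assume "\<not> ?thesis"
    then have n: "\<not> (f (x + d) m < f x m \<and> f (x + d) t > f x t)" if "d \<in> dirs" for d
      using that by blast
    note n = n[OF perp_dirs(1)[OF p0]] n[OF perp_dirs(2)[OF p0]]
      n[OF uminus_dirs[OF perp_dirs(1)[OF p0]]] n[OF uminus_dirs[OF perp_dirs(2)[OF p0]]]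
    note n = n[unfolded add_uminus_conv_diff]
    show False
      using n site(2,3)[OF xQ perm3_rot(1)[OF assms(2)] p0] site(1,3)[OF xQ perm3_rot(5)[OF assms(2)] p0] assms(3-6)
      by (smt (verit))
  qed
  then obtain d where d: "d \<in> dirs" "f (x + d) m < f x m" "f (x + d) t > f x t"
    by blast
  obtain e0 where e0: "perp d e0" using perp_swap[OF d(1)] by blast
  define y where "y = x + d"
  have yx: "y + - d = x" by (simp add: y_def)
  have yQ: "y \<in> Q" using deep_mem[OF deep_step(1)[OF assms(1) d(1)]] unfolding y_def .
  note E = perp_uminus(2)[OF e0]
  have b0: "f (x + g) b = 0" if "g \<in> dirs" for g
    using highE[OF xQ assms(2) e0 assms(3)] assms(4-6) that unfolding perp_cases(1)[OF e0] by auto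
  have y: "f y b = 0" "f y m < f x m" "f x t < f y t" "f y m < f y t" "0 < f y t" "0 < f x m" "f x t < f y t"
    using b0[OF d(1)] d assms(3-6) unfolding y_def by linarith+
  have ty: "f y t < f (y + e0) t" "f y t < f (y - e0) t"
    using lowB[OF yQ perm3_rot(5)[OF assms(2)] E, unfolded yx] y by simp_all
  \<comment> \<open>If \<open>f y m = 0\<close>, level \<open>m\<close> is 0 on both sides and level
    \<open>b\<close> on at least one; otherwise level \<open>b\<close> is 0 on both sides and level
    \<open>m\<close> drops on at least one.\<close>
  have "\<exists>e. perp d e \<and> f (y + e) b = 0 \<and> f (y + e) m \<le> f y m \<and> f (y + e) t > f y t"
  proof (cases "f y m = 0")
    case True
    have "f (y + e0) m = 0" "f (y - e0) m = 0"
      using highD[OF yQ perm3_rot(4)[OF assms(2)] E True, unfolded yx] y by simp_all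
    moreover have "f (y + e0) b = 0 \<or> f (y - e0) b = 0"
      using highD[OF yQ perm3_rot(3)[OF assms(2)] perp_commute[OF e0] y(1)] y(5) range(1)[of "y + e0" b] by linarith
    ultimately show ?thesis
      using ty e0 perp_uminus(1)[OF e0] True by (metis diff_conv_add_uminus order_refl)
  next
    case False
    then have m: "0 < f y m" using range(1)[of y m] by linarith
    have "f (y + e0) b = 0" "f (y - e0) b = 0"
      using highE[OF yQ assms(2) E y(1)] m y(5) by blast+
    moreover have "f (y + e0) m < f y m \<or> f (y - e0) m < f y m"
      using highA[OF yQ perm3_rot(4)[OF assms(2)] E y(4), unfolded yx, OF y(2)]
        site(3)[OF yQ perm3_rot(4)[OF assms(2)] E m] y range(2)[of y t] by linarith
    ultimately show ?thesis
      using ty e0 perp_uminus(1)[OF e0] by (metis diff_conv_add_uminus less_imp_le)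
  qed
  then obtain e where e: "perp d e" and n: "f (y + e) b = 0" "f (y + e) m \<le> f y m" "f (y + e) t > f y t"
    by blast
  define n s where "n = y + e" and "s = x + e"
  have pos: "n + - e = y" "n - d = s" "s + d = n" "s + - e = x"
    by (auto simp: y_def n_def s_def)
  note dd = perp_dirs[OF e] perp_uminus(2)[OF perp_commute[OF e]] perp_uminus(1)[OF e]
  note 1 = deep_step(1)[OF assms(1) dd(1)] deep_step(1)[OF assms(1) dd(2)]
  have Q: "n \<in> Q" "s \<in> Q"
    unfolding n_def y_def s_def by (rule deep_mem[OF deep_step(1)[OF 1(1) dd(2)]] deep_mem[OF 1(2)])+
  have st: "f n t < f s t"
    using lowB[OF Q(1) perm3_rot(5)[OF assms(2)] dd(3), unfolded pos] n y unfolding n_def by simp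
  have "f s b = 0" using b0[OF dd(2)] unfolding s_def .
  then show False
    using roof[OF Q(2) assms(2) dd(4), unfolded pos] st n y assms(5) unfolding n_def by simp
qed

lemma triple:
  assumes "deep Q (Suc (Suc 0)) x" "perm3 b m t" "f x b < f x m" "f x m < f x t"
  shows "f x b = 0 \<and> f x t = N"
proof -
  interpret R: ranking "\<lambda>x l. N - f x l" N Q by (rule rev_ranking)
  show ?thesis
    using no_open_triple[OF assms(1,2)] no_half_open_triple[OF assms(1,2)]
      R.no_half_open_triple[OF assms(1) perm3_rot(2)[OF assms(2)]] assms(3,4)
      range(1)[of x b] range(2)[of x t] by fastforce
qed

end

section \<open>Rays, and columns with two bottom sites\<close>

definition ray :: "int \<times> int \<Rightarrow> int \<times> int \<Rightarrow> nat \<Rightarrow> int \<times> int" where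
  "ray x d n = ((\<lambda>y. y + d) ^^ n) x"

lemma ray_0 [simp]: "ray x d 0 = x"
  and ray_Suc [simp]: "ray x d (Suc n) = ray x d n + d"
  by (simp_all add: ray_def)

context ranking
begin

text \<open>The column \<open>q\<close> that closes the square is full by \<open>corner\<close>, and
  then so is \<open>k\<close> beyond it; this forces zeros at \<open>g\<close> and \<open>h\<close>.
  Level \<open>t\<close> at \<open>x\<close> has the two zeros below it and \<open>x1\<close>,
  \<open>q\<close> above it, so it exceeds exactly one of \<open>g\<close> and \<open>h\<close>.
  Around the square \<open>x\<close>, \<open>g\<close>, \<open>r\<close>, \<open>h\<close> it rises
  from the higher one to \<open>r\<close> and would have to rise once more to the lower one.\<close>

lemma no_turn:
  assumes dp: "deep Q (Suc (Suc 0)) x" and de: "perp d e" and p: "perm3 a b t"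
    and x: "f x a = 0" "f x b = 0" "0 < f x t"
    and y: "f (x + d) a = 0" "f (x + d) b = 0" "f x t < f (x + d) t"
    and z: "f (x + d + e) a = 0" "f (x + d + e) b = 0" "f (x + d) t < f (x + d + e) t"
  shows False
proof -
  define x1 x2 q g h v r k where "x1 = x + d" and "x2 = x + d + e" and "q = x + e" and "g = x - d"
    and "h = x - e" and "v = x + d - e" and "r = x - d - e" and "k = x - d + e"
  note D = x1_def x2_def q_def g_def h_def v_def r_def k_def
  note dd = perp_dirs[OF de]
  note P = de perp_uminus[OF de] perp_uminus(1)[OF perp_uminus(2)[OF de]]
  note P = P P[THEN perp_commute]
  have pos: "x2 + - e = x1" "x2 - d = q" "q + d = x2" "q + - e = x" "q - d = k"
    "x + e = q" "x - e = h" "x - d = g" "x + d = x1" "h + e = x" "h + d = v" "h - d = r" "x1 + - d = x" "x1 - e = v"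
    "v + - d = h" "v + e = x1" "r + d = h" "r + e = g" "g + d = x" "g - e = r" "g + e = k"
    "x1 + e = x2"
    unfolding D by simp_all
  have Q: "x \<in> Q" "x1 \<in> Q" "x2 \<in> Q" "q \<in> Q" "g \<in> Q" "h \<in> Q" "v \<in> Q" "r \<in> Q"
    unfolding D using dp dd deep_step[OF deep_step(1)[OF dp dd(1)]] deep_step[OF deep_step(2)[OF dp dd(1)]] deep_step[OF dp]
    by (auto intro: deep_mem)
  note X = x y[folded x1_def] z[folded x1_def x2_def, unfolded pos]
  note pm = perm3_rot[OF p]
  have q: "f x2 t < f q t"
    using lowB[OF Q(3) pm(5) P(6), unfolded pos] X by simp
  have "\<forall>l\<in>{0, 1, 2}. f (q + d) l < f q t \<and> f (q + - e) l < f q t"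
    unfolding perm3_all[OF p] pos using q X by simp
  from corner[OF Q(4) p P(2) this] have qN: "f q a = N" "f q b = N" "f q t = N"
    unfolding perm3_all[OF p] by blast+
  have kN: "f k a = N" "f k b = N" "f k t = N"
    using lowC[OF Q(4) p P(2) qN(1), unfolded pos] lowC[OF Q(4) pm(1) P(2) qN(2), unfolded pos]
      lowC[OF Q(4) pm(5) P(2) qN(3), unfolded pos] X N_pos q qN by simp_all
  have zeros: "f g a = 0" "f g b = 0" "f h a = 0" "f h b = 0"
    using highD[OF Q(1) pm(3) P(5), unfolded pos] highD[OF Q(1) pm(4) P(5), unfolded pos] X qN N_pos by simp_all
  have "f g t < f x t \<and> f x t < f h t \<or> f h t < f x t \<and> f x t < f g t"
    using site[OF Q(1) pm(5) de, unfolded pos] X q range[of q t] by (smt (verit))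
  then show False
  proof (elim disjE conjE)
    assume gh: "f g t < f x t" "f x t < f h t"
    have v: "f h t < f v t" and r: "f h t < f r t"
      using lowB[OF Q(6) pm(5) P(5), unfolded pos] zeros gh X by simp_all
    have "f x1 t < f v t"
      using lowB[OF Q(2) pm(5) P(3), unfolded pos] X by simp
    then have "\<forall>l\<in>{0, 1, 2}. f (v + - d) l < f v t \<and> f (v + e) l < f v t"
      unfolding perm3_all[OF p] pos using v X zeros gh by simp
    from corner[OF Q(7) p P(3) this] have vN: "f v a = N" "f v b = N"
      unfolding perm3_all[OF p] by blast+
    have "f r a = 0" "f r b = 0"
      using highD[OF Q(6) pm(3) P(1), unfolded pos] highD[OF Q(6) pm(4) P(1), unfolded pos] X gh zeros vN N_pos by simp_all
    then show False
      using lowB[OF Q(8) pm(5) P(1), unfolded pos] r gh X by simp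
  next
    assume gh: "f h t < f x t" "f x t < f g t"
    have r: "f g t < f r t"
      using lowB[OF Q(5) pm(5) P(1), unfolded pos] zeros gh X by simp
    have "f r a = 0" "f r b = 0"
      using highD[OF Q(5) pm(3) P(5), unfolded pos] highD[OF Q(5) pm(4) P(5), unfolded pos] X gh zeros kN N_pos by simp_all
    then show False
      using lowB[OF Q(8) pm(5) P(5), unfolded pos] r gh X by simp
  qed
qed

text \<open>At \<open>x + d\<close> level \<open>t\<close> has three lower neighbours, so it rises
  in the other three directions. Each zero tolerates only one further higher neighbour, and by
  \<open>no_turn\<close> neither side direction keeps both zeros. So one zero is lost on each side
  and none straight ahead.\<close>

lemma climb:
  assumes dp: "deep Q (Suc (Suc 0)) x" and d: "d \<in> dirs" and p: "perm3 a b t"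
    and x: "f x a = 0" "f x b = 0" "0 < f x t"
    and y: "f (x + d) a = 0" "f (x + d) b = 0" "f x t < f (x + d) t"
  shows "f (x + d + d) a = 0" "f (x + d + d) b = 0" "f (x + d) t < f (x + d + d) t"
proof -
  obtain e where e: "perp d e" using perp_swap[OF d] by blast
  define y where "y = x + d"
  have yx: "y + - d = x" by (simp add: y_def)
  have yQ: "y \<in> Q" unfolding y_def by (rule deep_mem[OF deep_step(1)[OF dp d]])
  note Y = y[folded y_def]
  note pm = perm3_rot[OF p]
  have up: "f y t < f (y + d) t" "f y t < f (y + e) t" "f y t < f (y - e) t"
    using lowB[OF yQ pm(5) perp_uminus(2)[OF e], unfolded yx] Y x by simp_all
  have pa: "f (y + g) a = 0" "f (y - g) a = 0" if "perp g g'" "f (y + g') a \<noteq> 0" for g g'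
    using highD[OF yQ pm(3) perp_commute[OF that(1)] Y(1)] Y x that range(1)[of "y + g'" a] by auto
  have pb: "f (y + g) b = 0" "f (y - g) b = 0" if "perp g g'" "f (y + g') b \<noteq> 0" for g g'
    using highD[OF yQ pm(4) perp_commute[OF that(1)] Y(2)] Y x that range(1)[of "y + g'" b] by auto
  have opp: "f (y - e) a = 0" if "f (y + e) a \<noteq> 0"
    using highD[OF yQ pm(3) perp_commute[OF e] Y(1)] Y x that range(1)[of "y + e" a] by auto
  have opp': "f (y - e) b = 0" if "f (y + e) b \<noteq> 0"
    using highD[OF yQ pm(4) perp_commute[OF e] Y(2)] Y x that range(1)[of "y + e" b] by auto
  have t1: "\<not> (f (y + e) a = 0 \<and> f (y + e) b = 0)"
    using no_turn[OF dp e p x y] up(2) unfolding y_def by blast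
  have t2: "\<not> (f (y - e) a = 0 \<and> f (y - e) b = 0)"
    using no_turn[OF dp perp_uminus(1)[OF e] p x y] up(3) unfolding y_def by auto
  note c = perp_commute[OF e]
  show "f (x + d + d) a = 0" "f (x + d + d) b = 0" "f (x + d) t < f (x + d + d) t"
    using pa[OF c] pb[OF c] opp opp' t1 t2 up(1) unfolding y_def by blast+
qed

text \<open>Level \<open>t\<close> rises in three of the four directions, and each of the two zeros
  can be lost in only one of them.\<close>

lemma climb_start:
  assumes xQ: "x \<in> Q" and p: "perm3 a b t" and x: "f x a = 0" "f x b = 0" "0 < f x t" "f x t < N"
  shows "\<exists>d\<in>dirs. f (x + d) a = 0 \<and> f (x + d) b = 0 \<and> f x t < f (x + d) t"
proof (rule ccontr)
  obtain d e where de: "perp d e" using perp_swap[of "(1, 0)"] by (auto simp: dirs_def)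
  note pm = perm3_rot[OF p]
  assume "\<not> ?thesis"
  then have n: "\<not> (f (x + d) a = 0 \<and> f (x + d) b = 0 \<and> f x t < f (x + d) t)" if "d \<in> dirs" for d
    using that by blast
  have r: "f (x + d) a \<noteq> 0 \<longleftrightarrow> f (x + d) a > 0" "f (x + d) b \<noteq> 0 \<longleftrightarrow> f (x + d) b > 0" for d
    using range(1)[of "x + d" a] range(1)[of "x + d" b] by auto
  note n = n[OF perp_dirs(1)[OF de]] n[OF perp_dirs(2)[OF de]]
    n[OF uminus_dirs[OF perp_dirs(1)[OF de]]] n[OF uminus_dirs[OF perp_dirs(2)[OF de]]]
  note n = n[unfolded add_uminus_conv_diff]
  note r = r[of d] r[of e] r[of "- d"] r[of "- e"]
  note r = r[unfolded add_uminus_conv_diff]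
  have low: "ind (f (x + d) t < f x t) + ind (f (x - d) t < f x t) + ind (f (x + e) t < f x t) + ind (f (x - e) t < f x t) \<le> 1"
    using site(1)[OF xQ pm(5) de] x by simp
  have high: "ind (f (x + d) a > 0) + ind (f (x - d) a > 0) + ind (f (x + e) a > 0) + ind (f (x - e) a > 0) \<le> 1"
    "ind (f (x + d) b > 0) + ind (f (x - d) b > 0) + ind (f (x + e) b > 0) + ind (f (x - e) b > 0) \<le> 1"
    using site(2)[OF xQ p de] site(2)[OF xQ pm(1) de] x by simp_all
  show False
    using n r low high site(3)[OF xQ pm(5) de x(3,4)] by (smt (verit))
qed

text \<open>The rank at level \<open>t\<close> stays positive and still rises beyond the end of the
  ray, where it should be 0 or \<open>N\<close>.\<close>

lemma no_climb:
  assumes p: "perm3 a b t" and x: "f x a = 0" "f x b = 0" "0 < f x t" "f x t < N"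
    and lines: "\<forall>d\<in>dirs. \<exists>k. (f (ray x d k) t = 0 \<or> f (ray x d k) t = N) \<and> (\<forall>j\<le>k. deep Q (Suc (Suc 0)) (ray x d j))"
  shows False
proof -
  have "(1, 0) \<in> dirs" by (simp add: dirs_def)
  then obtain k0 where k0: "\<forall>j\<le>k0. deep Q (Suc (Suc 0)) (ray x (1, 0) j)" using lines by blast
  have xQ: "x \<in> Q" using deep_mem[OF k0[rule_format, of 0]] by simp
  obtain d where d: "d \<in> dirs" "f (x + d) a = 0 \<and> f (x + d) b = 0 \<and> f x t < f (x + d) t"
    using climb_start[OF xQ p x] by blast
  obtain k where k: "f (ray x d k) t = 0 \<or> f (ray x d k) t = N" "\<forall>j\<le>k. deep Q (Suc (Suc 0)) (ray x d j)"
    using lines d(1) by blast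
  have "f (ray x d j) a = 0 \<and> f (ray x d j) b = 0 \<and> 0 < f (ray x d j) t \<and>
    f (ray x d j + d) a = 0 \<and> f (ray x d j + d) b = 0 \<and> f (ray x d j) t < f (ray x d j + d) t" if "j \<le> k" for j
    using that
  proof (induction j)
    case 0
    show ?case using d x by simp
  next
    case (Suc j)
    then have IH: "f (ray x d j) a = 0" "f (ray x d j) b = 0" "0 < f (ray x d j) t"
      "f (ray x d j + d) a = 0" "f (ray x d j + d) b = 0" "f (ray x d j) t < f (ray x d j + d) t"
      and "deep Q (Suc (Suc 0)) (ray x d j)" using k(2) by simp_all
    from climb[OF this(7) d(1) p this(1-6)] show ?case using IH by simp
  qed
  from this[of k] k(1) range(2)[of "ray x d k + d" t] show False by auto
qed

section \<open>Columns with one bottom and one top site\<close>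

lemma wall_step:
  assumes dp: "deep Q (Suc 0) x" and de: "perp d e" and p: "perm3 b m t"
    and x: "f x b = 0" "f x t = N" "0 < f x m" and xm: "f x m < N" and w: "f (x + d) m = 0"
  shows "f (x + e) b = 0" "f (x + e) t = N" "f (x + e) m < N" "f (x + e + d) m = 0"
proof -
  have Q: "x \<in> Q" "x + d \<in> Q" "x + e \<in> Q"
    using deep_mem[OF dp] deep_step(1)[OF dp] perp_dirs[OF de] by (auto intro: deep_mem)
  note pm = perm3_rot[OF p] and dd = perp_uminus[OF de]
  show b: "f (x + e) b = 0"
    using highE[OF Q(1) p de x(1)] x N_pos by simp
  show t: "f (x + e) t = N"
    using lowE[OF Q(1) pm(5) de x(2)] x xm N_pos by simp
  have wt: "f (x + d) t = N"
    using lowE[OF Q(1) pm(5) de x(2)] x xm N_pos by simp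
  \<comment> \<open>The zero at \<open>x + d\<close> already has its two permitted higher
    neighbours, the site of rank \<open>N\<close> in its column and the intermediate site at
    \<open>x\<close>.\<close>
  have "f (x + d + e) m = 0"
    using highD[OF Q(2) pm(4) dd(2) w] wt x N_pos by simp
  then show w': "f (x + e + d) m = 0" by (simp add: add_ac)
  show "f (x + e) m < N"
    using lowA[OF Q(3) pm(1) perp_uminus(2)[OF perp_commute[OF de]]] b w' x range(2)[of "x + e" m] xm by fastforce
qed

text \<open>Beside the wall of zeros, level \<open>m\<close> has the bottom site, the wall and the
  previous column below it, so one step up is followed by another.\<close>

lemma no_wall_up:
  assumes de: "perp d e" and p: "perm3 b m t"
    and x: "f x b = 0" "f x t = N" "0 < f x m" "f x m < N" and w: "f (x + d) m = 0"
    and up: "f x m < f (x + e) m"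
    and k: "f (ray x e k) m = 0 \<or> f (ray x e k) m = N" "\<forall>j\<le>k. deep Q (Suc 0) (ray x e j)"
  shows False
proof -
  note pm = perm3_rot[OF p] and dd = perp_uminus[OF de]
  have "f (ray x e j) b = 0 \<and> f (ray x e j) t = N \<and> 0 < f (ray x e j) m \<and> f (ray x e j) m < N \<and>
    f (ray x e j + d) m = 0 \<and> f (ray x e j) m < f (ray x e j + e) m" if "j \<le> k" for j
    using that
  proof (induction j)
    case 0
    show ?case using x w up by simp
  next
    case (Suc j)
    define y z where "y = ray x e j" and "z = y + e"
    from Suc have IH: "f y b = 0" "f y t = N" "0 < f y m" "f y m < N" "f (y + d) m = 0" "f y m < f z m"
      by (simp_all add: y_def z_def)
    have dp: "deep Q (Suc 0) y" "deep Q (Suc 0) z"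
      using k(2)[rule_format, of j] k(2)[rule_format, of "Suc j"] Suc.prems unfolding y_def z_def ray_Suc by simp_all
    have zQ: "z \<in> Q" using deep_mem[OF dp(2)] .
    note Z = wall_step[OF dp(1) de p IH(1-5), folded z_def]
    have "z + - e = y" by (simp add: z_def)
    then have "f z m < f (z + e) m"
      using lowA[OF zQ pm(1) dd(1)] Z IH by simp
    then show ?case using Z IH unfolding y_def z_def by simp
  qed
  from this[of k] k(1) show False by auto
qed

text \<open>The bottom site and the wall are two lower neighbours, so level \<open>m\<close> rises
  in at least one of the two directions along the wall.\<close>

lemma no_wall:
  assumes de: "perp d e" and p: "perm3 b m t"
    and x: "f x b = 0" "f x t = N" "0 < f x m" "f x m < N" and w: "f (x + d) m = 0"
    and lines: "\<forall>e\<in>dirs. \<exists>k. (f (ray x e k) m = 0 \<or> f (ray x e k) m = N) \<and> (\<forall>j\<le>k. deep Q (Suc 0) (ray x e j))"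
  shows False
proof -
  note pm = perm3_rot[OF p] and dd = perp_uminus[OF de]
  obtain k where k: "f (ray x e k) m = 0 \<or> f (ray x e k) m = N" "\<forall>j\<le>k. deep Q (Suc 0) (ray x e j)"
    using lines perp_dirs(2)[OF de] by blast
  obtain k' where k': "f (ray x (- e) k') m = 0 \<or> f (ray x (- e) k') m = N" "\<forall>j\<le>k'. deep Q (Suc 0) (ray x (- e) j)"
    using lines perp_dirs(2)[OF dd(1)] by blast
  have xQ: "x \<in> Q" using k(2)[rule_format, of 0] deep_mem by simp
  have "f x m < f (x + e) m \<or> f x m < f (x + - e) m"
    using lowA[OF xQ pm(1) de] site(3)[OF xQ pm(1) de x(3,4)] w x by (cases "f (x + e) m < f x m") auto
  then show False
    using no_wall_up[OF de p x w _ k] no_wall_up[OF dd(1) p x w _ k'] by blast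
qed

text \<open>Levels \<open>b\<close> and \<open>t\<close> are 0 and \<open>N\<close> in every
  adjacent column, so the shape continues along the ray unless level \<open>m\<close> becomes 0 or
  \<open>N\<close> next door. That would be a wall or its dual, which is excluded by the rays that
  start at each column of the first ray.\<close>

lemma no_strip:
  assumes p: "perm3 b m t" and x: "f x b = 0" "f x t = N" "0 < f x m" "f x m < N"
    and de: "perp d e"
    and k: "f (ray x d k) m = 0 \<or> f (ray x d k) m = N" 
      "\<forall>j\<le>k. deep Q (Suc 0) (ray x d j) \<and> (\<forall>e\<in>dirs. \<exists>i. (f (ray (ray x d j) e i) m = 0 \<or> f (ray (ray x d j) e i) m = N)
        \<and> (\<forall>l\<le>i. deep Q (Suc 0) (ray (ray x d j) e l)))"
  shows False
proof -
  interpret R: ranking "\<lambda>x l. N - f x l" N Q by (rule rev_ranking)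
  note pm = perm3_rot[OF p] and dd = perp_uminus[OF de]
  have "f (ray x d j) b = 0 \<and> f (ray x d j) t = N \<and> 0 < f (ray x d j) m \<and> f (ray x d j) m < N" if "j \<le> k" for j
    using that
  proof (induction j)
    case 0
    show ?case using x by simp
  next
    case (Suc j)
    define y where "y = ray x d j"
    from Suc have IH: "f y b = 0" "f y t = N" "0 < f y m" "f y m < N"
      by (simp_all add: y_def)
    have dp: "deep Q (Suc 0) y" and lines: "\<forall>e\<in>dirs. \<exists>i. (f (ray y e i) m = 0 \<or> f (ray y e i) m = N)
        \<and> (\<forall>l\<le>i. deep Q (Suc 0) (ray y e l))"
      using k(2)[rule_format, of j] Suc.prems unfolding y_def by simp_all
    have yQ: "y \<in> Q" using deep_mem[OF dp] .
    have lines': "\<forall>e\<in>dirs. \<exists>i. (N - f (ray y e i) m = 0 \<or> N - f (ray y e i) m = N)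
        \<and> (\<forall>l\<le>i. deep Q (Suc 0) (ray y e l))"
    proof
      fix e :: "int \<times> int" assume "e \<in> dirs"
      then obtain i where "f (ray y e i) m = 0 \<or> f (ray y e i) m = N" "\<forall>l\<le>i. deep Q (Suc 0) (ray y e l)"
        using lines by blast
      then show "\<exists>i. (N - f (ray y e i) m = 0 \<or> N - f (ray y e i) m = N) \<and> (\<forall>l\<le>i. deep Q (Suc 0) (ray y e l))"
        by (intro exI[of _ i]) auto
    qed
    have "f (y + d) b = 0" "f (y + d) t = N"
      using highE[OF yQ p de IH(1)] lowE[OF yQ pm(5) de IH(2)] IH N_pos by simp_all
    moreover have "f (y + d) m \<noteq> 0"
      using no_wall[OF de p IH _ lines] by blast
    moreover have "f (y + d) m \<noteq> N"
      using R.no_wall[OF de pm(2) _ _ _ _ _ lines'] IH by auto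
    ultimately show ?case
      using range[of "y + d" m] unfolding y_def by simp
  qed
  from this[of k] k(1) show False by auto
qed

text \<open>A column with a rank strictly between 0 and \<open>N\<close> has either three distinct
  ranks, whose extremes are 0 and \<open>N\<close> by \<open>triple\<close>, or a tie at 0, or a tie
  at \<open>N\<close>. \<open>no_strip\<close>, \<open>no_climb\<close> and the dual of
  \<open>no_climb\<close> exclude these in turn.\<close>

lemma no_active:
  assumes F: "\<And>y l. y \<in> F \<Longrightarrow> l \<in> {0, 1, 2} \<Longrightarrow> f y l = 0"
    and lines: "\<And>d. d \<in> dirs \<Longrightarrow> \<exists>k. ray x d k \<in> F \<and> (\<forall>j\<le>k. deep Q (Suc (Suc 0)) (ray x d j) \<and>
      (\<forall>e\<in>dirs. \<exists>i. ray (ray x d j) e i \<in> F \<and> (\<forall>l\<le>i. deep Q (Suc (Suc 0)) (ray (ray x d j) e l))))"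
    and l: "l \<in> {0, 1, 2}"
  shows "f x l = 0 \<or> f x l = N"
proof -
  interpret R: ranking "\<lambda>x l. N - f x l" N Q by (rule rev_ranking)
  obtain d e where de: "perp d e" using perp_swap[of "(1, 0)"] by (auto simp: dirs_def)
  obtain k where k: "ray x d k \<in> F" "\<forall>j\<le>k. deep Q (Suc (Suc 0)) (ray x d j) \<and>
      (\<forall>e\<in>dirs. \<exists>i. ray (ray x d j) e i \<in> F \<and> (\<forall>l\<le>i. deep Q (Suc (Suc 0)) (ray (ray x d j) e l)))"
    using lines[OF perp_dirs(1)[OF de]] by blast
  have dp: "deep Q (Suc (Suc 0)) x" using k(2)[rule_format, of 0] by simp
  then have xQ: "x \<in> Q" by (rule deep_mem)
  obtain b m t where p: "perm3 b m t" and s: "f x b \<le> f x m" "f x m \<le> f x t"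
    by (rule perm3_sorted)
  note pm = perm3_rot[OF p]
  have lev: "b \<in> {0, 1, 2}" "m \<in> {0, 1, 2}" "t \<in> {0, 1, 2}"
    unfolding perm3_mem[OF p] by simp_all
  have dS: "deep Q (Suc 0) y" if "deep Q (Suc (Suc 0)) y" for y
    using that by simp
  have straight: "\<exists>k. (f (ray x d k) g = 0 \<or> f (ray x d k) g = N) \<and> (\<forall>j\<le>k. deep Q (Suc (Suc 0)) (ray x d j))" if "d \<in> dirs" "g \<in> {0, 1, 2}" for d g
    using lines[OF that(1)] F that(2) by meson
  consider "f x b < f x m" "f x m < f x t" | "f x b = f x m" "f x m < f x t" | "f x b < f x m" "f x m = f x t"
    | "f x b = f x m" "f x m = f x t"
    using s by linarith
  then have "(f x b = 0 \<or> f x b = N) \<and> (f x m = 0 \<or> f x m = N) \<and> (f x t = 0 \<or> f x t = N)"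
  proof cases
    case 1
    then have bt: "f x b = 0" "f x t = N" using triple[OF dp p] by blast+
    have m: "0 < f x m" "f x m < N" using 1 bt by simp_all
    have "f (ray x d k) m = 0 \<or> f (ray x d k) m = N" using F[OF k(1) lev(2)] by simp
    moreover have "\<forall>j\<le>k. deep Q (Suc 0) (ray x d j) \<and> (\<forall>e\<in>dirs. \<exists>i. (f (ray (ray x d j) e i) m = 0 \<or> f (ray (ray x d j) e i) m = N)
        \<and> (\<forall>l\<le>i. deep Q (Suc 0) (ray (ray x d j) e l)))"
      using k(2) F[OF _ lev(2)] dS by meson
    ultimately show ?thesis
      using no_strip[OF p bt m de] by blast
  next
    case 2
    then have b: "f x b = 0" "f x m = 0"
      using between[OF xQ p] range(2)[of x t] by linarith+
    have "\<not> f x t < N"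
      using no_climb[OF p b] 2 b straight lev(3) by auto
    then show ?thesis using b range(2)[of x t] by simp
  next
    case 3
    then have b: "f x m = N" "f x t = N"
      using between[OF xQ pm(4)] range(1)[of x b] by linarith+
    have "\<exists>k. (N - f (ray x d k) b = 0 \<or> N - f (ray x d k) b = N) \<and> (\<forall>j\<le>k. deep Q (Suc (Suc 0)) (ray x d j))"
      if d: "d \<in> dirs" for d
    proof -
      obtain k where "f (ray x d k) b = 0 \<or> f (ray x d k) b = N" "\<forall>j\<le>k. deep Q (Suc (Suc 0)) (ray x d j)"
        using straight[OF d lev(1)] by blast
      then show ?thesis by (intro exI[of _ k]) auto
    qed
    then have L: "\<forall>d\<in>dirs. \<exists>k. (N - f (ray x d k) b = 0 \<or> N - f (ray x d k) b = N) \<and> (\<forall>j\<le>k. deep Q (Suc (Suc 0)) (ray x d j))"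
      by blast
    have "\<not> 0 < f x b"
    proof
      assume "0 < f x b"
      then show False
        by (intro R.no_climb[OF pm(4) _ _ _ _ L]) (use 3 b in linarith)+
    qed
    then show ?thesis using b range(1)[of x b] by simp
  next
    case 4
    then show ?thesis using between[OF xQ p] by auto
  qed
  then show ?thesis using l unfolding perm3_mem[OF p] by blast
qed

end

section \<open>Reachable descents\<close>

lemma slab_iff: "(x, y, z) \<in> slab \<longleftrightarrow> z \<in> {0, 1, 2}"
  by (simp add: slab_def)

lemma finite_neighbors: "v \<in> slab \<Longrightarrow> finite (neighbors v)"
  using card_neighbors[of v] by (metis card.infinite zero_neq_numeral)

lemma neighbors_slab: "w \<in> neighbors v \<Longrightarrow> w \<in> slab"
  by (cases v; cases w) (auto simp: mem_neighbors_iff slab_iff)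

lemma neighbors_sym: "w \<in> neighbors v \<longleftrightarrow> v \<in> neighbors w"
  unfolding neighbors_def by (simp add: insert_commute)

lemma neighbors_irrefl: "v \<notin> neighbors v"
  by (cases v) (auto simp: mem_neighbors_iff doubleton_eq_iff)

definition site_of :: "int \<times> int \<Rightarrow> int \<Rightarrow> vertex" where
  "site_of x l = (fst x, snd x, l)"

lemma site_of_slab: "l \<in> {0, 1, 2} \<Longrightarrow> site_of x l \<in> slab"
  by (simp add: site_of_def slab_def)

lemma sum_neighbors:
  fixes g :: "vertex \<Rightarrow> nat"
  assumes "l \<in> {0, 1, 2}"
  shows "(\<Sum>m\<in>{0, 1, 2} - {l}. g (site_of x m)) + (\<Sum>d\<in>dirs. g (site_of (x + d) l)) = sum g (neighbors (site_of x l))"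
proof -
  obtain a b where x: "x = (a, b)" by fastforce
  let ?A = "(\<lambda>d. site_of (x + d) l) ` dirs" and ?B = "site_of x ` ({0, 1, 2} - {l})"
  have "neighbors (site_of x l) = ?A \<union> ?B"
    unfolding site_of_def x fst_conv snd_conv neighbors_eq[OF assms] by (simp add: dirs_def)
  moreover have "?A \<inter> ?B = {}" by (auto simp: site_of_def)
  moreover have "sum g ?A = (\<Sum>d\<in>dirs. g (site_of (x + d) l))"
    by (subst sum.reindex) (auto simp: inj_on_def site_of_def prod_eq_iff)
  moreover have "sum g ?B = (\<Sum>m\<in>{0, 1, 2} - {l}. g (site_of x m))"
    by (subst sum.reindex) (auto simp: inj_on_def site_of_def)
  moreover have "finite ?A" "finite ?B" by (simp_all add: dirs_def)
  ultimately show ?thesis by (simp add: sum.union_disjoint)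
qed

lemma num_low_neighbors:
  assumes "l \<in> {0, 1, 2}"
  shows "num_low (\<lambda>x l. h (site_of x l)) x l = card {w \<in> neighbors (site_of x l). h w < h (site_of x l)}"
  unfolding num_low_def sum_neighbors[OF assms, of "\<lambda>w. of_bool (h w < h (site_of x l))" x]
  using finite_neighbors[OF site_of_slab[OF assms]] by (simp add: Int_def)

lemma num_high_neighbors:
  assumes "l \<in> {0, 1, 2}"
  shows "num_high (\<lambda>x l. h (site_of x l)) x l = card {w \<in> neighbors (site_of x l). h w > h (site_of x l)}"
  unfolding num_high_def sum_neighbors[OF assms, of "\<lambda>w. of_bool (h w > h (site_of x l))" x]
  using finite_neighbors[OF site_of_slab[OF assms]] by (simp add: Int_def)

text \<open>\<open>P\<close> is the set of sites with one of the two spin values and each flip adds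
  a site to it, so all flips of a sequence have the same direction. Three neighbours out of six in
  \<open>P\<close> means zero energy, more than three means positive energy.\<close>

fun ties :: "vertex set \<Rightarrow> vertex set \<Rightarrow> vertex list \<Rightarrow> bool" where
  "ties Q P [] \<longleftrightarrow> True"
| "ties Q P (u # us) \<longleftrightarrow> u \<in> Q - P \<and> card (neighbors u \<inter> P) = 3 \<and> ties Q (insert u P) us"

definition descends :: "vertex set \<Rightarrow> vertex set \<Rightarrow> vertex list \<Rightarrow> vertex \<Rightarrow> bool" where
  "descends Q P us u \<longleftrightarrow> ties Q P us \<and> u \<in> Q - (P \<union> set us) \<and> card (neighbors u \<inter> (P \<union> set us)) > 3"

lemma ties_append: "ties Q P (us @ vs) \<longleftrightarrow> ties Q P us \<and> ties Q (P \<union> set us) vs"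
  by (induction us arbitrary: P) auto

lemma ties_distinct: "ties Q P us \<Longrightarrow> distinct us \<and> set us \<subseteq> Q - P"
  by (induction us arbitrary: P) auto

lemma ties_nth:
  assumes "ties Q P us" "i < length us"
  shows "card (neighbors (us ! i) \<inter> (P \<union> set (take i us))) = 3"
proof -
  have "ties Q P (take i us @ us ! i # drop (Suc i) us)"
    using assms by (simp add: id_take_nth_drop[symmetric])
  then show ?thesis unfolding ties_append by simp
qed

text \<open>No sequence repeats a site, so a longest one exists. A site left outside with three
  neighbours in the set would prolong it, and one with more would be a descent.\<close>

lemma ties_maximal:
  assumes "finite Q" "\<nexists>us u. descends Q P us u"
  obtains us where "ties Q P us" "\<And>u. u \<in> Q - (P \<union> set us) \<Longrightarrow> card (neighbors u \<inter> (P \<union> set us)) \<le> 2"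
proof -
  have len: "length us \<le> card Q" if "ties Q P us" for us
    using ties_distinct[OF that] assms(1) by (metis Diff_subset card_mono distinct_card order_trans)
  have "ties Q P []" by simp
  then obtain us where us: "ties Q P us" "\<And>vs. ties Q P vs \<Longrightarrow> length vs \<le> length us"
    using ex_has_greatest_nat[of "ties Q P" "[]" length "Suc (card Q)"] len le_imp_less_Suc by metis
  have "card (neighbors u \<inter> (P \<union> set us)) \<le> 2" if u: "u \<in> Q - (P \<union> set us)" for u
  proof (rule ccontr)
    assume "\<not> ?thesis"
    moreover have "card (neighbors u \<inter> (P \<union> set us)) \<le> 3"
      using assms(2) us(1) u unfolding descends_def by (metis not_less)
    ultimately have "ties Q P (us @ [u])"
      using us(1) u by (simp add: ties_append)
    from us(2)[OF this] show False by simp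
  qed
  with us(1) that show ?thesis by blast
qed

text \<open>At least four of six neighbours lie in \<open>B\<close>, which leaves at most two in
  \<open>P\<close>; hence no site of \<open>B\<close> can be the first one to flip.\<close>

lemma ties_avoid:
  assumes "ties Q P us" "B \<inter> P = {}" "B \<subseteq> slab" "\<And>b. b \<in> B \<Longrightarrow> 4 \<le> card (neighbors b \<inter> B)"
  shows "B \<inter> set us = {}"
  using assms(1,2)
proof (induction us arbitrary: P)
  case (Cons u us)
  have "u \<notin> B"
  proof
    assume u: "u \<in> B"
    then have us: "u \<in> slab" using assms(3) by blast
    have "card (neighbors u \<inter> B) + card (neighbors u \<inter> P) = card (neighbors u \<inter> B \<union> neighbors u \<inter> P)"
      using Cons.prems(2) finite_neighbors[OF us] by (intro card_Un_disjoint[symmetric]) auto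
    also have "\<dots> \<le> card (neighbors u)"
      using finite_neighbors[OF us] by (intro card_mono) auto
    finally show False using assms(4)[OF u] Cons.prems(1) card_neighbors[OF us] by simp
  qed
  then show ?case using Cons by auto
qed simp

lemma card_complement:
  assumes "v \<in> slab"
  shows "card (neighbors v \<inter> - S) + card (neighbors v \<inter> S) = 6"
proof -
  have "card (neighbors v \<inter> - S) + card (neighbors v \<inter> S) = card (neighbors v \<inter> - S \<union> neighbors v \<inter> S)"
    using finite_neighbors[OF assms] by (intro card_Un_disjoint[symmetric]) auto
  also have "neighbors v \<inter> - S \<union> neighbors v \<inter> S = neighbors v" by blast
  finally show ?thesis using card_neighbors[OF assms] by simp
qed

section \<open>Enclosure by columns that cannot flip\<close>

definition sturdy :: "vertex set \<Rightarrow> (int \<times> int) set" where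
  "sturdy P = {x. \<exists>B\<subseteq>P. B \<subseteq> slab \<and> (\<forall>b\<in>B. 4 \<le> card (neighbors b \<inter> B)) \<and> (\<forall>l\<in>{0, 1, 2}. site_of x l \<in> B)}"

text \<open>The rays that start at points of a ray are there for \<open>no_strip\<close>, which has
  to exclude walls at each column it passes.\<close>

definition enclosed :: "(int \<times> int) set \<Rightarrow> (int \<times> int) set \<Rightarrow> int \<times> int \<Rightarrow> bool" where
  "enclosed F Q x \<longleftrightarrow> (\<forall>d\<in>dirs. \<exists>k. ray x d k \<in> F \<and> (\<forall>j\<le>k. deep Q (Suc (Suc 0)) (ray x d j) \<and>
      (\<forall>e\<in>dirs. \<exists>i. ray (ray x d j) e i \<in> F \<and> (\<forall>l\<le>i. deep Q (Suc (Suc 0)) (ray (ray x d j) e l)))))"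

text \<open>If neither a sequence of ties raising spins nor one lowering spins leads to a strict descent,
  concatenate a maximal lowering sequence, reversed, with a maximal raising one. The position in
  this list ranks the sites: exactly three neighbours of a listed site precede it.\<close>

theorem descends_if_enclosed:
  assumes fin: "finite Q" and en: "enclosed (sturdy P) Q x" and l: "l \<in> {0, 1, 2}"
    and v: "if site_of x l \<in> P then 3 \<le> card (neighbors (site_of x l) - P) else 3 \<le> card (neighbors (site_of x l) \<inter> P)"
  defines "S \<equiv> case_prod site_of ` (Q \<times> {0, 1, 2})"
  shows "(\<exists>us u. descends S P us u) \<or> (\<exists>us u. descends S (- P) us u)"
proof (rule ccontr)
  assume neg: "\<not> ?thesis"
  have finS: "finite S" using fin by (simp add: S_def)
  have SS: "S \<subseteq> slab" using site_of_slab by (auto simp: S_def)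
  have inS: "site_of y m \<in> S" if "y \<in> Q" "m \<in> {0, 1, 2}" for y m using that by (force simp: S_def)
  obtain us where us: "ties S P us" "\<And>u. u \<in> S - (P \<union> set us) \<Longrightarrow> card (neighbors u \<inter> (P \<union> set us)) \<le> 2"
    using ties_maximal[OF finS] neg by metis
  obtain vs where vs: "ties S (- P) vs" "\<And>u. u \<in> S - (- P \<union> set vs) \<Longrightarrow> card (neighbors u \<inter> (- P \<union> set vs)) \<le> 2"
    using ties_maximal[OF finS] neg by metis
  \<comment> \<open>Started from \<open>A\<close>, the list first restores \<open>P\<close> and then
    extends it, so it is a single monotone sequence of ties.\<close>
  define L where "L = rev vs @ us"
  define A where "A = P - set vs"
  have dist: "distinct L" "set L \<subseteq> S" "set L \<inter> A = {}" "A \<union> set L = P \<union> set us" "- P \<union> set vs = - A"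
    using ties_distinct[OF us(1)] ties_distinct[OF vs(1)] by (auto simp: L_def A_def)
  have nth: "card (neighbors (L ! i) \<inter> (A \<union> set (take i L))) = 3" if i: "i < length L" for i
  proof (cases "i < length vs")
    case False
    then have "L ! i = us ! (i - length vs)" "A \<union> set (take i L) = P \<union> set (take (i - length vs) us)"
      using ties_distinct[OF vs(1)] by (auto simp: L_def A_def nth_append)
    then show ?thesis using ties_nth[OF us(1), of "i - length vs"] i False by (simp add: L_def)
  next
    case True
    define j where "j = length vs - Suc i"
    have j: "j < length vs" "i = length vs - Suc j" using True by (auto simp: j_def)
    have Li: "L ! i = vs ! j" using True by (simp add: L_def nth_append rev_nth j_def)
    have tk: "set (take i L) = set (drop (Suc j) vs)"
      using True j by (simp add: L_def take_rev)
    have split: "vs = take j vs @ vs ! j # drop (Suc j) vs" using j by (simp add: id_take_nth_drop[symmetric])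
    have dv: "distinct vs" "set vs \<subseteq> P" using ties_distinct[OF vs(1)] by auto
    have vj: "vs ! j \<in> slab" using ties_distinct[OF vs(1)] j(1) SS nth_mem by blast
    have "set vs = set (take j vs) \<union> {vs ! j} \<union> set (drop (Suc j) vs)"
      by (subst split) simp
    moreover have "set (take j vs) \<inter> set (drop (Suc j) vs) = {}"
      using dv(1) by (subst (asm) split) auto
    moreover have "vs ! j \<notin> set (drop (Suc j) vs)"
      using dv(1) by (subst (asm) split) auto
    \<comment> \<open>When \<open>vs ! j\<close> left the set, three of its neighbours were outside.
      The three inside are those in \<open>A\<close> and those that left later, and the latter
      precede it in the reversed list.\<close>
    ultimately have "neighbors (vs ! j) \<inter> (A \<union> set (drop (Suc j) vs)) = neighbors (vs ! j) \<inter> - (- P \<union> set (take j vs))"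
      using dv(2) neighbors_irrefl[of "vs ! j"] unfolding A_def by blast
    then show ?thesis
      using ties_nth[OF vs(1) j(1)] card_complement[OF vj, of "- P \<union> set (take j vs)"] unfolding Li tk by simp
  qed
  \<comment> \<open>Positions are shifted by one, which frees rank 0 for \<open>A\<close> and rank
    \<open>N\<close> for the sites outside \<open>A\<close> and the list.\<close>
  define N where "N = int (length L) + 1"
  define idx where "idx w = (THE i. i < length L \<and> L ! i = w)" for w
  have idx: "idx (L ! i) = i" if "i < length L" for i
    unfolding idx_def using dist(1) that by (auto simp: nth_eq_iff_index_eq)
  define h where "h w = (if w \<in> A then 0 else if w \<in> set L then int (idx w) + 1 else N)" for w
  have hL: "h (L ! i) = int i + 1" if "i < length L" for i
  proof -
    have "L ! i \<in> set L" "L ! i \<notin> A" using nth_mem[OF that] dist(3) by blast+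
    then show ?thesis using idx[OF that] unfolding h_def by simp
  qed
  have h0: "h w = 0 \<longleftrightarrow> w \<in> A" and hN: "h w = N \<longleftrightarrow> w \<notin> A \<union> set L" and rng: "0 \<le> h w" "h w \<le> N" for w
    using idx by (auto simp: h_def N_def in_set_conv_nth)
  have low: "h w < int i + 1 \<longleftrightarrow> w \<in> A \<union> set (take i L)" if i: "i < length L" for w i
  proof -
    have "w \<in> set (take i L) \<longleftrightarrow> (\<exists>j<i. w = L ! j)"
      using i by (auto simp: in_set_conv_nth)
    moreover have "h w < int i + 1 \<longleftrightarrow> w \<in> A \<or> (\<exists>j<i. w = L ! j)"
    proof (cases "w \<in> set L")
      case True
      then obtain k where k: "k < length L" "w = L ! k" by (auto simp: in_set_conv_nth)
      have "w \<notin> A" using True dist(3) by blast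
      moreover have "(\<exists>j<i. w = L ! j) \<longleftrightarrow> k < i"
        using k dist(1) i by (auto simp: nth_eq_iff_index_eq)
      moreover have "int k + 1 < int i + 1 \<longleftrightarrow> k < i" by linarith
      ultimately show ?thesis using hL[OF k(1)] k(2) by metis
    next
      case False
      then show ?thesis using i by (auto simp: h_def N_def)
    qed
    ultimately show ?thesis by blast
  qed
  interpret ranking "\<lambda>y m. h (site_of y m)" N Q
  proof
    fix y :: "int \<times> int" and m :: int
    assume y: "y \<in> Q" and m: "m \<in> {0, 1, 2}"
    let ?w = "site_of y m"
    note nb = num_low_neighbors[OF m, of h y] num_high_neighbors[OF m, of h y]
    have wS: "?w \<in> S" "?w \<in> slab" using inS[OF y m] SS by auto
    show "num_low (\<lambda>y m. h (site_of y m)) y m = 3 \<and> num_high (\<lambda>y m. h (site_of y m)) y m = 3" if "0 < h ?w" "h ?w < N"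
    proof -
      have "?w \<in> set L" using that h0[of ?w] hN[of ?w] by auto
      then obtain i where i: "i < length L" "?w = L ! i" by (auto simp: in_set_conv_nth)
      have eq: "{u \<in> neighbors ?w. h u < h ?w} = neighbors ?w \<inter> (A \<union> set (take i L))"
        using low[OF i(1)] hL[OF i(1)] i(2) by auto
      have neq: "h u \<noteq> h ?w" if "u \<in> neighbors ?w" for u
      proof
        assume eq: "h u = h ?w"
        then have "u \<in> set L" using \<open>0 < h ?w\<close> \<open>h ?w < N\<close> h0[of u] hN[of u] by auto
        then obtain k where "k < length L" "u = L ! k" by (auto simp: in_set_conv_nth)
        then have "u = ?w" using eq i hL by simp
        then show False using that neighbors_irrefl by blast
      qed
      have "h u > h ?w \<longleftrightarrow> u \<notin> A \<union> set (take i L)" if "u \<in> neighbors ?w" for u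
        using low[OF i(1), of u] hL[OF i(1)] neq[OF that] i(2) by auto
      then have "{u \<in> neighbors ?w. h u > h ?w} = neighbors ?w \<inter> - (A \<union> set (take i L))"
        by blast
      then show ?thesis
        using nth[OF i(1)] card_complement[OF wS(2), of "A \<union> set (take i L)"] unfolding nb eq by (simp add: i(2)[symmetric])
    qed
    show "num_high (\<lambda>y m. h (site_of y m)) y m \<le> 2" if "h ?w = 0"
    proof -
      have E: "{u \<in> neighbors ?w. h u > h ?w} = neighbors ?w \<inter> (- P \<union> set vs)"
      proof -
        have "h u > h ?w \<longleftrightarrow> u \<in> - P \<union> set vs" for u
          using that h0[of u] rng(1)[of u] unfolding dist(5) by auto
        then show ?thesis by blast
      qed
      have "?w \<in> S - (- P \<union> set vs)" using wS(1) that h0[of ?w] unfolding dist(5) by blast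
      then show ?thesis unfolding nb E by (rule vs(2))
    qed
    show "num_low (\<lambda>y m. h (site_of y m)) y m \<le> 2" if "h ?w = N"
    proof -
      have E: "{u \<in> neighbors ?w. h u < h ?w} = neighbors ?w \<inter> (P \<union> set us)"
      proof -
        have "h u < h ?w \<longleftrightarrow> u \<in> P \<union> set us" for u
          using that hN[of u] rng(2)[of u] unfolding dist(4)[symmetric] by auto
        then show ?thesis by blast
      qed
      have "?w \<in> S - (P \<union> set us)" using wS(1) that hN[of ?w] unfolding dist(4) by blast
      then show ?thesis unfolding nb E by (rule us(2))
    qed
  qed (use rng in \<open>auto simp: N_def\<close>)
  have "h (site_of y m) = 0" if sy: "y \<in> sturdy P" and m: "m \<in> {0, 1, 2}" for y m
  proof -
    obtain B where B: "B \<subseteq> P" "B \<subseteq> slab" "\<And>b. b \<in> B \<Longrightarrow> 4 \<le> card (neighbors b \<inter> B)" "\<forall>m\<in>{0, 1, 2}. site_of y m \<in> B"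
      using sy unfolding sturdy_def mem_Collect_eq by (elim exE conjE) blast
    have yB: "site_of y m \<in> B" using B(4) m by (rule bspec)
    have "B \<inter> set vs = {}" by (rule ties_avoid[OF vs(1) _ B(2,3)]) (use B(1) in auto)
    then show ?thesis unfolding h0 A_def using B(1) yB by blast
  qed
  from no_active[of "sturdy P", OF this _ l, of x] en
  have ext: "h (site_of x l) = 0 \<or> h (site_of x l) = N"
    unfolding enclosed_def by blast
  have xQ: "x \<in> Q"
  proof -
    have "(1, 0) \<in> dirs" by (simp add: dirs_def)
    then obtain k where "\<forall>j\<le>k. deep Q (Suc (Suc 0)) (ray x (1, 0) j)" using en unfolding enclosed_def by blast
    from this[rule_format, of 0] show ?thesis using deep_mem by simp
  qed
  have wS: "site_of x l \<in> S" by (rule inS[OF xQ l])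
  have fn: "finite (neighbors (site_of x l))"
    by (rule finite_neighbors[OF site_of_slab[OF l]])
  \<comment> \<open>The given site could flip at the start, so by maximality it occurs in one of the
    two sequences and has an intermediate rank.\<close>
  show False
  proof (cases "site_of x l \<in> P")
    case True
    have "card (neighbors (site_of x l) \<inter> - P) \<le> card (neighbors (site_of x l) \<inter> (- P \<union> set vs))"
      using fn by (intro card_mono) auto
    then have "site_of x l \<in> set vs"
      using vs(2)[of "site_of x l"] wS v True by (fastforce simp: Diff_eq)
    then show False using ext unfolding h0 hN by (auto simp: A_def L_def)
  next
    case False
    have "card (neighbors (site_of x l) \<inter> P) \<le> card (neighbors (site_of x l) \<inter> (P \<union> set us))"
      using fn by (intro card_mono) auto
    then have "site_of x l \<in> set us"
      using us(2)[of "site_of x l"] wS v False by fastforce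
    then show False using ext False unfolding h0 hN by (auto simp: A_def L_def)
  qed
qed

section \<open>Product measures\<close>

lemma sets_PiM_box:
  assumes "J \<subseteq> I" "finite J" "\<And>j. j \<in> J \<Longrightarrow> F j \<in> sets M"
  shows "{x \<in> space (PiM I (\<lambda>_. M)). \<forall>j\<in>J. x j \<in> F j} \<in> sets (PiM I (\<lambda>_. M))"
proof (rule sets.sets_Collect_finite_All[OF _ assms(2)])
  show "{x \<in> space (PiM I (\<lambda>_. M)). x j \<in> F j} \<in> sets (PiM I (\<lambda>_. M))" if "j \<in> J" for j
    using assms(1) assms(3)[OF that] sets.sets_into_space[OF assms(3)[OF that]] that
    by (intro sets_Collect_single') (auto simp: Int_def[symmetric] Int_absorb1)
qed

lemma PiM_const_eqI:
  assumes M: "prob_space M" and D: "sets D = sets (PiM I (\<lambda>_. M))"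
    and eq: "\<And>J F. finite J \<Longrightarrow> J \<subseteq> I \<Longrightarrow> (\<And>j. j \<in> J \<Longrightarrow> F j \<in> sets M) \<Longrightarrow>
      emeasure D {x \<in> space D. \<forall>j\<in>J. x j \<in> F j} = (\<Prod>j\<in>J. emeasure M (F j))"
  shows "D = PiM I (\<lambda>_. M)"
proof -
  interpret M: prob_space M by fact
  interpret P: product_prob_space "\<lambda>_. M" I ..
  show ?thesis
  proof (rule P.PiM_eq[OF D])
    fix J F assume J: "finite J" "J \<subseteq> I" "\<And>j. j \<in> J \<Longrightarrow> F j \<in> sets M"
    have "prod_emb I (\<lambda>_. M) J (Pi\<^sub>E J F) = {x \<in> space D. \<forall>j\<in>J. x j \<in> F j}"
      using J(2) unfolding sets_eq_imp_space_eq[OF D] by (auto simp: prod_emb_def space_PiM PiE_iff extensional_def)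
    with eq[OF J] show "emeasure D (prod_emb I (\<lambda>_. M) J (Pi\<^sub>E J F)) = (\<Prod>j\<in>J. emeasure M (F j))" by simp
  qed
qed

lemma emeasure_PiM_box:
  assumes "prob_space M" "J \<subseteq> I" "finite J" "\<And>j. j \<in> J \<Longrightarrow> F j \<in> sets M"
  shows "emeasure (PiM I (\<lambda>_. M)) {x \<in> space (PiM I (\<lambda>_. M)). \<forall>j\<in>J. x j \<in> F j} = (\<Prod>j\<in>J. emeasure M (F j))"
proof -
  interpret M: prob_space M by fact
  interpret P: product_prob_space "\<lambda>_. M" I ..
  show ?thesis using P.emeasure_PiM_Collect[OF assms(2-4)] by simp
qed

lemma nn_integral_PiM_prod:
  assumes "prob_space M" "J \<subseteq> I" "finite J" and [measurable]: "\<And>j. j \<in> J \<Longrightarrow> g j \<in> borel_measurable M"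
  shows "(\<integral>\<^sup>+x. (\<Prod>j\<in>J. g j (x j)) \<partial>PiM I (\<lambda>_. M)) = (\<Prod>j\<in>J. \<integral>\<^sup>+y. g j y \<partial>M)"
proof -
  interpret M: prob_space M by fact
  interpret P: product_prob_space "\<lambda>_. M" I ..
  interpret J: product_sigma_finite "\<lambda>_. M" ..
  have "(\<Prod>j\<in>J. \<integral>\<^sup>+y. g j y \<partial>M) = (\<integral>\<^sup>+x. (\<Prod>j\<in>J. g j (x j)) \<partial>PiM J (\<lambda>_. M))"
    using assms by (subst J.product_nn_integral_prod) auto
  also have "\<dots> = (\<integral>\<^sup>+x. (\<Prod>j\<in>J. g j (x j)) \<partial>distr (PiM I (\<lambda>_. M)) (PiM J (\<lambda>_. M)) (\<lambda>x. restrict x J))"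
    using P.distr_PiM_restrict_finite[OF assms(3,2)] by simp
  also have "\<dots> = (\<integral>\<^sup>+x. (\<Prod>j\<in>J. g j (restrict x J j)) \<partial>PiM I (\<lambda>_. M))"
    using assms(2) by (subst nn_integral_distr) (auto intro!: measurable_restrict_subset)
  also have "\<dots> = (\<integral>\<^sup>+x. (\<Prod>j\<in>J. g j (x j)) \<partial>PiM I (\<lambda>_. M))"
    by (intro nn_integral_cong prod.cong) auto
  finally show ?thesis ..
qed

lemma distr_PiM_map:
  assumes M: "prob_space M" and N: "prob_space N" and h[measurable]: "h \<in> measurable M N" and d: "distr M N h = N"
  shows "distr (PiM I (\<lambda>_. M)) (PiM I (\<lambda>_. N)) (\<lambda>x. \<lambda>i\<in>I. h (x i)) = PiM I (\<lambda>_. N)"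
proof (rule PiM_const_eqI[OF N])
  let ?D = "distr (PiM I (\<lambda>_. M)) (PiM I (\<lambda>_. N)) (\<lambda>x. \<lambda>i\<in>I. h (x i))"
  fix J F assume J: "finite J" "J \<subseteq> I" and F: "\<And>j. j \<in> J \<Longrightarrow> F j \<in> sets N"
  have S: "{x \<in> space (PiM I (\<lambda>_. N)). \<forall>j\<in>J. x j \<in> F j} \<in> sets (PiM I (\<lambda>_. N))"
    by (rule sets_PiM_box[OF J(2,1) F])
  have "emeasure ?D {x \<in> space ?D. \<forall>j\<in>J. x j \<in> F j} = emeasure (PiM I (\<lambda>_. M)) {x \<in> space (PiM I (\<lambda>_. M)). \<forall>j\<in>J. x j \<in> h -` F j \<inter> space M}"
    using J S by (auto simp: emeasure_distr space_PiM PiE_iff extensional_def measurable_space[OF h] intro!: arg_cong[where f = "emeasure _"])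
  also have "\<dots> = (\<Prod>j\<in>J. emeasure M (h -` F j \<inter> space M))"
    using J F by (intro emeasure_PiM_box[OF M]) auto
  also have "\<dots> = (\<Prod>j\<in>J. emeasure N (F j))"
    using emeasure_distr[OF h F] unfolding d by (intro prod.cong) auto
  finally show "emeasure ?D {x \<in> space ?D. \<forall>j\<in>J. x j \<in> F j} = (\<Prod>j\<in>J. emeasure N (F j))" .
qed simp

lemma distr_PiM_zip:
  assumes M: "prob_space M" and N: "prob_space N"
  shows "distr (PiM I (\<lambda>_. M) \<Otimes>\<^sub>M PiM I (\<lambda>_. N)) (PiM I (\<lambda>_. M \<Otimes>\<^sub>M N)) (\<lambda>p. \<lambda>i\<in>I. (fst p i, snd p i)) = PiM I (\<lambda>_. M \<Otimes>\<^sub>M N)"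
    (is "?D = _")
proof (rule PiM_const_eqI)
  interpret M: prob_space M by fact
  interpret N: prob_space N by fact
  interpret MN: pair_prob_space M N ..
  interpret PN: prob_space "PiM I (\<lambda>_. N)" by (intro prob_space_PiM N)
  show "prob_space (M \<Otimes>\<^sub>M N)" by (rule MN.prob_space_axioms)
  fix J F assume J: "finite J" "J \<subseteq> I" and F[measurable]: "\<And>j. j \<in> J \<Longrightarrow> F j \<in> sets (M \<Otimes>\<^sub>M N)"
  have S: "{x \<in> space (PiM I (\<lambda>_. M \<Otimes>\<^sub>M N)). \<forall>j\<in>J. x j \<in> F j} \<in> sets (PiM I (\<lambda>_. M \<Otimes>\<^sub>M N))"
    by (rule sets_PiM_box[OF J(2,1) F])
  have z[measurable]: "(\<lambda>p. \<lambda>i\<in>I. (fst p i, snd p i)) \<in> measurable (PiM I (\<lambda>_. M) \<Otimes>\<^sub>M PiM I (\<lambda>_. N)) (PiM I (\<lambda>_. M \<Otimes>\<^sub>M N))"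
    by (intro measurable_restrict) measurable
  let ?X = "(\<lambda>p. \<lambda>i\<in>I. (fst p i, snd p i)) -` {x \<in> space (PiM I (\<lambda>_. M \<Otimes>\<^sub>M N)). \<forall>j\<in>J. x j \<in> F j}
    \<inter> space (PiM I (\<lambda>_. M) \<Otimes>\<^sub>M PiM I (\<lambda>_. N))"
  have "emeasure ?D {x \<in> space ?D. \<forall>j\<in>J. x j \<in> F j} = emeasure (PiM I (\<lambda>_. M) \<Otimes>\<^sub>M PiM I (\<lambda>_. N)) ?X"
    using S by (simp add: emeasure_distr)
  \<comment> \<open>The sets \<open>F j\<close> need not be rectangles; fixing the first coordinates
    turns them into a box of sections.\<close>
  also have "\<dots> = (\<integral>\<^sup>+x. emeasure (PiM I (\<lambda>_. N)) (Pair x -` ?X) \<partial>PiM I (\<lambda>_. M))"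
    using S by (intro PN.emeasure_pair_measure_alt) (rule measurable_sets[OF z])
  also have "\<dots> = (\<integral>\<^sup>+x. (\<Prod>j\<in>J. emeasure N (Pair (x j) -` F j)) \<partial>PiM I (\<lambda>_. M))"
  proof (intro nn_integral_cong)
    fix x assume x: "x \<in> space (PiM I (\<lambda>_. M))"
    have eqX: "Pair x -` ?X = {y \<in> space (PiM I (\<lambda>_. N)). \<forall>j\<in>J. y j \<in> Pair (x j) -` F j}"
      using x J by (auto simp: space_PiM space_pair_measure PiE_iff extensional_def)
    show "emeasure (PiM I (\<lambda>_. N)) (Pair x -` ?X) = (\<Prod>j\<in>J. emeasure N (Pair (x j) -` F j))"
      unfolding eqX by (rule emeasure_PiM_box[OF N J(2,1)]) (rule sets_Pair1[OF F])
  qed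
  also have "\<dots> = (\<Prod>j\<in>J. \<integral>\<^sup>+y. emeasure N (Pair y -` F j) \<partial>M)"
    using F by (intro nn_integral_PiM_prod[OF M J(2,1)] N.measurable_emeasure_Pair) auto
  also have "\<dots> = (\<Prod>j\<in>J. emeasure (M \<Otimes>\<^sub>M N) (F j))"
    using F by (intro prod.cong) (auto simp: N.emeasure_pair_measure_alt)
  finally show "emeasure ?D {x \<in> space ?D. \<forall>j\<in>J. x j \<in> F j} = (\<Prod>j\<in>J. emeasure (M \<Otimes>\<^sub>M N) (F j))" .
qed simp

lemma distr_PiM_uncurry:
  assumes M: "prob_space M"
  shows "distr (PiM I (\<lambda>_. PiM J (\<lambda>_. M))) (PiM (I \<times> J) (\<lambda>_. M)) (\<lambda>x. \<lambda>p\<in>I \<times> J. x (fst p) (snd p)) = PiM (I \<times> J) (\<lambda>_. M)"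
    (is "?D = _")
proof (rule PiM_const_eqI[OF M])
  let ?S = "PiM I (\<lambda>_. PiM J (\<lambda>_. M))"
  have z[measurable]: "(\<lambda>x. \<lambda>p\<in>I \<times> J. x (fst p) (snd p)) \<in> measurable ?S (PiM (I \<times> J) (\<lambda>_. M))"
  proof (intro measurable_restrict)
    fix p assume p: "p \<in> I \<times> J"
    have "(\<lambda>x. x (fst p)) \<in> measurable ?S (PiM J (\<lambda>_. M))"
      using p by (intro measurable_component_singleton) auto
    moreover have "(\<lambda>y. y (snd p)) \<in> measurable (PiM J (\<lambda>_. M)) M"
      using p by (intro measurable_component_singleton) auto
    ultimately show "(\<lambda>x. x (fst p) (snd p)) \<in> measurable ?S M"
      by (rule measurable_compose)
  qed
  fix K F assume K: "finite K" "K \<subseteq> I \<times> J" and F: "\<And>j. j \<in> K \<Longrightarrow> F j \<in> sets M"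
  have S: "{x \<in> space (PiM (I \<times> J) (\<lambda>_. M)). \<forall>j\<in>K. x j \<in> F j} \<in> sets (PiM (I \<times> J) (\<lambda>_. M))"
    by (rule sets_PiM_box[OF K(2,1) F])
  define B where "B i = {y \<in> space (PiM J (\<lambda>_. M)). \<forall>j\<in>{j. (i, j) \<in> K}. y j \<in> F (i, j)}" for i
  have fin: "finite {j. (i, j) \<in> K}" for i
    by (rule finite_subset[of _ "snd ` K"]) (use K in \<open>force+\<close>)
  have sub: "{j. (i, j) \<in> K} \<subseteq> J" for i using K by auto
  have "emeasure ?D {x \<in> space ?D. \<forall>j\<in>K. x j \<in> F j} =
    emeasure ?S ((\<lambda>x. \<lambda>p\<in>I \<times> J. x (fst p) (snd p)) -` {x \<in> space (PiM (I \<times> J) (\<lambda>_. M)). \<forall>j\<in>K. x j \<in> F j} \<inter> space ?S)"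
    using S by (simp add: emeasure_distr)
  also have "(\<lambda>x. \<lambda>p\<in>I \<times> J. x (fst p) (snd p)) -` {x \<in> space (PiM (I \<times> J) (\<lambda>_. M)). \<forall>j\<in>K. x j \<in> F j} \<inter> space ?S
    = {x \<in> space ?S. \<forall>i\<in>fst ` K. x i \<in> B i}"
    (is "?l = ?r")
  proof (intro set_eqI iffI)
    fix x assume "x \<in> ?l"
    then show "x \<in> ?r" using K(2) unfolding B_def by (fastforce simp: space_PiM PiE_iff)
  next
    fix x assume x: "x \<in> ?r"
    then have "x i j \<in> F (i, j)" if "(i, j) \<in> K" for i j using that unfolding B_def by force
    then have "\<forall>p\<in>K. (\<lambda>p\<in>I \<times> J. x (fst p) (snd p)) p \<in> F p" using K(2) by auto
    then show "x \<in> ?l" using x measurable_space[OF z] by auto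
  qed
  also have "emeasure ?S \<dots> = (\<Prod>i\<in>fst ` K. emeasure (PiM J (\<lambda>_. M)) (B i))"
    using K F fin sub unfolding B_def by (intro emeasure_PiM_box prob_space_PiM M sets_PiM_box) auto
  also have "\<dots> = (\<Prod>i\<in>fst ` K. \<Prod>j\<in>{j. (i, j) \<in> K}. emeasure M (F (i, j)))"
    using F fin sub unfolding B_def by (intro prod.cong refl emeasure_PiM_box M) auto
  also have "\<dots> = (\<Prod>p\<in>Sigma (fst ` K) (\<lambda>i. {j. (i, j) \<in> K}). emeasure M (F p))"
    using K fin by (subst prod.Sigma) (auto simp: case_prod_unfold)
  also have "Sigma (fst ` K) (\<lambda>i. {j. (i, j) \<in> K}) = K" by force
  finally show "emeasure ?D {x \<in> space ?D. \<forall>j\<in>K. x j \<in> F j} = (\<Prod>j\<in>K. emeasure M (F j))" .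
qed simp

text \<open>Currying inverts uncurrying on the space, so its law follows from
  \<open>distr_PiM_uncurry\<close> without a second computation on boxes.\<close>

lemma distr_PiM_curry:
  assumes M: "prob_space M"
  shows "distr (PiM (I \<times> J) (\<lambda>_. M)) (PiM I (\<lambda>_. PiM J (\<lambda>_. M))) (\<lambda>x. \<lambda>i\<in>I. \<lambda>j\<in>J. x (i, j)) = PiM I (\<lambda>_. PiM J (\<lambda>_. M))"
proof -
  let ?S = "PiM I (\<lambda>_. PiM J (\<lambda>_. M))" and ?T = "PiM (I \<times> J) (\<lambda>_. M)"
  let ?u = "\<lambda>x. \<lambda>p\<in>I \<times> J. x (fst p) (snd p)" and ?c = "\<lambda>x. \<lambda>i\<in>I. \<lambda>j\<in>J. x (i, j)"
  have c: "?c \<in> measurable ?T ?S"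
    by (intro measurable_restrict measurable_component_singleton) auto
  have u: "?u \<in> measurable ?S ?T"
  proof (intro measurable_restrict)
    fix p assume p: "p \<in> I \<times> J"
    have "(\<lambda>x. x (fst p)) \<in> measurable ?S (PiM J (\<lambda>_. M))"
      using p by (intro measurable_component_singleton) auto
    moreover have "(\<lambda>y. y (snd p)) \<in> measurable (PiM J (\<lambda>_. M)) M"
      using p by (intro measurable_component_singleton) auto
    ultimately show "(\<lambda>x. x (fst p) (snd p)) \<in> measurable ?S M"
      by (rule measurable_compose)
  qed
  have "distr ?T ?S ?c = distr (distr ?S ?T ?u) ?S ?c"
    unfolding distr_PiM_uncurry[OF M] ..
  also have "\<dots> = distr ?S ?S (?c \<circ> ?u)"
    by (rule distr_distr[OF c u])
  also have "\<dots> = distr ?S ?S (\<lambda>x. x)"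
  proof (rule distr_cong[OF refl refl])
    fix x assume "x \<in> space ?S"
    then show "(?c \<circ> ?u) x = x"
      by (auto simp: space_PiM PiE_iff extensional_def fun_eq_iff)
  qed
  finally show ?thesis by (simp add: distr_id2)
qed

section \<open>Histories and resampling after a given time\<close>

definition ring_measure :: "(real \<times> int) measure" where
  "ring_measure = density lborel (\<lambda>x. ennreal (exponential_density 1 x)) \<Otimes>\<^sub>M measure_pmf (spin_pmf (1/2))"

definition clock_measure :: "(nat \<Rightarrow> real \<times> int) measure" where
  "clock_measure = PiM UNIV (\<lambda>_. ring_measure)"

definition site_measure :: "real \<Rightarrow> (int \<times> (nat \<Rightarrow> real \<times> int)) measure" where
  "site_measure p = measure_pmf (spin_pmf p) \<Otimes>\<^sub>M clock_measure"

text \<open>All randomness of a vertex is one coordinate, so that resampling acts vertex by vertex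
  and translations permute the coordinates of a product over the slab.\<close>

type_synonym history = "vertex \<Rightarrow> int \<times> (nat \<Rightarrow> real \<times> int)"

definition history_measure :: "real \<Rightarrow> history measure" where
  "history_measure p = PiM slab (\<lambda>_. site_measure p)"

lemma prob_space_exponential: "prob_space (density lborel (\<lambda>x. ennreal (exponential_density 1 x)))"
  by (rule prob_space_exponential_density) simp

lemma prob_space_ring: "prob_space ring_measure"
proof -
  interpret A: prob_space "density lborel (\<lambda>x. ennreal (exponential_density 1 x))" by (rule prob_space_exponential)
  interpret pair_prob_space "density lborel (\<lambda>x. ennreal (exponential_density 1 x))" "measure_pmf (spin_pmf (1/2))" ..
  show ?thesis unfolding ring_measure_def by (rule prob_space_axioms)
qed

lemma prob_space_clock: "prob_space clock_measure"
  unfolding clock_measure_def by (intro prob_space_PiM prob_space_ring)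

lemma prob_space_site: "prob_space (site_measure p)"
proof -
  interpret prob_space clock_measure by (rule prob_space_clock)
  interpret pair_prob_space "measure_pmf (spin_pmf p)" clock_measure ..
  show ?thesis unfolding site_measure_def by (rule prob_space_axioms)
qed

lemma prob_space_history: "prob_space (history_measure p)"
  unfolding history_measure_def by (intro prob_space_PiM prob_space_site)

lemma sets_ring [measurable_cong]: "sets ring_measure = sets (borel \<Otimes>\<^sub>M count_space UNIV)"
  unfolding ring_measure_def by (intro sets_pair_measure_cong) auto

lemma sets_clock [measurable_cong]: "sets clock_measure = sets (PiM UNIV (\<lambda>_. borel \<Otimes>\<^sub>M count_space UNIV))"
  unfolding clock_measure_def by (intro sets_PiM_cong) (auto simp: sets_ring)

lemma sets_site [measurable_cong]: "sets (site_measure p) = sets (count_space UNIV \<Otimes>\<^sub>M PiM UNIV (\<lambda>_. borel \<Otimes>\<^sub>M count_space UNIV))"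
  unfolding site_measure_def by (intro sets_pair_measure_cong) (auto simp: sets_clock)

definition history :: "sample \<Rightarrow> history" where
  "history \<omega> = (\<lambda>v\<in>slab. (fst \<omega> v, \<lambda>n. (fst (snd \<omega>) (v, n), snd (snd \<omega>) (v, n))))"

text \<open>Waiting times are paired with coins, rings are grouped by vertex, and initial spins are
  added; each of these rearrangements preserves the product law.\<close>

lemma distr_history: "distr (glauber_measure p) (history_measure p) history = history_measure p"
  and measurable_history: "history \<in> measurable (glauber_measure p) (history_measure p)"
proof -
  let ?E = "density lborel (\<lambda>x. ennreal (exponential_density 1 x))" and ?C = "measure_pmf (spin_pmf (1/2))"
  let ?S = "PiM slab (\<lambda>_. measure_pmf (spin_pmf p))" and ?I = "slab \<times> (UNIV :: nat set)"
  let ?WC = "PiM ?I (\<lambda>_. ?E) \<Otimes>\<^sub>M PiM ?I (\<lambda>_. ?C)"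
  let ?R = "PiM ?I (\<lambda>_. ring_measure)" and ?K = "PiM slab (\<lambda>_. clock_measure)"
  let ?zip = "\<lambda>q. \<lambda>i\<in>?I. (fst q i, snd q i)" and ?cur = "\<lambda>x. \<lambda>i\<in>slab. \<lambda>j\<in>(UNIV :: nat set). x (i, j)"
  let ?zip2 = "\<lambda>q. \<lambda>v\<in>slab. (fst q v, snd q v)"
  have d1: "distr ?WC ?R ?zip = ?R"
    unfolding ring_measure_def by (rule distr_PiM_zip[OF prob_space_exponential measure_pmf.prob_space_axioms])
  have d2: "distr ?R ?K ?cur = ?K"
    unfolding clock_measure_def by (rule distr_PiM_curry[OF prob_space_ring])
  have d3: "distr (?S \<Otimes>\<^sub>M ?K) (history_measure p) ?zip2 = history_measure p"
    unfolding history_measure_def site_measure_def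
    by (rule distr_PiM_zip[OF measure_pmf.prob_space_axioms prob_space_clock])
  have m1: "?zip \<in> measurable ?WC ?R"
    unfolding ring_measure_def by (intro measurable_restrict) measurable
  have m2: "?cur \<in> measurable ?R ?K"
    unfolding clock_measure_def by (intro measurable_restrict measurable_component_singleton) auto
  have m3: "?zip2 \<in> measurable (?S \<Otimes>\<^sub>M ?K) (history_measure p)"
    unfolding history_measure_def site_measure_def by (intro measurable_restrict) measurable
  have K: "distr ?WC ?K (?cur \<circ> ?zip) = ?K"
    using distr_distr[OF m2 m1] d1 d2 by simp
  have m12: "?cur \<circ> ?zip \<in> measurable ?WC ?K" using m1 m2 by (rule measurable_comp)
  interpret K: prob_space ?K by (intro prob_space_PiM prob_space_clock)
  have "?S \<Otimes>\<^sub>M ?K = distr ?S ?S (\<lambda>x. x) \<Otimes>\<^sub>M distr ?WC ?K (?cur \<circ> ?zip)"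
    unfolding K by (simp add: distr_id2)
  also have "\<dots> = distr (?S \<Otimes>\<^sub>M ?WC) (?S \<Otimes>\<^sub>M ?K) (\<lambda>(x, y). (x, (?cur \<circ> ?zip) y))"
    by (rule pair_measure_distr[OF measurable_ident_sets[OF refl] m12])
       (unfold K, rule K.sigma_finite_measure_axioms)
  finally have SK: "?S \<Otimes>\<^sub>M ?K = distr (glauber_measure p) (?S \<Otimes>\<^sub>M ?K) (\<lambda>(x, y). (x, (?cur \<circ> ?zip) y))"
    unfolding glauber_measure_def .
  have m4: "(\<lambda>(x, y). (x, (?cur \<circ> ?zip) y)) \<in> measurable (glauber_measure p) (?S \<Otimes>\<^sub>M ?K)"
    unfolding glauber_measure_def using m12 by measurable
  have h: "?zip2 \<circ> (\<lambda>(x, y). (x, (?cur \<circ> ?zip) y)) = history"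
    by (auto simp: history_def fun_eq_iff)
  show "history \<in> measurable (glauber_measure p) (history_measure p)"
    using measurable_comp[OF m4 m3] unfolding h .
  have "history_measure p = distr (glauber_measure p) (history_measure p) (?zip2 \<circ> (\<lambda>(x, y). (x, (?cur \<circ> ?zip) y)))"
    using distr_distr[OF m3 m4] SK d3 by metis
  then show "distr (glauber_measure p) (history_measure p) history = history_measure p"
    unfolding h ..
qed

text \<open>The waiting time that straddles \<open>T\<close> is replaced by the time up to \<open>T\<close> plus a fresh waiting
  time; by memorylessness this preserves the law.\<close>

primrec restart :: "nat \<Rightarrow> real \<Rightarrow> (nat \<Rightarrow> real \<times> int) \<Rightarrow> (nat \<Rightarrow> real \<times> int) \<Rightarrow> real \<times> int" where
  "restart 0 T \<xi> \<zeta> = (if fst (\<xi> 0) > T then (T + fst (\<zeta> 0), snd (\<zeta> 0)) else \<xi> 0)"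
| "restart (Suc n) T \<xi> \<zeta> = (if fst (\<xi> 0) > T then \<zeta> (Suc n) else restart n (T - fst (\<xi> 0)) (\<lambda>k. \<xi> (Suc k)) \<zeta>)"

section \<open>The law of a clock restarted at a fixed time\<close>

lemma measurable_clock_nth:
  assumes "\<xi> \<in> measurable M clock_measure"
  shows "(\<lambda>x. \<xi> x n) \<in> measurable M (borel \<Otimes>\<^sub>M count_space UNIV)"
proof (rule measurable_compose[OF assms])
  show "(\<lambda>\<xi>. \<xi> n) \<in> measurable clock_measure (borel \<Otimes>\<^sub>M count_space UNIV)"
    unfolding measurable_cong_sets[OF sets_clock refl] by (rule measurable_component_singleton) simp
qed

lemma measurable_clock_shift:
  assumes "\<xi> \<in> measurable M clock_measure"
  shows "(\<lambda>x k. \<xi> x (Suc k)) \<in> measurable M clock_measure"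
  unfolding measurable_cong_sets[OF refl sets_clock]
  using measurable_clock_nth[OF assms] by (intro measurable_PiM_single') (auto simp: space_pair_measure)

lemma measurable_restart:
  assumes "T \<in> borel_measurable M" "\<xi> \<in> measurable M clock_measure" "\<zeta> \<in> measurable M clock_measure"
  shows "(\<lambda>x. restart n (T x) (\<xi> x) (\<zeta> x)) \<in> measurable M (borel \<Otimes>\<^sub>M count_space UNIV)"
  using assms
proof (induction n arbitrary: T \<xi>)
  case 0
  note [measurable] = 0 measurable_clock_nth[OF 0(2)] measurable_clock_nth[OF 0(3)]
  show ?case unfolding restart.simps by measurable
next
  case (Suc n)
  note [measurable] = Suc.prems measurable_clock_nth[OF Suc.prems(2)] measurable_clock_nth[OF Suc.prems(3)]
    measurable_clock_shift[OF Suc.prems(2)]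
  have [measurable]: "(\<lambda>x. restart n (T x - fst (\<xi> x 0)) (\<lambda>k. \<xi> x (Suc k)) (\<zeta> x)) \<in> measurable M (borel \<Otimes>\<^sub>M count_space UNIV)"
    by (rule Suc.IH) measurable
  show ?case unfolding restart.simps by measurable
qed

lemma emeasure_waiting_gt:
  "emeasure ring_measure {s \<in> space ring_measure. fst s > T} = (\<integral>\<^sup>+s. indicator {T<..} (fst s) \<partial>ring_measure)"
proof -
  have S: "{s \<in> space ring_measure. fst s > T} \<in> sets ring_measure" by measurable
  show ?thesis
    unfolding nn_integral_indicator[OF S, symmetric] by (intro nn_integral_cong) (auto simp: indicator_def)
qed

text \<open>A waiting time conditioned to exceed \<open>T\<close> is distributed like
  \<open>T\<close> plus a fresh one; this is the form without division.\<close>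

lemma memoryless:
  assumes T: "0 \<le> T" and g[measurable]: "g \<in> borel_measurable ring_measure"
  shows "emeasure ring_measure {s \<in> space ring_measure. fst s > T} * (\<integral>\<^sup>+r. g (T + fst r, snd r) \<partial>ring_measure)
    = (\<integral>\<^sup>+s. indicator {T<..} (fst s) * g s \<partial>ring_measure)"
proof -
  let ?E = "density lborel (\<lambda>x. ennreal (exponential_density 1 x))" and ?C = "measure_pmf (spin_pmf (1/2))"
  interpret E: prob_space ?E by (rule prob_space_exponential)
  interpret P: pair_prob_space ?E ?C ..
  have g'[measurable]: "g \<in> borel_measurable (borel \<Otimes>\<^sub>M count_space UNIV)"
    using g unfolding measurable_cong_sets[OF sets_ring refl] .
  have shift: "ennreal (exp (- T)) * (\<integral>\<^sup>+x. h (T + x) \<partial>?E) = (\<integral>\<^sup>+x. indicator {T<..} x * h x \<partial>?E)"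
    if [measurable]: "h \<in> borel_measurable borel" for h
  proof -
    have "(\<integral>\<^sup>+x. indicator {T<..} x * h x \<partial>?E) = (\<integral>\<^sup>+x. ennreal (exponential_density 1 x) * (indicator {T<..} x * h x) \<partial>lborel)"
      by (subst nn_integral_density) auto
    also have "\<dots> = (\<integral>\<^sup>+x. ennreal (exponential_density 1 (T + 1 * x)) * (indicator {T<..} (T + 1 * x) * h (T + 1 * x)) \<partial>lborel)"
      by (subst nn_integral_real_affine[where c = 1 and t = T]) auto
    also have "\<dots> = (\<integral>\<^sup>+x. ennreal (exp (- T)) * (ennreal (exponential_density 1 x) * h (T + x)) \<partial>lborel)"
    proof (rule nn_integral_cong_AE)
      \<comment> \<open>At 0 the two sides may differ: the density is positive there, while the
        indicator of the open half-line vanishes.\<close>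
      have "AE x in lborel. x \<noteq> (0 :: real)" by (rule AE_lborel_singleton)
      then show "AE x in lborel. ennreal (exponential_density 1 (T + 1 * x)) * (indicator {T<..} (T + 1 * x) * h (T + 1 * x))
        = ennreal (exp (- T)) * (ennreal (exponential_density 1 x) * h (T + x))"
      proof eventually_elim
        case (elim x)
        show ?case
          using T elim by (cases "x > 0")
            (auto simp: exponential_density_def mult_exp_exp mult.assoc[symmetric] ennreal_mult[symmetric])
      qed
    qed
    also have "\<dots> = ennreal (exp (- T)) * (\<integral>\<^sup>+x. h (T + x) \<partial>?E)"
      by (subst nn_integral_cmult) (auto simp: nn_integral_density)
    finally show ?thesis ..
  qed
  have "emeasure ring_measure {s \<in> space ring_measure. fst s > T} = (\<integral>\<^sup>+s. indicator {T<..} (fst s) \<partial>(?E \<Otimes>\<^sub>M ?C))"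
    using emeasure_waiting_gt[of T] unfolding ring_measure_def .
  also have "\<dots> = (\<integral>\<^sup>+x. \<integral>\<^sup>+y. indicator {T<..} x \<partial>?C \<partial>?E)"
    by (subst measure_pmf.nn_integral_fst[symmetric]) auto
  also have "\<dots> = (\<integral>\<^sup>+x. indicator {T<..} x * 1 \<partial>?E)"
    by (simp add: measure_pmf.emeasure_space_1)
  also have "\<dots> = ennreal (exp (- T))"
    using shift[of "\<lambda>_. 1"] E.emeasure_space_1 by simp
  finally have e: "emeasure ring_measure {s \<in> space ring_measure. fst s > T} = ennreal (exp (- T))" .
  have "(\<integral>\<^sup>+r. g (T + fst r, snd r) \<partial>ring_measure) = (\<integral>\<^sup>+x. \<integral>\<^sup>+y. g (T + x, y) \<partial>?C \<partial>?E)"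
    unfolding ring_measure_def by (subst measure_pmf.nn_integral_fst[symmetric]) auto
  then have "ennreal (exp (- T)) * (\<integral>\<^sup>+r. g (T + fst r, snd r) \<partial>ring_measure)
    = (\<integral>\<^sup>+x. indicator {T<..} x * (\<integral>\<^sup>+y. g (x, y) \<partial>?C) \<partial>?E)"
    using shift[of "\<lambda>x. \<integral>\<^sup>+y. g (x, y) \<partial>?C"] by simp
  also have "\<dots> = (\<integral>\<^sup>+x. \<integral>\<^sup>+y. indicator {T<..} x * g (x, y) \<partial>?C \<partial>?E)"
    by (intro nn_integral_cong nn_integral_cmult[symmetric]) auto
  also have "\<dots> = (\<integral>\<^sup>+s. indicator {T<..} (fst s) * g s \<partial>ring_measure)"
    unfolding ring_measure_def by (subst measure_pmf.nn_integral_fst[symmetric]) auto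
  finally show ?thesis unfolding e .
qed

lemma clock_head_tail:
  assumes [measurable]: "g \<in> borel_measurable clock_measure"
  shows "(\<integral>\<^sup>+\<xi>. g \<xi> \<partial>clock_measure) = (\<integral>\<^sup>+s. \<integral>\<^sup>+\<xi>. g (case_nat s \<xi>) \<partial>clock_measure \<partial>ring_measure)"
    and measurable_case_nat_clock: "(\<lambda>p. case_nat (fst p) (snd p)) \<in> measurable (ring_measure \<Otimes>\<^sub>M clock_measure) clock_measure"
proof -
  interpret R: prob_space ring_measure by (rule prob_space_ring)
  interpret S: sequence_space ring_measure ..
  interpret C: prob_space clock_measure by (rule prob_space_clock)
  have it: "distr (ring_measure \<Otimes>\<^sub>M clock_measure) clock_measure (\<lambda>(s, \<xi>). case_nat s \<xi>) = clock_measure"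
    using S.PiM_iter unfolding clock_measure_def .
  show m: "(\<lambda>p. case_nat (fst p) (snd p)) \<in> measurable (ring_measure \<Otimes>\<^sub>M clock_measure) clock_measure"
    unfolding clock_measure_def by measurable
  have "(\<integral>\<^sup>+\<xi>. g \<xi> \<partial>clock_measure) = (\<integral>\<^sup>+p. g (case_nat (fst p) (snd p)) \<partial>(ring_measure \<Otimes>\<^sub>M clock_measure))"
    using nn_integral_distr[OF m, of g] it unfolding case_prod_unfold by simp
  also have "\<dots> = (\<integral>\<^sup>+s. \<integral>\<^sup>+\<xi>. g (case_nat s \<xi>) \<partial>clock_measure \<partial>ring_measure)"
    using C.nn_integral_fst[OF measurable_compose[OF m assms]] by simp
  finally show "(\<integral>\<^sup>+\<xi>. g \<xi> \<partial>clock_measure) = (\<integral>\<^sup>+s. \<integral>\<^sup>+\<xi>. g (case_nat s \<xi>) \<partial>clock_measure \<partial>ring_measure)" .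
qed

text \<open>Induction on the number of rings, splitting off the first waiting time \<open>s\<close>.
  If it exceeds \<open>T\<close>, all entries are fresh up to the shift of the first; otherwise
  \<open>s\<close> is kept and the remaining clock is restarted at \<open>T - s\<close>.
  \<open>memoryless\<close> reassembles the two cases.\<close>

lemma restart_law:
  assumes "0 \<le> T" "\<And>j. F j \<in> sets ring_measure"
  shows "(\<integral>\<^sup>+\<xi>. \<integral>\<^sup>+\<zeta>. (\<Prod>j<n. indicator (F j) (restart j T \<xi> \<zeta>)) \<partial>clock_measure \<partial>clock_measure) = (\<Prod>j<n. emeasure ring_measure (F j))"
  using assms
proof (induction n arbitrary: T F)
  case 0
  then show ?case using prob_space.emeasure_space_1[OF prob_space_clock] by simp
next
  case (Suc n)
  interpret R: prob_space ring_measure by (rule prob_space_ring)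
  interpret C: prob_space clock_measure by (rule prob_space_clock)
  let ?c = "\<Prod>j<n. emeasure ring_measure (F (Suc j))"
  note F[measurable] = Suc.prems(2)
  have F'[measurable]: "F j \<in> sets (borel \<Otimes>\<^sub>M count_space UNIV)" for j using F unfolding sets_ring .
  have [measurable]: "(\<lambda>p. restart j T (fst p) (snd p)) \<in> measurable (clock_measure \<Otimes>\<^sub>M clock_measure) (borel \<Otimes>\<^sub>M count_space UNIV)" for j T
    by (rule measurable_restart) auto
  have [measurable]: "(\<lambda>\<zeta>. restart j T \<xi> \<zeta>) \<in> measurable clock_measure (borel \<Otimes>\<^sub>M count_space UNIV)" if "\<xi> \<in> space clock_measure" for j T \<xi>
    using that by (intro measurable_restart) auto
  have step: "(\<integral>\<^sup>+\<xi>. \<integral>\<^sup>+\<zeta>. (\<Prod>j<Suc n. indicator (F j) (restart j T (case_nat s \<xi>) \<zeta>)) \<partial>clock_measure \<partial>clock_measure)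
     = ?c * (indicator {T<..} (fst s) * (\<integral>\<^sup>+r. indicator (F 0) (T + fst r, snd r) \<partial>ring_measure)
       + indicator {..T} (fst s) * indicator (F 0) s)" for s
  proof (cases "fst s > T")
    case True
    let ?g = "\<lambda>j r. if j = 0 then indicator (F 0) (T + fst r, snd r) else indicator (F j) r :: ennreal"
    have "(\<integral>\<^sup>+\<zeta>. (\<Prod>j<Suc n. indicator (F j) (restart j T (case_nat s \<xi>) \<zeta>)) \<partial>clock_measure)
      = (\<integral>\<^sup>+\<zeta>. (\<Prod>j<Suc n. ?g j (\<zeta> j)) \<partial>clock_measure)" for \<xi>
      using True by (intro nn_integral_cong prod.cong refl) (auto simp: gr0_conv_Suc)
    also have "(\<integral>\<^sup>+\<zeta>. (\<Prod>j<Suc n. ?g j (\<zeta> j)) \<partial>clock_measure) = (\<Prod>j<Suc n. \<integral>\<^sup>+r. ?g j r \<partial>ring_measure)"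
      unfolding clock_measure_def by (intro nn_integral_PiM_prod prob_space_ring) auto
    also have "\<dots> = (\<integral>\<^sup>+r. indicator (F 0) (T + fst r, snd r) \<partial>ring_measure) * ?c"
      by (simp add: prod.lessThan_Suc_shift del: prod.lessThan_Suc)
    finally show ?thesis using True by (simp add: C.emeasure_space_1 mult.commute)
  next
    case False
    have "(\<integral>\<^sup>+\<xi>. \<integral>\<^sup>+\<zeta>. (\<Prod>j<Suc n. indicator (F j) (restart j T (case_nat s \<xi>) \<zeta>)) \<partial>clock_measure \<partial>clock_measure)
      = (\<integral>\<^sup>+\<xi>. \<integral>\<^sup>+\<zeta>. indicator (F 0) s * (\<Prod>j<n. indicator (F (Suc j)) (restart j (T - fst s) \<xi> \<zeta>)) \<partial>clock_measure \<partial>clock_measure)"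
      using False by (simp add: prod.lessThan_Suc_shift del: prod.lessThan_Suc)
    also have "\<dots> = indicator (F 0) s * (\<integral>\<^sup>+\<xi>. \<integral>\<^sup>+\<zeta>. (\<Prod>j<n. indicator (F (Suc j)) (restart j (T - fst s) \<xi> \<zeta>)) \<partial>clock_measure \<partial>clock_measure)"
      by (cases "s \<in> F 0") simp_all
    also have "\<dots> = indicator (F 0) s * ?c"
      using Suc.IH[of "T - fst s" "\<lambda>j. F (Suc j)"] False by simp
    finally show ?thesis using False by (simp add: mult.commute)
  qed
  have mf: "(\<lambda>\<xi>. \<integral>\<^sup>+\<zeta>. (\<Prod>j<Suc n. indicator (F j) (restart j T \<xi> \<zeta>)) \<partial>clock_measure) \<in> borel_measurable clock_measure"
    by (intro C.borel_measurable_nn_integral) measurable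
  have "(\<integral>\<^sup>+\<xi>. \<integral>\<^sup>+\<zeta>. (\<Prod>j<Suc n. indicator (F j) (restart j T \<xi> \<zeta>)) \<partial>clock_measure \<partial>clock_measure)
    = (\<integral>\<^sup>+s. ?c * (indicator {T<..} (fst s) * (\<integral>\<^sup>+r. indicator (F 0) (T + fst r, snd r) \<partial>ring_measure)
       + indicator {..T} (fst s) * indicator (F 0) s) \<partial>ring_measure)"
    unfolding clock_head_tail[OF mf] step ..
  also have "\<dots> = ?c * ((\<integral>\<^sup>+s. indicator {T<..} (fst s) \<partial>ring_measure) * (\<integral>\<^sup>+r. indicator (F 0) (T + fst r, snd r) \<partial>ring_measure)
       + (\<integral>\<^sup>+s. indicator {..T} (fst s) * indicator (F 0) s \<partial>ring_measure))"
    by (simp add: nn_integral_cmult nn_integral_add nn_integral_multc)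
  also have "(\<integral>\<^sup>+s. indicator {T<..} (fst s) \<partial>ring_measure) = emeasure ring_measure {s \<in> space ring_measure. fst s > T}"
    by (rule emeasure_waiting_gt[symmetric])
  also have "\<dots> * (\<integral>\<^sup>+r. indicator (F 0) (T + fst r, snd r) \<partial>ring_measure) = (\<integral>\<^sup>+s. indicator {T<..} (fst s) * indicator (F 0) s \<partial>ring_measure)"
    by (rule memoryless[OF Suc.prems(1)]) measurable
  also have "\<dots> + (\<integral>\<^sup>+s. indicator {..T} (fst s) * indicator (F 0) s \<partial>ring_measure) = (\<integral>\<^sup>+s. indicator (F 0) s \<partial>ring_measure)"
  proof -
    have "(\<integral>\<^sup>+s. indicator {T<..} (fst s) * indicator (F 0) s \<partial>ring_measure) + (\<integral>\<^sup>+s. indicator {..T} (fst s) * indicator (F 0) s \<partial>ring_measure)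
      = (\<integral>\<^sup>+s. indicator {T<..} (fst s) * indicator (F 0) s + indicator {..T} (fst s) * indicator (F 0) s \<partial>ring_measure)"
      by (rule nn_integral_add[symmetric]) measurable
    also have "\<dots> = (\<integral>\<^sup>+s. indicator (F 0) s \<partial>ring_measure)"
      by (rule nn_integral_cong) (simp split: split_indicator)
    finally show ?thesis .
  qed
  finally show ?case
    by (simp add: prod.lessThan_Suc_shift mult.commute del: prod.lessThan_Suc)
qed

definition splice_at :: "real \<Rightarrow> (nat \<Rightarrow> real \<times> int) \<Rightarrow> (nat \<Rightarrow> real \<times> int) \<Rightarrow> nat \<Rightarrow> real \<times> int" where
  "splice_at T \<xi> \<zeta> = (\<lambda>n. restart n T \<xi> \<zeta>)"

lemma measurable_splice_at:
  assumes "\<xi> \<in> measurable M clock_measure" "\<zeta> \<in> measurable M clock_measure"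
  shows "(\<lambda>x. splice_at T (\<xi> x) (\<zeta> x)) \<in> measurable M clock_measure"
  unfolding measurable_cong_sets[OF refl sets_clock] splice_at_def
  by (intro measurable_PiM_single' measurable_restart assms) (auto simp: space_pair_measure)

lemma distr_splice_at:
  assumes T: "0 \<le> T"
  shows "distr (clock_measure \<Otimes>\<^sub>M clock_measure) clock_measure (\<lambda>p. splice_at T (fst p) (snd p)) = clock_measure"
    (is "?D = _")
proof -
  interpret R: prob_space ring_measure by (rule prob_space_ring)
  interpret C: prob_space clock_measure by (rule prob_space_clock)
  have m: "(\<lambda>p. splice_at T (fst p) (snd p)) \<in> measurable (clock_measure \<Otimes>\<^sub>M clock_measure) clock_measure"
    by (intro measurable_splice_at) auto
  have "?D = PiM UNIV (\<lambda>_. ring_measure)"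
  proof (rule PiM_const_eqI[OF prob_space_ring])
    show "sets ?D = sets (PiM UNIV (\<lambda>_. ring_measure))" by (simp add: clock_measure_def)
    fix J :: "nat set" and F assume J: "finite J" and F: "\<And>j. j \<in> J \<Longrightarrow> F j \<in> sets ring_measure"
    obtain n where n: "J \<subseteq> {..<n}" using J finite_nat_iff_bounded by blast
    \<comment> \<open>Coordinates outside \<open>J\<close> are left free, so that \<open>J\<close>
      may be replaced by the initial segment of which \<open>restart_law\<close> speaks.\<close>
    define G where "G j = (if j \<in> J then F j else space ring_measure)" for j
    have G: "G j \<in> sets ring_measure" for j using F by (simp add: G_def)
    have sp: "restart j T \<xi> \<zeta> \<in> space ring_measure" for j \<xi> \<zeta>
      using sets_eq_imp_space_eq[OF sets_ring] by (simp add: space_pair_measure)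
    have ind: "indicator {\<xi> \<in> space ?D. \<forall>j\<in>J. \<xi> j \<in> F j} (splice_at T \<xi> \<zeta>) = (\<Prod>j<n. indicator (G j) (restart j T \<xi> \<zeta>) :: ennreal)"
      if "\<xi> \<in> space clock_measure" "\<zeta> \<in> space clock_measure" for \<xi> \<zeta>
    proof -
      have "splice_at T \<xi> \<zeta> \<in> space clock_measure"
        using measurable_space[OF m, of "(\<xi>, \<zeta>)"] that by (simp add: space_pair_measure)
      moreover have "(\<Prod>j<n. indicator (G j) (restart j T \<xi> \<zeta>)) = (indicator {\<xi>. \<forall>j\<in>J. \<xi> j \<in> F j} (splice_at T \<xi> \<zeta>) :: ennreal)"
      proof (cases "\<forall>j\<in>J. restart j T \<xi> \<zeta> \<in> F j")
        case True
        then show ?thesis using sp by (auto simp: G_def splice_at_def intro!: prod.neutral)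
      next
        case False
        then obtain j where j: "j \<in> J" "restart j T \<xi> \<zeta> \<notin> F j" by blast
        have "(\<Prod>j<n. indicator (G j) (restart j T \<xi> \<zeta>) :: ennreal) = 0"
          by (rule prod_zero) (use j n in \<open>auto simp: G_def intro!: bexI[of _ j]\<close>)
        moreover have "splice_at T \<xi> \<zeta> \<notin> {\<xi>. \<forall>j\<in>J. \<xi> j \<in> F j}" using j by (auto simp: splice_at_def)
        ultimately show ?thesis by simp
      qed
      ultimately show ?thesis by (simp add: indicator_def)
    qed
    have S: "{\<xi> \<in> space ?D. \<forall>j\<in>J. \<xi> j \<in> F j} \<in> sets ?D"
      using sets_PiM_box[of J UNIV F ring_measure, OF _ J F] by (simp add: clock_measure_def)
    have "emeasure ?D {\<xi> \<in> space ?D. \<forall>j\<in>J. \<xi> j \<in> F j} = (\<integral>\<^sup>+\<xi>. indicator {\<xi> \<in> space ?D. \<forall>j\<in>J. \<xi> j \<in> F j} \<xi> \<partial>?D)"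
      using S by (rule nn_integral_indicator[symmetric])
    also have "\<dots> = (\<integral>\<^sup>+p. indicator {\<xi> \<in> space ?D. \<forall>j\<in>J. \<xi> j \<in> F j} (splice_at T (fst p) (snd p)) \<partial>(clock_measure \<Otimes>\<^sub>M clock_measure))"
      using S by (intro nn_integral_distr[OF m]) auto
    also have "\<dots> = (\<integral>\<^sup>+\<xi>. \<integral>\<^sup>+\<zeta>. indicator {\<xi> \<in> space ?D. \<forall>j\<in>J. \<xi> j \<in> F j} (splice_at T \<xi> \<zeta>) \<partial>clock_measure \<partial>clock_measure)"
      using S by (subst C.nn_integral_fst[symmetric]) (auto intro!: measurable_compose[OF m])
    also have "\<dots> = (\<integral>\<^sup>+\<xi>. \<integral>\<^sup>+\<zeta>. (\<Prod>j<n. indicator (G j) (restart j T \<xi> \<zeta>)) \<partial>clock_measure \<partial>clock_measure)"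
      by (intro nn_integral_cong ind)
    also have "\<dots> = (\<Prod>j<n. emeasure ring_measure (G j))"
      by (rule restart_law[OF T G])
    also have "\<dots> = (\<Prod>j\<in>J. emeasure ring_measure (G j))"
      using n by (intro prod.mono_neutral_right) (auto simp: G_def R.emeasure_space_1)
    also have "\<dots> = (\<Prod>j\<in>J. emeasure ring_measure (F j))"
      by (intro prod.cong) (auto simp: G_def)
    finally show "emeasure ?D {\<xi> \<in> space ?D. \<forall>j\<in>J. \<xi> j \<in> F j} = (\<Prod>j\<in>J. emeasure ring_measure (F j))" .
  qed
  then show ?thesis unfolding clock_measure_def .
qed

definition splice_site :: "real \<Rightarrow> (int \<times> (nat \<Rightarrow> real \<times> int)) \<times> (int \<times> (nat \<Rightarrow> real \<times> int)) \<Rightarrow> int \<times> (nat \<Rightarrow> real \<times> int)" where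
  "splice_site T q = (fst (fst q), splice_at T (snd (fst q)) (snd (snd q)))"

lemma measurable_splice_site: "splice_site T \<in> measurable (site_measure p \<Otimes>\<^sub>M site_measure p) (site_measure p)"
proof -
  have "snd \<in> measurable (site_measure p) clock_measure" by (simp add: site_measure_def)
  then have [measurable]: "(\<lambda>q. splice_at T (snd (fst q)) (snd (snd q))) \<in> measurable (site_measure p \<Otimes>\<^sub>M site_measure p) clock_measure"
    by (intro measurable_splice_at) auto
  have [measurable]: "(\<lambda>q. fst (fst q)) \<in> measurable (site_measure p \<Otimes>\<^sub>M site_measure p) (measure_pmf (spin_pmf p))"
    unfolding site_measure_def by measurable
  show ?thesis unfolding splice_site_def
    by (subst (3) site_measure_def) measurable
qed

lemma distr_splice_site:
  assumes T: "0 \<le> T"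
  shows "distr (site_measure p \<Otimes>\<^sub>M site_measure p) (site_measure p) (splice_site T) = site_measure p" (is "?D = _")
proof (rule measure_eqI)
  interpret C: prob_space clock_measure by (rule prob_space_clock)
  interpret S: prob_space "site_measure p" by (rule prob_space_site)
  fix X assume "X \<in> sets ?D"
  then have X[measurable]: "X \<in> sets (site_measure p)" by simp
  have X'[measurable]: "X \<in> sets (measure_pmf (spin_pmf p) \<Otimes>\<^sub>M clock_measure)" using X unfolding site_measure_def .
  have m: "(\<lambda>p. splice_at T (fst p) (snd p)) \<in> measurable (clock_measure \<Otimes>\<^sub>M clock_measure) clock_measure"
    by (intro measurable_splice_at) auto
  have mx: "(\<lambda>q. indicator X (splice_site T q) :: ennreal) \<in> borel_measurable (site_measure p \<Otimes>\<^sub>M site_measure p)"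
    by (rule measurable_compose[OF measurable_splice_site[of T p]]) (rule borel_measurable_indicator[OF X])
  have s1: "indicator X (splice_site T (a, b)) = (indicator X (fst a, splice_at T (snd a) (snd b)) :: ennreal)" for a b
    by (simp add: splice_site_def)
  have g: "(\<lambda>\<eta>. indicator X (s, \<eta>) :: ennreal) \<in> borel_measurable clock_measure" for s
    by measurable
  have gm: "(\<lambda>q. indicator X (s, splice_at T (fst q) (snd q)) :: ennreal) \<in> borel_measurable (clock_measure \<Otimes>\<^sub>M clock_measure)" for s
    by (rule measurable_compose[OF m g])
  have gz: "(\<lambda>\<zeta>. indicator X (s, splice_at T \<xi> \<zeta>) :: ennreal) \<in> borel_measurable clock_measure" if "\<xi> \<in> space clock_measure" for s \<xi>
    using that by (intro measurable_compose[OF measurable_splice_at g]) auto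
  have drop: "(\<integral>\<^sup>+b. indicator X (s, splice_at T \<xi> (snd b)) \<partial>site_measure p) = (\<integral>\<^sup>+\<zeta>. indicator X (s, splice_at T \<xi> \<zeta>) \<partial>clock_measure)"
    if "\<xi> \<in> space clock_measure" for s \<xi>
  proof -
    have "(\<integral>\<^sup>+b. indicator X (s, splice_at T \<xi> (snd b)) \<partial>site_measure p)
      = (\<integral>\<^sup>+s'. \<integral>\<^sup>+\<zeta>. indicator X (s, splice_at T \<xi> \<zeta>) \<partial>clock_measure \<partial>measure_pmf (spin_pmf p))"
      unfolding site_measure_def using gz[OF that]
      by (subst C.nn_integral_fst[symmetric]) (auto intro: measurable_compose[OF measurable_snd])
    then show ?thesis using measure_pmf.emeasure_space_1[of "spin_pmf p"] by simp
  qed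
  have "emeasure ?D X = (\<integral>\<^sup>+q. indicator X (splice_site T q) \<partial>(site_measure p \<Otimes>\<^sub>M site_measure p))"
    using nn_integral_distr[OF measurable_splice_site[of T p], of "indicator X"] X by simp
  also have "\<dots> = (\<integral>\<^sup>+a. \<integral>\<^sup>+b. indicator X (splice_site T (a, b)) \<partial>site_measure p \<partial>site_measure p)"
    using S.nn_integral_fst[OF mx] by simp
  also have "\<dots> = (\<integral>\<^sup>+a. \<integral>\<^sup>+\<zeta>. indicator X (fst a, splice_at T (snd a) \<zeta>) \<partial>clock_measure \<partial>site_measure p)"
    unfolding s1 by (intro nn_integral_cong drop) (auto simp: site_measure_def space_pair_measure)
  also have "\<dots> = (\<integral>\<^sup>+s. \<integral>\<^sup>+\<xi>. \<integral>\<^sup>+\<zeta>. indicator X (s, splice_at T \<xi> \<zeta>) \<partial>clock_measure \<partial>clock_measure \<partial>measure_pmf (spin_pmf p))"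
  proof -
    have [measurable]: "(\<lambda>q. splice_at T (snd (fst q)) (snd q)) \<in> measurable ((measure_pmf (spin_pmf p) \<Otimes>\<^sub>M clock_measure) \<Otimes>\<^sub>M clock_measure) clock_measure"
      by (intro measurable_splice_at) auto
    have [measurable]: "(\<lambda>q. indicator X (fst (fst q), splice_at T (snd (fst q)) (snd q)) :: ennreal) \<in> borel_measurable ((measure_pmf (spin_pmf p) \<Otimes>\<^sub>M clock_measure) \<Otimes>\<^sub>M clock_measure)"
      by measurable
    have "(\<lambda>a. \<integral>\<^sup>+\<zeta>. indicator X (fst a, splice_at T (snd a) \<zeta>) \<partial>clock_measure) \<in> borel_measurable (measure_pmf (spin_pmf p) \<Otimes>\<^sub>M clock_measure)"
      by (rule C.borel_measurable_nn_integral) (simp add: case_prod_unfold)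
    from C.nn_integral_fst[OF this] show ?thesis unfolding site_measure_def by simp
  qed
  also have "\<dots> = (\<integral>\<^sup>+s. \<integral>\<^sup>+\<eta>. indicator X (s, \<eta>) \<partial>clock_measure \<partial>measure_pmf (spin_pmf p))"
  proof (rule nn_integral_cong)
    fix s
    have "(\<integral>\<^sup>+\<xi>. \<integral>\<^sup>+\<zeta>. indicator X (s, splice_at T \<xi> \<zeta>) \<partial>clock_measure \<partial>clock_measure)
      = (\<integral>\<^sup>+q. indicator X (s, splice_at T (fst q) (snd q)) \<partial>(clock_measure \<Otimes>\<^sub>M clock_measure))"
      using C.nn_integral_fst[OF gm] by simp
    also have "\<dots> = (\<integral>\<^sup>+\<eta>. indicator X (s, \<eta>) \<partial>clock_measure)"
      using nn_integral_distr[OF m, of "\<lambda>\<eta>. indicator X (s, \<eta>)"] g unfolding distr_splice_at[OF T] by simp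
    finally show "(\<integral>\<^sup>+\<xi>. \<integral>\<^sup>+\<zeta>. indicator X (s, splice_at T \<xi> \<zeta>) \<partial>clock_measure \<partial>clock_measure) = (\<integral>\<^sup>+\<eta>. indicator X (s, \<eta>) \<partial>clock_measure)" .
  qed
  also have "\<dots> = (\<integral>\<^sup>+q. indicator X q \<partial>site_measure p)"
    unfolding site_measure_def using X' C.nn_integral_fst[of "indicator X" "measure_pmf (spin_pmf p)"] by simp
  also have "\<dots> = emeasure (site_measure p) X" by simp
  finally show "emeasure ?D X = emeasure (site_measure p) X" .
qed simp

definition splice :: "real \<Rightarrow> history \<Rightarrow> history \<Rightarrow> history" where
  "splice T x y = (\<lambda>v\<in>slab. splice_site T (x v, y v))"

lemma distr_splice:
  assumes T: "0 \<le> T"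
  shows "distr (history_measure p \<Otimes>\<^sub>M history_measure p) (history_measure p) (\<lambda>q. splice T (fst q) (snd q)) = history_measure p"
    and measurable_splice: "(\<lambda>q. splice T (fst q) (snd q)) \<in> measurable (history_measure p \<Otimes>\<^sub>M history_measure p) (history_measure p)"
proof -
  let ?H = "history_measure p" and ?S = "site_measure p"
  let ?Z = "PiM slab (\<lambda>_. ?S \<Otimes>\<^sub>M ?S)" and ?zip = "\<lambda>q. \<lambda>i\<in>slab. (fst q i, snd q i)"
  let ?map = "\<lambda>x. \<lambda>i\<in>slab. splice_site T (x i)"
  interpret S: prob_space ?S by (rule prob_space_site)
  interpret SS: pair_prob_space ?S ?S ..
  have d1: "distr (?H \<Otimes>\<^sub>M ?H) ?Z ?zip = ?Z"
    unfolding history_measure_def by (rule distr_PiM_zip[OF prob_space_site prob_space_site])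
  have d2: "distr ?Z ?H ?map = ?H"
    unfolding history_measure_def
    by (rule distr_PiM_map[OF SS.prob_space_axioms prob_space_site measurable_splice_site distr_splice_site[OF T]])
  have m1: "?zip \<in> measurable (?H \<Otimes>\<^sub>M ?H) ?Z"
    unfolding history_measure_def by (intro measurable_restrict) measurable
  have m2: "?map \<in> measurable ?Z ?H"
    unfolding history_measure_def
    by (intro measurable_restrict measurable_compose[OF _ measurable_splice_site] measurable_component_singleton)
  have eq: "?map \<circ> ?zip = (\<lambda>q. splice T (fst q) (snd q))"
    by (auto simp: splice_def fun_eq_iff)
  show "distr (?H \<Otimes>\<^sub>M ?H) ?H (\<lambda>q. splice T (fst q) (snd q)) = ?H"
    using distr_distr[OF m2 m1] d1 d2 unfolding eq by simp
  show "(\<lambda>q. splice T (fst q) (snd q)) \<in> measurable (?H \<Otimes>\<^sub>M ?H) ?H"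
    using measurable_comp[OF m1 m2] unfolding eq .
qed

section \<open>The trajectory of a history\<close>

definition spin0 :: "history \<Rightarrow> vertex \<Rightarrow> int" where "spin0 x v = fst (x v)"
definition toss :: "history \<Rightarrow> vertex \<Rightarrow> nat \<Rightarrow> int" where "toss x v n = snd (snd (x v) n)"
definition rt :: "history \<Rightarrow> vertex \<Rightarrow> nat \<Rightarrow> real" where "rt x v n = (\<Sum>k\<le>n. fst (snd (x v) k))"

text \<open>The earlier ring may influence the outcome of the later one. That there is no infinite
  backward chain of influence is what the construction takes from Harris' argument.\<close>

definition precedes :: "history \<Rightarrow> ((vertex \<times> nat) \<times> (vertex \<times> nat)) set" where
  "precedes x = {((w, m), (v, n)). v \<in> slab \<and> w \<in> insert v (neighbors v) \<and> rt x w m < rt x v n}"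

definition good :: "history \<Rightarrow> bool" where
  "good x \<longleftrightarrow> (\<forall>v\<in>slab. (\<forall>n. 0 < fst (snd (x v) n)) \<and> (\<forall>T. \<exists>n. T < rt x v n) \<and> spin0 x v \<in> {1, -1} \<and> (\<forall>n. toss x v n \<in> {1, -1}))
    \<and> (\<forall>v\<in>slab. \<forall>w\<in>slab. \<forall>n m. v \<noteq> w \<longrightarrow> rt x v n \<noteq> rt x w m) \<and> wf (precedes x)"

definition rings_before :: "history \<Rightarrow> vertex \<Rightarrow> real \<Rightarrow> nat" where
  "rings_before x v t = (LEAST n. t \<le> rt x v n)"

definition rings_upto :: "history \<Rightarrow> vertex \<Rightarrow> real \<Rightarrow> nat" where
  "rings_upto x v t = (LEAST n. t < rt x v n)"

text \<open>Approximations of the configuration just before a time: follow the dependencies backwards for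
  \<open>k\<close> rings, then use the initial spins.\<close>

primrec approx :: "nat \<Rightarrow> history \<Rightarrow> vertex \<Rightarrow> real \<Rightarrow> int" where
  "approx 0 x v t = spin0 x v"
| "approx (Suc k) x v t = (case rings_before x v t of 0 \<Rightarrow> spin0 x v
    | Suc n \<Rightarrow> updated_spin (\<lambda>w. approx k x w (rt x v n)) v (toss x v n))"

text \<open>The default value makes this a spin for every history, and the quantifiers over natural
  numbers keep it measurable.\<close>

definition before :: "history \<Rightarrow> real \<Rightarrow> config" where
  "before x t v = (if \<exists>K. \<forall>k\<ge>K. approx k x v t = 1 then 1 else - 1)"

definition spin :: "history \<Rightarrow> vertex \<Rightarrow> real \<Rightarrow> int" where
  "spin x v t = (case rings_upto x v t of 0 \<Rightarrow> spin0 x v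
    | Suc n \<Rightarrow> updated_spin (before x (rt x v n)) v (toss x v n))"

section \<open>Stabilisation of the approximations, existence and uniqueness of the
  trajectory\<close>

lemma near_slab: "v \<in> slab \<Longrightarrow> u \<in> insert v (neighbors v) \<Longrightarrow> u \<in> slab"
  using neighbors_slab by blast

lemma energy_cong: "(\<And>w. w \<in> insert v (neighbors v) \<Longrightarrow> \<eta> w = \<theta> w) \<Longrightarrow> energy \<eta> v = energy \<theta> v"
  unfolding energy_def by (intro arg_cong[where f = uminus] sum.cong) auto

lemma updated_spin_cong: "(\<And>w. w \<in> insert v (neighbors v) \<Longrightarrow> \<eta> w = \<theta> w) \<Longrightarrow> updated_spin \<eta> v c = updated_spin \<theta> v c"
  unfolding updated_spin_def using energy_cong[of v \<eta> \<theta>] by auto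

lemma updated_spin_sign: "\<eta> v \<in> {1, -1} \<Longrightarrow> c \<in> {1, -1} \<Longrightarrow> updated_spin \<eta> v c \<in> {1, -1}"
  by (auto simp: updated_spin_def)

context
  fixes x assumes g: "good x"
begin

lemma good_dest:
  assumes "v \<in> slab"
  shows "0 < fst (snd (x v) n)" "\<exists>n. T < rt x v n" "spin0 x v \<in> {1, -1}" "toss x v n \<in> {1, -1}"
  using g assms unfolding good_def by blast+

lemma rt_distinct: "v \<in> slab \<Longrightarrow> w \<in> slab \<Longrightarrow> v \<noteq> w \<Longrightarrow> rt x v n \<noteq> rt x w m"
  using g unfolding good_def by blast

lemma rt_strict_mono: "v \<in> slab \<Longrightarrow> strict_mono (rt x v)"
  unfolding strict_mono_Suc_iff rt_def using good_dest(1) by simp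

lemma rt_pos: "v \<in> slab \<Longrightarrow> 0 < rt x v n"
  unfolding rt_def by (intro sum_pos) (auto intro: good_dest(1))

lemma rings_before_iff: "v \<in> slab \<Longrightarrow> n < rings_before x v t \<longleftrightarrow> rt x v n < t"
proof -
  assume v: "v \<in> slab"
  obtain m where "t < rt x v m" using good_dest(2)[OF v] by blast
  then have L: "t \<le> rt x v (rings_before x v t)"
    unfolding rings_before_def by (intro LeastI[of "\<lambda>n. t \<le> rt x v n" m]) simp
  show ?thesis
  proof
    assume "n < rings_before x v t"
    then show "rt x v n < t" unfolding rings_before_def by (metis not_less_Least not_le)
  next
    assume "rt x v n < t"
    then have "rt x v n < rt x v (rings_before x v t)" using L by linarith
    then show "n < rings_before x v t" using strict_mono_less[OF rt_strict_mono[OF v]] by blast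
  qed
qed

lemma rings_upto_iff: "v \<in> slab \<Longrightarrow> n < rings_upto x v t \<longleftrightarrow> rt x v n \<le> t"
proof -
  assume v: "v \<in> slab"
  obtain m where "t < rt x v m" using good_dest(2)[OF v] by blast
  then have L: "t < rt x v (rings_upto x v t)"
    unfolding rings_upto_def by (intro LeastI[of "\<lambda>n. t < rt x v n" m]) simp
  show ?thesis
  proof
    assume "n < rings_upto x v t"
    then show "rt x v n \<le> t" unfolding rings_upto_def by (metis not_less_Least not_le)
  next
    assume "rt x v n \<le> t"
    then have "rt x v n < rt x v (rings_upto x v t)" using L by linarith
    then show "n < rings_upto x v t" using strict_mono_less[OF rt_strict_mono[OF v]] by blast
  qed
qed

lemma rings_upto_eqI: "v \<in> slab \<Longrightarrow> (\<And>n. rt x v n \<le> s \<longleftrightarrow> rt x v n \<le> t) \<Longrightarrow> rings_upto x v s = rings_upto x v t"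
  using rings_upto_iff by (metis linorder_neqE_nat less_irrefl)

lemma rings_upto_before_eqI: "v \<in> slab \<Longrightarrow> (\<And>n. rt x v n \<le> s \<longleftrightarrow> rt x v n < t) \<Longrightarrow> rings_upto x v s = rings_before x v t"
  using rings_upto_iff rings_before_iff by (metis linorder_neqE_nat less_irrefl)

lemma rings_upto_rt: "v \<in> slab \<Longrightarrow> rings_upto x v (rt x v n) = Suc n"
  using rings_upto_iff[of v _ "rt x v n"] strict_mono_less_eq[OF rt_strict_mono[of v]]
  by (metis less_Suc_eq_le linorder_neqE_nat less_irrefl)

lemma wf_precedes: "wf (precedes x)"
  using g unfolding good_def by blast

lemma approx_sign: "v \<in> slab \<Longrightarrow> approx k x v t \<in> {1, -1}"
proof (induction k arbitrary: v t)
  case 0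
  then show ?case using good_dest(3) by simp
next
  case (Suc k)
  show ?case
  proof (cases "rings_before x v t")
    case 0
    then show ?thesis using good_dest(3)[OF Suc.prems] by simp
  next
    case (Suc n)
    show ?thesis unfolding approx.simps Suc nat.case
      using Suc.IH[OF Suc.prems] good_dest(4)[OF Suc.prems] by (intro updated_spin_sign)
  qed
qed

text \<open>The approximation at a site depends on those of its neighbourhood at its last ring. By
  well-founded induction over rings these are eventually constant, and finitely many neighbours have
  a common threshold.\<close>

lemma approx_stable:
  assumes v: "v \<in> slab"
  shows "\<exists>K. \<forall>k\<ge>K. approx k x v t = before x t v"
proof -
  have lift: "\<exists>K c. \<forall>k\<ge>K. approx k x w t = c"
    if w: "w \<in> slab" and IH: "\<And>n u. rt x w n < t \<Longrightarrow> u \<in> insert w (neighbors w) \<Longrightarrow> \<exists>K c. \<forall>k\<ge>K. approx k x u (rt x w n) = c" for w t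
  proof (cases "rings_before x w t")
    case 0
    have "approx k x w t = spin0 x w" for k using 0 by (cases k) auto
    then show ?thesis by blast
  next
    case (Suc n)
    then have "rt x w n < t" using rings_before_iff[OF w, of n t] by simp
    from IH[OF this] have "\<forall>u\<in>insert w (neighbors w). \<exists>K c. \<forall>k\<ge>K. approx k x u (rt x w n) = c" by blast
    then obtain K c where Kc: "\<And>u k. u \<in> insert w (neighbors w) \<Longrightarrow> k \<ge> K u \<Longrightarrow> approx k x u (rt x w n) = c u"
      by metis
    define M where "M = Max (K ` insert w (neighbors w))"
    have M: "K u \<le> M" if "u \<in> insert w (neighbors w)" for u
      using that finite_neighbors[OF w] unfolding M_def by (intro Max_ge) auto
    have "approx k x w t = updated_spin c w (toss x w n)" if k: "k \<ge> Suc M" for k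
    proof -
      obtain k' where k': "k = Suc k'" "k' \<ge> M" using k by (cases k) auto
      show ?thesis unfolding k'(1) approx.simps Suc nat.case
      proof (rule updated_spin_cong)
        fix u assume u: "u \<in> insert w (neighbors w)"
        have "K u \<le> k'" using M[OF u] k'(2) by linarith
        then show "approx k' x u (rt x w n) = c u" by (rule Kc[OF u])
      qed
    qed
    then show ?thesis by blast
  qed
  have ring: "\<forall>u\<in>insert (fst r) (neighbors (fst r)). \<exists>K c. \<forall>k\<ge>K. approx k x u (rt x (fst r) (snd r)) = c" if "fst r \<in> slab" for r
    using that
  proof (induction r rule: wf_induct_rule[OF wf_precedes])
    case (1 r)
    show ?case
    proof
      fix u assume u: "u \<in> insert (fst r) (neighbors (fst r))"
      then have us: "u \<in> slab" using near_slab[OF 1(2)] by blast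
      show "\<exists>K c. \<forall>k\<ge>K. approx k x u (rt x (fst r) (snd r)) = c"
      proof (rule lift[OF us])
        fix n w assume n: "rt x u n < rt x (fst r) (snd r)" and w: "w \<in> insert u (neighbors u)"
        have "((u, n), r) \<in> precedes x"
          using n u 1(2) unfolding precedes_def by (cases r) simp
        from 1(1)[OF this, unfolded fst_conv snd_conv, OF us] w show "\<exists>K c. \<forall>k\<ge>K. approx k x w (rt x u n) = c" by blast
      qed
    qed
  qed
  obtain K c where K: "\<forall>k\<ge>K. approx k x v t = c"
    using lift[OF v] ring[of "(v, _)"] v by (metis fst_conv snd_conv)
  have c: "c \<in> {1, -1}" using approx_sign[OF v, of K t] K by auto
  have "before x t v = c"
  proof (cases "c = 1")
    case True
    then show ?thesis using K unfolding before_def by auto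
  next
    case False
    have "\<not> (\<forall>k\<ge>L. approx k x v t = 1)" for L
      using K[rule_format, of "max K L"] False by (metis max.cobounded1 max.cobounded2)
    then show ?thesis using c False unfolding before_def by auto
  qed
  then show ?thesis using K by (intro exI[of _ K]) simp
qed

lemma before_sign: "before x t v \<in> {1, -1}"
  unfolding before_def by simp

lemma before_eq:
  assumes v: "v \<in> slab"
  shows "before x t v = (case rings_before x v t of 0 \<Rightarrow> spin0 x v
    | Suc n \<Rightarrow> updated_spin (before x (rt x v n)) v (toss x v n))"
proof (cases "rings_before x v t")
  case 0
  obtain K where "\<forall>k\<ge>K. approx k x v t = before x t v" using approx_stable[OF v] by blast
  from this[rule_format, of K] show ?thesis using 0 by (cases K) auto
next
  case (Suc n)
  have "\<forall>u\<in>insert v (neighbors v). \<exists>K. \<forall>k\<ge>K. approx k x u (rt x v n) = before x (rt x v n) u"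
    using approx_stable v neighbors_slab by blast
  then obtain K where K: "\<And>u k. u \<in> insert v (neighbors v) \<Longrightarrow> k \<ge> K u \<Longrightarrow> approx k x u (rt x v n) = before x (rt x v n) u"
    by metis
  obtain L where L: "\<forall>k\<ge>L. approx k x v t = before x t v" using approx_stable[OF v] by blast
  define M where "M = max L (Max (K ` insert v (neighbors v)))"
  have M: "K u \<le> M" if "u \<in> insert v (neighbors v)" for u
    unfolding M_def using that finite_neighbors[OF v] by (intro max.coboundedI2 Max_ge) auto
  have "before x t v = approx (Suc M) x v t"
    by (rule L[rule_format, symmetric]) (simp add: M_def)
  also have "\<dots> = updated_spin (before x (rt x v n)) v (toss x v n)"
    unfolding approx.simps Suc nat.case by (rule updated_spin_cong) (use K M in blast)
  finally show ?thesis using Suc by simp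
qed

lemma spin_rt: "v \<in> slab \<Longrightarrow> spin x v (rt x v n) = updated_spin (before x (rt x v n)) v (toss x v n)"
  unfolding spin_def by (simp add: rings_upto_rt)

lemma spin_0: "v \<in> slab \<Longrightarrow> t < rt x v 0 \<Longrightarrow> spin x v t = spin0 x v"
  using rings_upto_iff[of v 0 t] unfolding spin_def by simp

lemma spin_const:
  assumes "v \<in> slab" "s \<le> t" "\<And>n. rt x v n \<notin> {s<..t}"
  shows "spin x v t = spin x v s"
proof -
  have "rt x v n \<le> t \<longleftrightarrow> rt x v n \<le> s" for n using assms(2) assms(3)[of n] by auto
  from rings_upto_eqI[OF assms(1) this] show ?thesis unfolding spin_def by simp
qed

lemma before_spin:
  assumes "v \<in> slab" "s < t" "\<And>n. rt x v n \<notin> {s<..<t}"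
  shows "before x t v = spin x v s"
proof -
  have "rt x v n \<le> s \<longleftrightarrow> rt x v n < t" for n using assms(2) assms(3)[of n] by auto
  from rings_upto_before_eqI[OF assms(1) this] show ?thesis unfolding spin_def before_eq[OF assms(1)] by simp
qed

lemma spin_sign: "v \<in> slab \<Longrightarrow> spin x v t \<in> {1, -1}"
  unfolding spin_def
  using good_dest(3) updated_spin_sign[OF before_sign good_dest(4)] by (cases "rings_upto x v t") simp_all

lemma gap:
  assumes v: "v \<in> slab" and t: "0 < t"
  obtains s where "0 \<le> s" "s < t" "\<And>n. rt x v n \<notin> {s<..<t}"
    "(case rings_before x v t of 0 \<Rightarrow> s = 0 | Suc n \<Rightarrow> s = rt x v n)"
proof (cases "rings_before x v t")
  case 0
  then have "\<not> rt x v n < t" for n using rings_before_iff[OF v, of n t] by simp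
  then show ?thesis using that[of 0] t 0 by auto
next
  case (Suc n)
  then have n: "rt x v n < t" using rings_before_iff[OF v, of n t] by simp
  have "rt x v m \<notin> {rt x v n<..<t}" for m
    using Suc rings_before_iff[OF v, of m t] strict_mono_less[OF rt_strict_mono[OF v], of n m] by auto
  then show ?thesis using that[of "rt x v n"] rt_pos[OF v, of n] n Suc by auto
qed

lemma config_before_eq:
  assumes v: "v \<in> slab" and t: "0 < t"
    and const: "\<And>s t. 0 \<le> s \<Longrightarrow> s \<le> t \<Longrightarrow> (\<And>n. rt x v n \<notin> {s<..t}) \<Longrightarrow> \<sigma> v t = \<sigma> v s"
    and s: "0 \<le> s" "s < t" "\<And>n. rt x v n \<notin> {s<..<t}"
  shows "config_before \<sigma> t v = (\<sigma> v s :: int)"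
proof -
  have "eventually (\<lambda>r. \<sigma> v r = \<sigma> v s) (at_left t)"
  proof (rule eventually_at_leftI[of s])
    fix r assume r: "r \<in> {s<..<t}"
    show "\<sigma> v r = \<sigma> v s"
    proof (rule const)
      show "rt x v n \<notin> {s<..r}" for n using s(3)[of n] r by auto
    qed (use s r in auto)
  qed (rule s(2))
  then have "((\<lambda>r. \<sigma> v r) \<longlongrightarrow> \<sigma> v s) (at_left t)"
    using tendsto_eventually by blast
  then show ?thesis unfolding config_before_def
    by (intro tendsto_Lim) (auto simp: trivial_limit_at_left_real)
qed

text \<open>The outcome of a ring is determined by the neighbourhood just before it, hence by
  initial spins and by rings that strictly precede it.\<close>

lemma trajectory_unique:
  assumes init: "\<And>v. v \<in> slab \<Longrightarrow> \<sigma> v 0 = spin0 x v"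
    and const: "\<And>v s t. v \<in> slab \<Longrightarrow> 0 \<le> s \<Longrightarrow> s \<le> t \<Longrightarrow> (\<And>n. rt x v n \<notin> {s<..t}) \<Longrightarrow> \<sigma> v t = \<sigma> v s"
    and jump: "\<And>v n. v \<in> slab \<Longrightarrow> \<sigma> v (rt x v n) = updated_spin (config_before \<sigma> (rt x v n)) v (toss x v n)"
    and v: "v \<in> slab" and t: "0 \<le> t"
  shows "\<sigma> v t = spin x v t"
proof -
  have ring: "\<sigma> (fst r) (rt x (fst r) (snd r)) = spin x (fst r) (rt x (fst r) (snd r))" if "fst r \<in> slab" for r
    using that
  proof (induction r rule: wf_induct_rule[OF wf_precedes])
    case (1 r)
    let ?t = "rt x (fst r) (snd r)"
    note v = 1(2)
    have t: "0 < ?t" by (rule rt_pos[OF v])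
    have "config_before \<sigma> ?t u = before x ?t u" if u: "u \<in> insert (fst r) (neighbors (fst r))" for u
    proof -
      have us: "u \<in> slab" using near_slab[OF v u] .
      obtain s where s: "0 \<le> s" "s < ?t" "\<And>n. rt x u n \<notin> {s<..<?t}"
        "(case rings_before x u ?t of 0 \<Rightarrow> s = 0 | Suc n \<Rightarrow> s = rt x u n)" by (rule gap[OF us t], rule that)
      have "config_before \<sigma> ?t u = \<sigma> u s"
        by (rule config_before_eq[of u ?t \<sigma>, OF us t const[OF us] s(1-3)])
      also have "\<dots> = spin x u s"
      proof (cases "rings_before x u ?t")
        case 0
        then show ?thesis using s(4) init[OF us] spin_0[OF us] rt_pos[OF us] by simp
      next
        case (Suc n)
        then have "s = rt x u n" using s(4) by simp
        moreover have "((u, n), r) \<in> precedes x"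
          using u v s(2) \<open>s = rt x u n\<close> unfolding precedes_def by (cases r) simp
        ultimately show ?thesis using 1(1)[of "(u, n)"] us by simp
      qed
      also have "\<dots> = before x ?t u" by (rule before_spin[OF us s(2,3), symmetric])
      finally show ?thesis .
    qed
    then show ?case unfolding jump[OF v] spin_rt[OF v] by (rule updated_spin_cong)
  qed
  show ?thesis
  proof (cases "rings_upto x v t")
    case 0
    then have "\<not> rt x v n \<le> t" for n using rings_upto_iff[OF v, of n t] by simp
    then have "rt x v n \<notin> {0<..t}" "\<not> rt x v n \<le> t" for n by auto
    then show ?thesis using const[OF v, of 0 t] t init[OF v] spin_0[OF v, of t] by (auto simp: not_le)
  next
    case (Suc n)
    then have n: "rt x v n \<le> t" using rings_upto_iff[OF v, of n t] by simp
    have none: "rt x v m \<notin> {rt x v n<..t}" for m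
      using Suc rings_upto_iff[OF v, of m t] strict_mono_less[OF rt_strict_mono[OF v], of n m] by auto
    have "\<sigma> v t = \<sigma> v (rt x v n)"
      using const[OF v _ n none] rt_pos[OF v, of n] by simp
    also have "\<dots> = spin x v (rt x v n)" using ring[of "(v, n)"] v by simp
    also have "\<dots> = spin x v t" by (rule spin_const[OF v n none, symmetric])
    finally show ?thesis .
  qed
qed

lemma config_before_spin:
  assumes v: "v \<in> slab" and t: "0 < t"
  shows "config_before (spin x) t v = before x t v"
proof -
  obtain s where s: "0 \<le> s" "s < t" "\<And>n. rt x v n \<notin> {s<..<t}" by (rule gap[OF v t], rule that)
  show ?thesis
    using config_before_eq[of v t "spin x", OF v t spin_const[OF v] s] before_spin[OF v s(2,3)] by simp
qed

end

lemma history_ring_time: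
  assumes "v \<in> slab"
  shows "ring_time \<omega> v n = rt (history \<omega>) v n" "initial_spin \<omega> v = spin0 (history \<omega>) v" "coin \<omega> v n = toss (history \<omega>) v n"
  using assms by (simp_all add: ring_time_def waiting_time_def rt_def history_def initial_spin_def spin0_def coin_def toss_def)

text \<open>Since \<open>spin\<close> is a trajectory, the choice in \<open>glauber\<close> picks a
  trajectory too, and uniqueness identifies the two.\<close>

theorem glauber_eq_spin:
  assumes g: "good (history \<omega>)" and v: "v \<in> slab" and t: "0 \<le> t"
  shows "glauber \<omega> v t = spin (history \<omega>) v t"
proof -
  let ?x = "history \<omega>"
  have "glauber_trajectory \<omega> (spin ?x)"
    unfolding glauber_trajectory_def
  proof (intro ballI conjI allI impI)
    fix v assume v: "v \<in> slab"
    show "spin ?x v 0 = initial_spin \<omega> v"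
      using spin_0[OF g v] rt_pos[OF g v] history_ring_time(2)[OF v] by simp
    show "spin ?x v t = spin ?x v s" if "0 \<le> s \<and> s \<le> t \<and> (\<forall>n. ring_time \<omega> v n \<notin> {s<..t})" for s t
      using that spin_const[OF g v, of s t] unfolding history_ring_time(1)[OF v] by blast
    show "spin ?x v (ring_time \<omega> v n) = updated_spin (config_before (spin ?x) (ring_time \<omega> v n)) v (coin \<omega> v n)" for n
      unfolding history_ring_time[OF v] spin_rt[OF g v]
      by (intro updated_spin_cong config_before_spin[OF g, symmetric] rt_pos[OF g v] near_slab[OF v])
  qed
  then have T: "glauber_trajectory \<omega> (glauber \<omega>)"
    unfolding glauber_def by (rule someI[where P = "glauber_trajectory \<omega>"])
  show ?thesis
  proof (rule trajectory_unique[OF g _ _ _ v t])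
    fix v assume v: "v \<in> slab"
    note T' = T[unfolded glauber_trajectory_def, rule_format, OF v]
    show "glauber \<omega> v 0 = spin0 ?x v" using T' history_ring_time(2)[OF v] by simp
    show "glauber \<omega> v t = glauber \<omega> v s" if "0 \<le> s" "s \<le> t" "\<And>n. rt ?x v n \<notin> {s<..t}" for s t
      using T' that unfolding history_ring_time(1)[OF v] by blast
    show "glauber \<omega> v (rt ?x v n) = updated_spin (config_before (glauber \<omega>) (rt ?x v n)) v (toss ?x v n)" for n
      using T' unfolding history_ring_time[OF v] by blast
  qed
qed

section \<open>Energy balance\<close>

lemma energy_count:
  assumes v: "v \<in> slab" and c: "c \<in> {1, -1}" and \<eta>: "\<And>w. w \<in> neighbors v \<Longrightarrow> \<eta> w \<in> {1, -1}" "\<eta> v = - c"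
  shows "energy \<eta> v = 2 * int (card {w \<in> neighbors v. \<eta> w = c}) - 6"
proof -
  have "- (\<eta> v * \<eta> w) = 2 * of_bool (\<eta> w = c) - 1" if "w \<in> neighbors v" for w
    using \<eta>(1)[OF that] \<eta>(2) c by auto
  then have "energy \<eta> v = (\<Sum>w\<in>neighbors v. 2 * of_bool (\<eta> w = c) - 1)"
    unfolding energy_def sum_negf[symmetric] by (intro sum.cong) auto
  also have "\<dots> = 2 * (\<Sum>w\<in>neighbors v. of_bool (\<eta> w = c)) - 6"
    using card_neighbors[OF v] by (simp add: sum_subtractf sum_distrib_left)
  finally show ?thesis using finite_neighbors[OF v] by (simp add: Int_def)
qed

definition lowers :: "history \<Rightarrow> vertex \<Rightarrow> nat \<Rightarrow> bool" where
  "lowers x v n \<longleftrightarrow> energy (before x (rt x v n)) v > 0"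


lemma energy_unlike:
  assumes v: "v \<in> slab" and \<eta>: "\<And>w. w \<in> insert v (neighbors v) \<Longrightarrow> \<eta> w \<in> {1, -1}"
  shows "energy \<eta> v = 2 * int (card {w \<in> neighbors v. \<eta> w \<noteq> \<eta> v}) - 6"
proof -
  have sv: "\<eta> v \<in> {1, -1}" by (rule \<eta>) simp
  have "{w \<in> neighbors v. \<eta> w = - \<eta> v} = {w \<in> neighbors v. \<eta> w \<noteq> \<eta> v}"
  proof -
    have "\<eta> w = - \<eta> v \<longleftrightarrow> \<eta> w \<noteq> \<eta> v" if "w \<in> neighbors v" for w
      using \<eta>[of w] \<eta>[of v] that by auto
    then show ?thesis by blast
  qed
  then show ?thesis
    using energy_count[of v "- \<eta> v" \<eta>, OF v _ \<eta>] sv by fastforce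
qed

text \<open>Pairs are ordered, so every unlike edge inside the box counts twice; hence the factors 4
  and 12 below.\<close>

definition unlike_pairs :: "vertex set \<Rightarrow> config \<Rightarrow> int" where
  "unlike_pairs \<Lambda> \<eta> = (\<Sum>u\<in>\<Lambda>. \<Sum>w\<in>\<Lambda>. of_bool (w \<in> neighbors u \<and> \<eta> u \<noteq> \<eta> w))"

lemma unlike_pairs_insert:
  assumes "finite \<Lambda>" "v \<notin> \<Lambda>"
  shows "unlike_pairs (insert v \<Lambda>) \<eta> = unlike_pairs \<Lambda> \<eta> + 2 * int (card {w \<in> neighbors v \<inter> \<Lambda>. \<eta> w \<noteq> \<eta> v})"
proof -
  have 1: "(\<Sum>w\<in>\<Lambda>. of_bool (w \<in> neighbors v \<and> \<eta> v \<noteq> \<eta> w)) = int (card {w \<in> neighbors v \<inter> \<Lambda>. \<eta> w \<noteq> \<eta> v})"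
    using assms(1) by (auto simp: Int_def intro!: arg_cong[where f = card])
  have 2: "(\<Sum>u\<in>\<Lambda>. of_bool (v \<in> neighbors u \<and> \<eta> u \<noteq> \<eta> v)) = int (card {w \<in> neighbors v \<inter> \<Lambda>. \<eta> w \<noteq> \<eta> v})"
    unfolding 1[symmetric] using neighbors_sym[of v] by (intro sum.cong) auto
  have split: "(\<Sum>u\<in>insert v \<Lambda>. \<Sum>w\<in>insert v \<Lambda>. b u w) = b v v + (\<Sum>w\<in>\<Lambda>. b v w) + (\<Sum>u\<in>\<Lambda>. b u v) + (\<Sum>u\<in>\<Lambda>. \<Sum>w\<in>\<Lambda>. b u w)"
    for b :: "vertex \<Rightarrow> vertex \<Rightarrow> int"
    using assms by (simp add: sum.distrib)
  show ?thesis
    unfolding unlike_pairs_def split 1 2 using neighbors_irrefl[of v] by simp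
qed

lemma unlike_pairs_cong: "(\<And>w. w \<in> \<Lambda> \<Longrightarrow> \<eta> w = \<theta> w) \<Longrightarrow> unlike_pairs \<Lambda> \<eta> = unlike_pairs \<Lambda> \<theta>"
  unfolding unlike_pairs_def by (intro sum.cong) auto

lemma unlike_pairs_bounds:
  assumes "finite \<Lambda>" "\<Lambda> \<subseteq> slab"
  shows "0 \<le> unlike_pairs \<Lambda> \<eta>" "unlike_pairs \<Lambda> \<eta> \<le> 6 * int (card \<Lambda>)"
proof -
  show "0 \<le> unlike_pairs \<Lambda> \<eta>" unfolding unlike_pairs_def by (intro sum_nonneg) auto
  have "(\<Sum>w\<in>\<Lambda>. of_bool (w \<in> neighbors u \<and> \<eta> u \<noteq> \<eta> w)) \<le> (6 :: int)" if "u \<in> \<Lambda>" for u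
  proof -
    have us: "u \<in> slab" using that assms(2) by blast
    have "(\<Sum>w\<in>\<Lambda>. of_bool (w \<in> neighbors u \<and> \<eta> u \<noteq> \<eta> w)) = int (card {w \<in> \<Lambda>. w \<in> neighbors u \<and> \<eta> u \<noteq> \<eta> w})"
      using assms(1) by (simp add: Int_def)
    also have "\<dots> \<le> int (card (neighbors u))"
      using finite_neighbors[OF us] by (intro of_nat_mono card_mono) auto
    finally show ?thesis using card_neighbors[OF us] by simp
  qed
  from sum_bounded_above[OF this] show "unlike_pairs \<Lambda> \<eta> \<le> 6 * int (card \<Lambda>)"
    unfolding unlike_pairs_def by (simp add: mult.commute)
qed

text \<open>A flip turns \<open>k\<close> unlike neighbours into \<open>6 - k\<close>. Positive
  energy means that \<open>k\<close> is at least 4, so at least two unlike edges disappear, each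
  counted twice. If part of the neighbourhood is outside the box, at most six unlike edges appear,
  again counted twice.\<close>

lemma unlike_pairs_update:
  assumes fin: "finite \<Lambda>" and sub: "\<Lambda> \<subseteq> slab" and v: "v \<in> \<Lambda>"
    and same: "\<And>w. w \<in> \<Lambda> - {v} \<Longrightarrow> \<theta> w = \<eta> w"
    and sign: "\<And>w. w \<in> slab \<Longrightarrow> \<eta> w \<in> {1, -1}" and c: "c \<in> {1, -1}" and new: "\<theta> v = updated_spin \<eta> v c"
  shows "neighbors v \<subseteq> \<Lambda> \<Longrightarrow> unlike_pairs \<Lambda> \<theta> + 4 * of_bool (energy \<eta> v > 0) \<le> unlike_pairs \<Lambda> \<eta>"
    "unlike_pairs \<Lambda> \<theta> \<le> unlike_pairs \<Lambda> \<eta> + 12"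
proof -
  define D where "D \<zeta> = {w \<in> neighbors v \<inter> (\<Lambda> - {v}). \<zeta> w \<noteq> \<zeta> v}" for \<zeta> :: config
  have vs: "v \<in> slab" using v sub by blast
  have \<Lambda>: "insert v (\<Lambda> - {v}) = \<Lambda>" using v by blast
  have H: "unlike_pairs \<Lambda> \<zeta> = unlike_pairs (\<Lambda> - {v}) \<zeta> + 2 * int (card (D \<zeta>))" for \<zeta>
    using unlike_pairs_insert[of "\<Lambda> - {v}" v \<zeta>] fin unfolding \<Lambda> D_def by simp
  have rest: "unlike_pairs (\<Lambda> - {v}) \<theta> = unlike_pairs (\<Lambda> - {v}) \<eta>"
    by (rule unlike_pairs_cong[OF same])
  have "card (D \<theta>) \<le> card (neighbors v)"
    unfolding D_def using finite_neighbors[OF vs] by (intro card_mono) auto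
  then show "unlike_pairs \<Lambda> \<theta> \<le> unlike_pairs \<Lambda> \<eta> + 12"
    unfolding H rest using card_neighbors[OF vs] by simp
  assume nb: "neighbors v \<subseteq> \<Lambda>"
  have nv: "neighbors v \<inter> (\<Lambda> - {v}) = neighbors v" using nb neighbors_irrefl by blast
  have sg: "\<eta> w \<in> {1, -1}" if "w \<in> insert v (neighbors v)" for w
    using sign near_slab[OF vs that] by blast
  have e: "energy \<eta> v = 2 * int (card (D \<eta>)) - 6"
    unfolding D_def nv using energy_unlike[OF vs sg] .
  have keep: "D \<theta> = D \<eta>" if "\<theta> v = \<eta> v"
    unfolding D_def using that same by (intro Collect_cong) (metis IntE)
  have flip: "card (D \<theta>) = 6 - card (D \<eta>)" if "\<theta> v = - \<eta> v"
  proof -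
    have "\<theta> w \<noteq> \<theta> v \<longleftrightarrow> \<eta> w = \<eta> v" if "w \<in> neighbors v" for w
    proof -
      have "w \<in> \<Lambda> - {v}" using that nv by blast
      then have "\<theta> w = \<eta> w" by (rule same)
      moreover have "\<eta> w = 1 \<or> \<eta> w = - 1" "\<eta> v = 1 \<or> \<eta> v = - 1" using sg[of w] sg[of v] that by simp_all
      ultimately show ?thesis using \<open>\<theta> v = - \<eta> v\<close> by (metis add.inverse_inverse one_neq_neg_one)
    qed
    then have "D \<theta> = neighbors v - D \<eta>" unfolding D_def nv by blast
    moreover have "D \<eta> \<subseteq> neighbors v" unfolding D_def by blast
    ultimately show ?thesis
      using finite_neighbors[OF vs] card_neighbors[OF vs] by (simp add: card_Diff_subset finite_subset)
  qed
  have "\<theta> v = \<eta> v \<or> \<theta> v = - \<eta> v"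
    using updated_spin_sign[of \<eta> v c, OF _ c] sg[of v] unfolding new by auto
  then show "unlike_pairs \<Lambda> \<theta> + 4 * of_bool (energy \<eta> v > 0) \<le> unlike_pairs \<Lambda> \<eta>"
    using keep flip new e sg[of v] unfolding H rest updated_spin_def by (auto split: if_splits)
qed

text \<open>Induction on the number of rings in the box. The last one, \<open>(v, n)\<close>, is
  undone by going back to the time \<open>s'\<close> of the ring before it.\<close>

lemma energy_balance:
  assumes g: "good x" and fin: "finite \<Lambda>" and sub: "\<Lambda> \<subseteq> slab"
  defines "I \<equiv> {v \<in> \<Lambda>. neighbors v \<subseteq> \<Lambda>}"
  shows "0 \<le> t \<Longrightarrow> unlike_pairs \<Lambda> (\<lambda>v. spin x v t) + 4 * (\<Sum>v\<in>I. int (card {n. n < rings_upto x v t \<and> lowers x v n}))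
    \<le> unlike_pairs \<Lambda> (spin0 x) + 12 * (\<Sum>v\<in>\<Lambda> - I. int (rings_upto x v t))"
proof (induction "\<Sum>v\<in>\<Lambda>. rings_upto x v t" arbitrary: t rule: less_induct)
  case less
  have fI: "finite I" "I \<subseteq> \<Lambda>" using fin by (auto simp: I_def)
  show ?case
  proof (cases "\<forall>v\<in>\<Lambda>. rings_upto x v t = 0")
    case True
    then have "spin x v t = spin0 x v" if "v \<in> \<Lambda>" for v using that by (simp add: spin_def)
    then have "unlike_pairs \<Lambda> (\<lambda>v. spin x v t) = unlike_pairs \<Lambda> (spin0 x)" by (rule unlike_pairs_cong)
    moreover have "(\<Sum>v\<in>I. int (card {n. n < rings_upto x v t \<and> lowers x v n})) = 0"
      using True fI by (intro sum.neutral) auto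
    ultimately show ?thesis by (simp add: sum_nonneg)
  next
    case False
    define R where "R = Sigma \<Lambda> (\<lambda>v. {..<rings_upto x v t})"
    have R: "finite R" "R \<noteq> {}" using fin False by (auto simp: R_def)
    let ?f = "\<lambda>q. rt x (fst q) (snd q)"
    have "Max (?f ` R) \<in> ?f ` R" using R by (intro Max_in) auto
    then obtain r where rR: "r \<in> R" "?f r = Max (?f ` R)" by auto
    have r: "r \<in> R" "\<And>q. q \<in> R \<Longrightarrow> rt x (fst q) (snd q) \<le> rt x (fst r) (snd r)"
      using rR(1) unfolding rR(2) by (auto intro!: Max_ge finite_imageI R(1))
    obtain v n where vn: "r = (v, n)" by fastforce
    let ?s = "rt x v n"
    have v: "v \<in> \<Lambda>" "v \<in> slab" and n: "n < rings_upto x v t" using r(1) sub unfolding vn R_def by auto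
    have mem: "(w, m) \<in> R \<longleftrightarrow> w \<in> \<Lambda> \<and> rt x w m \<le> t" for w m
      using rings_upto_iff[OF g, of w m t] sub unfolding R_def by auto
    have less: "rt x w m < ?s" if "(w, m) \<in> R" "(w, m) \<noteq> (v, n)" for w m
    proof -
      have "rt x w m \<le> ?s" using r(2)[OF that(1)] by (simp add: vn)
      moreover have "rt x w m \<noteq> ?s"
      proof (cases "w = v")
        case True
        then show ?thesis using that(2) strict_mono_eq[OF rt_strict_mono[OF g v(2)], of m n] by auto
      next
        case False
        have "w \<in> slab" using that(1) sub by (auto simp: R_def)
        then show ?thesis using rt_distinct[OF g _ v(2) False] by blast
      qed
      ultimately show ?thesis by simp
    qed
    have last: "Suc n = rings_upto x v t"
    proof (rule ccontr)
      assume "Suc n \<noteq> rings_upto x v t"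
      then have "(v, Suc n) \<in> R" using n v unfolding R_def by auto
      from less[OF this] show False using strict_mono_less[OF rt_strict_mono[OF g v(2)], of "Suc n" n] by simp
    qed
    \<comment> \<open>The inserted 0 serves the case in which the last ring is the only one.\<close>
    define s' where "s' = Max (insert 0 ((\<lambda>q. rt x (fst q) (snd q)) ` (R - {r})))"
    have fS: "finite (insert 0 ((\<lambda>q. rt x (fst q) (snd q)) ` (R - {r})))" using R by simp
    have s'0: "0 \<le> s'" unfolding s'_def by (rule Max_ge[OF fS]) simp
    have s'ge: "rt x w m \<le> s'" if "(w, m) \<in> R" "(w, m) \<noteq> (v, n)" for w m
      unfolding s'_def by (rule Max_ge[OF fS]) (use that vn in force)
    have s'lt: "s' < ?s"
    proof -
      have "rt x (fst q) (snd q) < ?s" if "q \<in> R - {r}" for q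
        using less[of "fst q" "snd q"] that unfolding vn by (metis DiffE prod.collapse singletonI)
      then have "\<forall>a\<in>insert 0 ((\<lambda>q. rt x (fst q) (snd q)) ` (R - {r})). a < ?s"
        using rt_pos[OF g v(2), of n] by blast
      then show ?thesis unfolding s'_def using Max_less_iff[OF fS] by blast
    qed
    have st: "?s \<le> t" using rings_upto_iff[OF g v(2), of n t] n by simp
    have w': "rings_upto x w s' = rings_upto x w t" if "w \<in> \<Lambda>" "w \<noteq> v" for w
    proof (rule rings_upto_eqI[OF g])
      show "w \<in> slab" using that sub by blast
      show "rt x w m \<le> s' \<longleftrightarrow> rt x w m \<le> t" for m
        using s'ge[of w m] mem[of w m] that s'lt st by auto
    qed
    have v': "rings_upto x v s' = n"
    proof -
      have "rt x v m \<le> s' \<longleftrightarrow> m < n" for m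
      proof
        assume "rt x v m \<le> s'"
        then show "m < n" using s'lt strict_mono_less[OF rt_strict_mono[OF g v(2)], of m n] by simp
      next
        assume "m < n"
        then have "(v, m) \<in> R" "(v, m) \<noteq> (v, n)" using n v(1) by (auto simp: R_def)
        then show "rt x v m \<le> s'" by (rule s'ge)
      qed
      then show ?thesis using rings_upto_iff[OF g v(2), of _ s'] by (metis linorder_neqE_nat less_irrefl)
    qed
    have sp: "spin x w t = spin x w s'" if "w \<in> \<Lambda> - {v}" for w
      unfolding spin_def using w'[of w] that by auto
    have bef: "before x ?s w = spin x w s'" if "w \<in> \<Lambda>" for w
    proof (rule before_spin[OF g _ s'lt])
      show "w \<in> slab" using that sub by blast
      show "rt x w m \<notin> {s'<..<?s}" for m
        using s'ge[of w m] mem[of w m] that st by force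
    qed
    have spv: "spin x v t = updated_spin (before x ?s) v (toss x v n)"
      unfolding spin_def last[symmetric] by simp
    let ?\<eta> = "before x ?s"
    have H: "unlike_pairs \<Lambda> ?\<eta> = unlike_pairs \<Lambda> (\<lambda>w. spin x w s')"
      by (rule unlike_pairs_cong[OF bef])
    note upd = unlike_pairs_update[OF fin sub v(1), of "\<lambda>w. spin x w t" ?\<eta> "toss x v n", OF _ before_sign[OF g] good_dest(4)[OF g v(2)] spv, unfolded H]
    have same: "spin x w t = ?\<eta> w" if "w \<in> \<Lambda> - {v}" for w using sp[OF that] bef[of w] that by simp
    have IH: "unlike_pairs \<Lambda> (\<lambda>v. spin x v s') + 4 * (\<Sum>v\<in>I. int (card {n. n < rings_upto x v s' \<and> lowers x v n}))
      \<le> unlike_pairs \<Lambda> (spin0 x) + 12 * (\<Sum>v\<in>\<Lambda> - I. int (rings_upto x v s'))"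
    proof (rule less.hyps[OF _ s'0])
      have "(\<Sum>w\<in>\<Lambda> - {v}. rings_upto x w s') = (\<Sum>w\<in>\<Lambda> - {v}. rings_upto x w t)"
        by (intro sum.cong refl w') blast+
      then show "(\<Sum>v\<in>\<Lambda>. rings_upto x v s') < (\<Sum>v\<in>\<Lambda>. rings_upto x v t)"
        using sum.remove[OF fin v(1), of "\<lambda>w. rings_upto x w s'"] sum.remove[OF fin v(1), of "\<lambda>w. rings_upto x w t"] v' last by simp
    qed
    let ?C = "\<lambda>t w. int (card {n. n < rings_upto x w t \<and> lowers x w n})"
    have lown: "energy ?\<eta> v > 0 \<longleftrightarrow> lowers x v n" by (simp add: lowers_def)
    have Cv: "?C t v = ?C s' v + of_bool (lowers x v n)"
    proof -
      have "{m. m < rings_upto x v t \<and> lowers x v m} = {m. m < n \<and> lowers x v m} \<union> (if lowers x v n then {n} else {})"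
        unfolding last[symmetric] by (auto simp: less_Suc_eq)
      then show ?thesis unfolding v' by (auto simp: card_insert_if)
    qed
    have Cw: "?C t w = ?C s' w" if "w \<in> \<Lambda> - {v}" for w using w'[of w] that by simp
    show ?thesis
    proof (cases "v \<in> I")
      case True
      have "(\<Sum>w\<in>I. ?C t w) = (\<Sum>w\<in>I. ?C s' w) + of_bool (lowers x v n)"
      proof -
        have "(\<Sum>w\<in>I - {v}. ?C t w) = (\<Sum>w\<in>I - {v}. ?C s' w)" using fI by (intro sum.cong refl Cw) blast
        then show ?thesis using sum.remove[OF fI(1) True, of "?C t"] sum.remove[OF fI(1) True, of "?C s'"] Cv by simp
      qed
      moreover have "(\<Sum>w\<in>\<Lambda> - I. int (rings_upto x w t)) = (\<Sum>w\<in>\<Lambda> - I. int (rings_upto x w s'))"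
        using True by (intro sum.cong refl arg_cong[where f = int] w'[symmetric]) blast+
      moreover have "unlike_pairs \<Lambda> (\<lambda>w. spin x w t) + 4 * of_bool (lowers x v n) \<le> unlike_pairs \<Lambda> (\<lambda>w. spin x w s')"
        using upd(1)[OF same] True unfolding lown I_def by simp
      ultimately show ?thesis using IH by linarith
    next
      case False
      have "(\<Sum>w\<in>I. ?C t w) = (\<Sum>w\<in>I. ?C s' w)" using fI False by (intro sum.cong refl Cw) blast
      moreover have "(\<Sum>w\<in>\<Lambda> - I. int (rings_upto x w t)) = (\<Sum>w\<in>\<Lambda> - I. int (rings_upto x w s')) + 1"
      proof -
        have vi: "v \<in> \<Lambda> - I" using False v by blast
        have f: "finite (\<Lambda> - I)" using fin by simp
        have "(\<Sum>w\<in>\<Lambda> - I - {v}. int (rings_upto x w t)) = (\<Sum>w\<in>\<Lambda> - I - {v}. int (rings_upto x w s'))"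
          by (intro sum.cong refl arg_cong[where f = int] w'[symmetric]) blast+
        then show ?thesis
          using sum.remove[OF f vi, of "\<lambda>w. int (rings_upto x w t)"] sum.remove[OF f vi, of "\<lambda>w. int (rings_upto x w s')"] v' last by simp
      qed
      ultimately show ?thesis using IH upd(2)[OF same] by linarith
    qed
  qed
qed

lemma lowers_bound:
  assumes g: "good x" and fin: "finite \<Lambda>" and sub: "\<Lambda> \<subseteq> slab" and t: "0 \<le> t"
  shows "4 * (\<Sum>v\<in>{v \<in> \<Lambda>. neighbors v \<subseteq> \<Lambda>}. int (card {n. n < rings_upto x v t \<and> lowers x v n}))
    \<le> 6 * int (card \<Lambda>) + 12 * (\<Sum>v\<in>\<Lambda> - {v \<in> \<Lambda>. neighbors v \<subseteq> \<Lambda>}. int (rings_upto x v t))"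
  using energy_balance[OF g fin sub t] unlike_pairs_bounds[OF fin sub, of "\<lambda>v. spin x v t"] unlike_pairs_bounds[OF fin sub, of "spin0 x"]
  by linarith

text \<open>The first ring to break the set would see at least four neighbours of spin 1, hence
  negative energy. Induction along \<open>precedes\<close> makes sense of "first" although
  infinitely many clocks are running.\<close>

lemma sturdy_persistent:
  assumes g: "good x" and B: "B \<subseteq> slab" "\<And>b. b \<in> B \<Longrightarrow> 4 \<le> card (neighbors b \<inter> B)" "\<And>b. b \<in> B \<Longrightarrow> spin0 x b = 1"
    and b: "b \<in> B"
  shows "spin x b t = 1"
proof -
  have ring: "fst r \<in> B \<longrightarrow> updated_spin (before x (rt x (fst r) (snd r))) (fst r) (toss x (fst r) (snd r)) = 1" for r
  proof (induction r rule: wf_induct_rule[OF wf_precedes[OF g]])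
    case (1 r)
    obtain v n where r: "r = (v, n)" by fastforce
    show ?case unfolding r fst_conv snd_conv
    proof
      assume v: "v \<in> B"
      then have vs: "v \<in> slab" using B by blast
      let ?t = "rt x v n"
      have bf: "before x ?t u = 1" if u: "u \<in> insert v (neighbors v)" "u \<in> B" for u
      proof (cases "rings_before x u ?t")
        case 0
        then show ?thesis using before_eq[OF g, of u ?t] B u by auto
      next
        case (Suc m)
        have us: "u \<in> slab" using u B by blast
        have "rt x u m < ?t" using rings_before_iff[OF g us, of m ?t] Suc by simp
        then have "((u, m), r) \<in> precedes x" using u vs unfolding precedes_def r by simp
        from 1[OF this] show ?thesis using before_eq[OF g us, of ?t] Suc u(2) by simp
      qed
      have "{w \<in> neighbors v. before x ?t w \<noteq> before x ?t v} \<subseteq> neighbors v - (neighbors v \<inter> B)"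
        using bf v by auto
      then have "card {w \<in> neighbors v. before x ?t w \<noteq> before x ?t v} \<le> card (neighbors v - (neighbors v \<inter> B))"
        using finite_neighbors[OF vs] by (intro card_mono) auto
      also have "\<dots> \<le> 2"
        using B(2)[OF v] finite_neighbors[OF vs] card_neighbors[OF vs] by (subst card_Diff_subset) auto
      finally have "energy (before x ?t) v < 0"
        using energy_unlike[of v "before x ?t", OF vs before_sign[OF g]] by simp
      then show "updated_spin (before x ?t) v (toss x v n) = 1"
        using bf[of v] v by (simp add: updated_spin_def)
    qed
  qed
  show ?thesis
    unfolding spin_def using ring[of "(b, _)"] B(3)[OF b] b by (cases "rings_upto x b t") auto
qed

text \<open>This is nonnegative energy: a ring at \<open>v\<close> could change its spin
  now.\<close>

definition flippable :: "history \<Rightarrow> real \<Rightarrow> vertex \<Rightarrow> bool" where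
  "flippable x t v \<longleftrightarrow> 3 \<le> card {w \<in> neighbors v. spin x w t \<noteq> spin x v t}"

lemma flip_flippable:
  assumes g: "good x" and v: "v \<in> slab" and flip: "spin x v (rt x v n) \<noteq> before x (rt x v n) v"
    and s: "s < rt x v n" "\<And>w m. w \<in> insert v (neighbors v) \<Longrightarrow> rt x w m \<notin> {s<..<rt x v n}"
  shows "flippable x s v"
proof -
  have b: "before x (rt x v n) w = spin x w s" if "w \<in> insert v (neighbors v)" for w
    by (rule before_spin[OF g near_slab[OF v that] s(1) s(2)[OF that]])
  have "energy (before x (rt x v n)) v \<ge> 0"
    using flip unfolding spin_rt[OF g v] updated_spin_def by (auto split: if_splits)
  then have "3 \<le> card {w \<in> neighbors v. before x (rt x v n) w \<noteq> before x (rt x v n) v}"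
    using energy_unlike[of v "before x (rt x v n)", OF v before_sign[OF g]] by simp
  also have "{w \<in> neighbors v. before x (rt x v n) w \<noteq> before x (rt x v n) v} = {w \<in> neighbors v. spin x w s \<noteq> spin x v s}"
    using b by auto
  finally show ?thesis unfolding flippable_def .
qed

text \<open>Blocks of initial spins 1 persist, so the enclosure found in the initial configuration
  is still one at time \<open>T\<close>. The value \<open>c\<close> records whether the descent
  raises or lowers spins.\<close>

theorem descent_exists:
  assumes g: "good x" and fin: "finite Q" and en: "enclosed (sturdy {v \<in> slab. spin0 x v = 1}) Q w" and l: "l \<in> {0, 1, 2}"
    and f: "flippable x T (site_of w l)"
  defines "S \<equiv> case_prod site_of ` (Q \<times> {0, 1, 2})"
  shows "\<exists>c P us u. c \<in> {1, -1} \<and> descends S P us u \<and> (\<forall>v\<in>slab. v \<in> P \<longleftrightarrow> spin x v T = c)"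
proof -
  define P where "P = {v \<in> slab. spin x v T = 1}"
  have sub: "sturdy {v \<in> slab. spin0 x v = 1} \<subseteq> sturdy P"
  proof
    fix y assume "y \<in> sturdy {v \<in> slab. spin0 x v = 1}"
    then obtain B where B: "B \<subseteq> {v \<in> slab. spin0 x v = 1}" "B \<subseteq> slab" "\<forall>b\<in>B. 4 \<le> card (neighbors b \<inter> B)" "\<forall>l\<in>{0, 1, 2}. site_of y l \<in> B"
      unfolding sturdy_def by blast
    have "spin x b T = 1" if "b \<in> B" for b
      by (rule sturdy_persistent[OF g B(2) _ _ that]) (use B in auto)
    then have "B \<subseteq> P" using B(2) unfolding P_def by blast
    then show "y \<in> sturdy P" using B unfolding sturdy_def by blast
  qed
  have en': "enclosed (sturdy P) Q w"
    using en sub unfolding enclosed_def by (meson subsetD)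
  let ?v = "site_of w l"
  have vs: "?v \<in> slab" by (rule site_of_slab[OF l])
  have "if ?v \<in> P then 3 \<le> card (neighbors ?v - P) else 3 \<le> card (neighbors ?v \<inter> P)"
  proof (cases "?v \<in> P")
    case True
    have "spin x u T \<noteq> spin x ?v T \<longleftrightarrow> u \<notin> P" if "u \<in> neighbors ?v" for u
      using True neighbors_slab[OF that] unfolding P_def by auto
    then have "{u \<in> neighbors ?v. spin x u T \<noteq> spin x ?v T} = neighbors ?v - P" by blast
    then show ?thesis using f True unfolding flippable_def by simp
  next
    case False
    have "spin x u T \<noteq> spin x ?v T \<longleftrightarrow> u \<in> P" if "u \<in> neighbors ?v" for u
      using False spin_sign[OF g vs, of T] spin_sign[OF g neighbors_slab[OF that], of T] neighbors_slab[OF that] vs unfolding P_def by auto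
    then have "{u \<in> neighbors ?v. spin x u T \<noteq> spin x ?v T} = neighbors ?v \<inter> P" by blast
    then show ?thesis using f False unfolding flippable_def by simp
  qed
  from descends_if_enclosed[OF fin en' l this] have "(\<exists>us u. descends S P us u) \<or> (\<exists>us u. descends S (- P) us u)"
    unfolding S_def .
  moreover have "\<forall>v\<in>slab. v \<in> P \<longleftrightarrow> spin x v T = 1"
    unfolding P_def by blast
  moreover have "\<forall>v\<in>slab. v \<in> - P \<longleftrightarrow> spin x v T = - 1"
  proof
    fix v :: vertex assume "v \<in> slab"
    then show "v \<in> - P \<longleftrightarrow> spin x v T = - 1" using spin_sign[OF g, of v T] unfolding P_def by auto
  qed
  ultimately show ?thesis
    by (elim disjE exE) (rule exI[of _ 1] exI[of _ "-1"], rule exI, rule exI, rule exI, intro conjI, simp, assumption, assumption)+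
qed

section \<open>Horizontal translations\<close>

definition tr :: "int \<Rightarrow> int \<Rightarrow> vertex \<Rightarrow> vertex" where
  "tr i j v = (fst v + i, fst (snd v) + j, snd (snd v))"

definition shift :: "int \<Rightarrow> int \<Rightarrow> history \<Rightarrow> history" where
  "shift i j x = (\<lambda>v\<in>slab. x (tr i j v))"

lemma tr_slab: "tr i j v \<in> slab \<longleftrightarrow> v \<in> slab"
  by (cases v) (auto simp: tr_def slab_iff)

lemma inj_tr: "inj_on (tr i j) A"
  by (auto simp: inj_on_def tr_def)

lemma neighbors_tr: "neighbors (tr i j v) = tr i j ` neighbors v"
proof (rule set_eqI)
  fix u :: vertex
  obtain a b c a' b' c' where "v = (a, b, c)" "u = (a', b', c')" by (metis prod_cases3)
  moreover have "u \<in> neighbors (tr i j v) \<longleftrightarrow> tr (- i) (- j) u \<in> neighbors v"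
    unfolding calculation by (simp add: tr_def mem_neighbors_iff algebra_simps)
  moreover have "tr (- i) (- j) u \<in> neighbors v \<longleftrightarrow> u \<in> tr i j ` neighbors v"
  proof
    assume "tr (- i) (- j) u \<in> neighbors v"
    then show "u \<in> tr i j ` neighbors v" by (intro image_eqI[of _ _ "tr (- i) (- j) u"]) (auto simp: tr_def)
  qed (auto simp: tr_def)
  ultimately show "u \<in> neighbors (tr i j v) \<longleftrightarrow> u \<in> tr i j ` neighbors v" by simp
qed

lemma energy_tr: "energy \<eta> (tr i j v) = energy (\<lambda>w. \<eta> (tr i j w)) v"
  unfolding energy_def neighbors_tr by (simp add: sum.reindex[OF inj_tr])

lemma shift_site:
  assumes "v \<in> slab"
  shows "rt (shift i j x) v n = rt x (tr i j v) n" "toss (shift i j x) v n = toss x (tr i j v) n" "spin0 (shift i j x) v = spin0 x (tr i j v)"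
    "rings_before (shift i j x) v t = rings_before x (tr i j v) t" "rings_upto (shift i j x) v t = rings_upto x (tr i j v) t"
  using assms by (simp_all add: rt_def toss_def spin0_def rings_before_def rings_upto_def shift_def)

lemma approx_shift: "v \<in> slab \<Longrightarrow> approx k (shift i j x) v t = approx k x (tr i j v) t"
proof (induction k arbitrary: v t)
  case 0
  then show ?case by (simp add: shift_site)
next
  case (Suc k)
  have "updated_spin (\<lambda>w. approx k (shift i j x) w s) v c = updated_spin (\<lambda>w. approx k x w s) (tr i j v) c" for s c
  proof -
    have "updated_spin (\<lambda>w. approx k (shift i j x) w s) v c = updated_spin (\<lambda>w. approx k x (tr i j w) s) v c"
      by (rule updated_spin_cong) (rule Suc.IH[OF near_slab[OF Suc.prems]])
    then show ?thesis unfolding updated_spin_def energy_tr by simp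
  qed
  then show ?case using Suc.prems by (simp add: shift_site split: nat.split)
qed

lemma lowers_shift: "v \<in> slab \<Longrightarrow> lowers (shift i j x) v n = lowers x (tr i j v) n"
proof -
  assume v: "v \<in> slab"
  have "energy (before (shift i j x) t) v = energy (\<lambda>w. before x t (tr i j w)) v" for t
    by (rule energy_cong) (simp add: before_def approx_shift[OF near_slab[OF v]])
  then show ?thesis unfolding lowers_def energy_tr shift_site(1)[OF v] by simp
qed

section \<open>Following a prescribed sequence of flips\<close>

lemma restart_before:
  "(\<And>j. j \<le> n \<Longrightarrow> (\<Sum>k\<le>j. fst (\<xi> k)) \<le> T) \<Longrightarrow> restart n T \<xi> \<zeta> = \<xi> n"
proof (induction n arbitrary: T \<xi>)
  case 0
  from 0[of 0] show ?case by simp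
next
  case (Suc n)
  have "restart n (T - fst (\<xi> 0)) (\<lambda>k. \<xi> (Suc k)) \<zeta> = \<xi> (Suc n)"
  proof (rule Suc.IH)
    fix j assume "j \<le> n"
    with Suc.prems[of "Suc j"] show "(\<Sum>k\<le>j. fst (\<xi> (Suc k))) \<le> T - fst (\<xi> 0)"
      by (simp add: sum.atMost_Suc_shift del: sum.atMost_Suc)
  qed
  then show ?case using Suc.prems[of 0] by simp
qed

text \<open>\<open>K\<close> is the index of the waiting time that straddles \<open>T\<close>. From
  there on the fresh clock is read from its first entry, so its ring times are just delayed by
  \<open>T\<close>.\<close>

lemma restart_after:
  "(\<And>j. j < K \<Longrightarrow> (\<Sum>k\<le>j. fst (\<xi> k)) \<le> T) \<Longrightarrow> (\<Sum>k\<le>K. fst (\<xi> k)) > T \<Longrightarrow>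
   (\<Sum>k\<le>K + j. fst (restart k T \<xi> \<zeta>)) = T + (\<Sum>k\<le>j. fst (\<zeta> k)) \<and> snd (restart (K + j) T \<xi> \<zeta>) = snd (\<zeta> j)"
proof (induction K arbitrary: T \<xi>)
  case 0
  then have "fst (\<xi> 0) > T" by simp
  then have "restart k T \<xi> \<zeta> = (if k = 0 then (T + fst (\<zeta> 0), snd (\<zeta> 0)) else \<zeta> k)" for k
    by (cases k) auto
  moreover have "(\<Sum>k\<le>j. if k = 0 then T + fst (\<zeta> 0) else fst (\<zeta> k)) = T + (\<Sum>k\<le>j. fst (\<zeta> k))"
    by (induction j) auto
  ultimately show ?case by (simp add: if_distrib[of fst] cong: if_cong)
next
  case (Suc K)
  have le: "fst (\<xi> 0) \<le> T" using Suc.prems(1)[of 0] by simp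
  have "(\<Sum>k\<le>K + j. fst (restart k (T - fst (\<xi> 0)) (\<lambda>k. \<xi> (Suc k)) \<zeta>)) = (T - fst (\<xi> 0)) + (\<Sum>k\<le>j. fst (\<zeta> k))
    \<and> snd (restart (K + j) (T - fst (\<xi> 0)) (\<lambda>k. \<xi> (Suc k)) \<zeta>) = snd (\<zeta> j)"
  proof (rule Suc.IH)
    fix j assume "j < K"
    with Suc.prems(1)[of "Suc j"] show "(\<Sum>k\<le>j. fst (\<xi> (Suc k))) \<le> T - fst (\<xi> 0)"
      by (simp add: sum.atMost_Suc_shift del: sum.atMost_Suc)
  next
    show "T - fst (\<xi> 0) < (\<Sum>k\<le>K. fst (\<xi> (Suc k)))"
      using Suc.prems(2) by (simp add: sum.atMost_Suc_shift del: sum.atMost_Suc)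
  qed
  then show ?case using le by (simp add: sum.atMost_Suc_shift del: sum.atMost_Suc)
qed

lemma splice_rings:
  assumes g: "good x" and v: "v \<in> slab" and K: "K = rings_upto x v T"
  shows "n < K \<Longrightarrow> rt (splice T x y) v n = rt x v n" "n < K \<Longrightarrow> toss (splice T x y) v n = toss x v n"
    "rt (splice T x y) v (K + j) = T + rt y v j" "toss (splice T x y) v (K + j) = toss y v j"
    "spin0 (splice T x y) v = spin0 x v"
proof -
  have le: "(\<Sum>k\<le>j. fst (snd (x v) k)) \<le> T" if "j < K" for j
    using that rings_upto_iff[OF g v] unfolding K rt_def by blast
  have gt: "(\<Sum>k\<le>K. fst (snd (x v) k)) > T"
    using rings_upto_iff[OF g v, of K T] unfolding K rt_def by (meson less_irrefl not_le)
  have s: "snd (splice T x y v) n = restart n T (snd (x v)) (snd (y v))" for n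
    using v by (simp add: splice_def splice_site_def splice_at_def)
  have b: "restart m T (snd (x v)) (snd (y v)) = snd (x v) m" if "m < K" for m
    by (rule restart_before) (use le that in auto)
  show "rt (splice T x y) v n = rt x v n" if "n < K"
    unfolding rt_def s using b that by (intro sum.cong) auto
  show "toss (splice T x y) v n = toss x v n" if "n < K"
    unfolding toss_def s using b that by simp
  show "rt (splice T x y) v (K + j) = T + rt y v j" "toss (splice T x y) v (K + j) = toss y v j"
    unfolding rt_def toss_def s using restart_after[where K = K and \<xi> = "snd (x v)" and T = T and j = j and \<zeta> = "snd (y v)", OF le gt] by blast+
  show "spin0 (splice T x y) v = spin0 x v"
    using v by (simp add: spin0_def splice_def splice_site_def)
qed

text \<open>The rings that can influence a ring up to time \<open>T\<close> are themselves rings up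
  to \<open>T\<close>, on which the two histories agree.\<close>

lemma spin_agree:
  assumes g: "good x" "good x'"
    and init: "\<And>v. v \<in> slab \<Longrightarrow> spin0 x' v = spin0 x v"
    and same: "\<And>v n. v \<in> slab \<Longrightarrow> n < rings_upto x v T \<Longrightarrow> rt x' v n = rt x v n \<and> toss x' v n = toss x v n"
    and num: "\<And>v. v \<in> slab \<Longrightarrow> rings_upto x' v T = rings_upto x v T"
    and v: "v \<in> slab" and t: "0 \<le> t" "t \<le> T"
  shows "spin x' v t = spin x v t"
proof -
  have sub: "rt x' u n = rt x u n" if "u \<in> slab" "rt x' u n \<le> T \<or> rt x u n \<le> T" for u n
  proof -
    have "n < rings_upto x u T"
      using that(2) rings_upto_iff[OF g(1) that(1), of n T] rings_upto_iff[OF g(2) that(1), of n T]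
      unfolding num[OF that(1)] by blast
    then show ?thesis using same[OF that(1)] by blast
  qed
  have ring: "rt x (fst r) (snd r) \<le> T \<longrightarrow> spin x' (fst r) (rt x (fst r) (snd r)) = spin x (fst r) (rt x (fst r) (snd r))" if "fst r \<in> slab" for r
    using that
  proof (induction r rule: wf_induct_rule[OF wf_precedes[OF g(1)]])
    case (1 r)
    obtain v n where r: "r = (v, n)" by fastforce
    have v: "v \<in> slab" using 1(2) r by simp
    let ?t = "rt x v n"
    show ?case unfolding r fst_conv snd_conv
    proof
      assume T: "?t \<le> T"
      have t: "0 < ?t" by (rule rt_pos[OF g(1) v])
      have "before x' ?t u = before x ?t u" if u: "u \<in> insert v (neighbors v)" for u
      proof -
        have us: "u \<in> slab" using near_slab[OF v u] .
        obtain s where s: "0 \<le> s" "s < ?t" "\<And>n. rt x u n \<notin> {s<..<?t}"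
          "(case rings_before x u ?t of 0 \<Rightarrow> s = 0 | Suc n \<Rightarrow> s = rt x u n)" by (rule gap[OF g(1) us t], rule that)
        have s': "rt x' u n \<notin> {s<..<?t}" for n
          using s(3)[of n] sub[OF us, of n] T by auto
        have "before x' ?t u = spin x' u s" by (rule before_spin[OF g(2) us s(2) s'])
        also have "\<dots> = spin x u s"
        proof (cases "rings_before x u ?t")
          case 0
          then show ?thesis using s(4) init[OF us] spin_0[OF g(1) us] spin_0[OF g(2) us] rt_pos[OF g(1) us] rt_pos[OF g(2) us] by simp
        next
          case (Suc n)
          then have sn: "s = rt x u n" using s(4) by simp
          moreover have "((u, n), r) \<in> precedes x"
            using u v s(2) sn unfolding precedes_def r by simp
          ultimately show ?thesis using 1(1)[of "(u, n)"] us s(2) T by simp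
        qed
        also have "\<dots> = before x ?t u" by (rule before_spin[OF g(1) us s(2,3), symmetric])
        finally show ?thesis .
      qed
      then have b: "updated_spin (before x' ?t) v c = updated_spin (before x ?t) v c" for c by (rule updated_spin_cong)
      have "n < rings_upto x v T" using rings_upto_iff[OF g(1) v] T by blast
      then have "rt x' v n = ?t" "toss x' v n = toss x v n" using same[OF v] by blast+
      then show "spin x' v ?t = spin x v ?t"
        using spin_rt[OF g(1) v, of n] spin_rt[OF g(2) v, of n] b by simp
    qed
  qed
  show ?thesis
  proof (cases "rings_upto x v t")
    case 0
    then have no: "\<not> rt x v n \<le> t" for n using rings_upto_iff[OF g(1) v, of n t] by simp
    then have "\<not> rt x' v n \<le> t" for n using sub[OF v, of n] t by force
    then show ?thesis using no spin_0[OF g(1) v, of t] spin_0[OF g(2) v, of t] init[OF v] by (simp add: not_le)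
  next
    case (Suc n)
    then have n: "rt x v n \<le> t" using rings_upto_iff[OF g(1) v, of n t] by simp
    have none: "rt x v m \<notin> {rt x v n<..t}" for m
      using Suc rings_upto_iff[OF g(1) v, of m t] strict_mono_less[OF rt_strict_mono[OF g(1) v], of n m] by auto
    have none': "rt x' v m \<notin> {rt x v n<..t}" for m
      using none[of m] sub[OF v, of m] t by auto
    show ?thesis
      using spin_const[OF g(1) v n none] spin_const[OF g(2) v n none'] ring[of "(v, n)"] v n t by simp
  qed
qed

lemma splice_rings_upto:
  assumes g: "good x" "good (splice T x y)" and y: "good y" and v: "v \<in> slab"
  shows "rings_upto (splice T x y) v T = rings_upto x v T"
proof -
  let ?K = "rings_upto x v T"
  note sr = splice_rings[OF g(1) v refl, where y = y and T = T]
  have "rt (splice T x y) v n \<le> T \<longleftrightarrow> n < ?K" for n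
  proof (cases "n < ?K")
    case True
    then show ?thesis using sr(1)[of n] rings_upto_iff[OF g(1) v, of n T] by simp
  next
    case False
    then have "n = ?K + (n - ?K)" by simp
    then have "rt (splice T x y) v n = T + rt y v (n - ?K)" using sr(3)[of "n - ?K"] by metis
    then show ?thesis using rt_pos[OF y v, of "n - ?K"] False by simp
  qed
  then show ?thesis using rings_upto_iff[OF g(2) v, of _ T] by (metis linorder_neqE_nat less_irrefl)
qed

lemma spin_splice:
  assumes "good x" "good y" "good (splice T x y)" "v \<in> slab" "0 \<le> t" "t \<le> T"
  shows "spin (splice T x y) v t = spin x v t"
  by (rule spin_agree[OF assms(1,3) _ _ _ assms(4-6)])
    (use splice_rings[OF assms(1)] splice_rings_upto[OF assms(1,3,2)] in auto)

text \<open>Slots of length \<open>1 / length L\<close> force the order of the rings. Second rings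
  and all other clocks in \<open>B\<close> wait for more than one unit of time, so the sequence runs
  undisturbed.\<close>

definition follows :: "vertex set \<Rightarrow> vertex list \<Rightarrow> int \<Rightarrow> history \<Rightarrow> bool" where
  "follows B L c y \<longleftrightarrow> (\<forall>v\<in>B - set L. 1 < rt y v 0) \<and>
    (\<forall>i<length L. real i / length L < rt y (L ! i) 0 \<and> rt y (L ! i) 0 \<le> real (Suc i) / length L
      \<and> 1 < rt y (L ! i) 1 \<and> toss y (L ! i) 0 = c)"

text \<open>Each site of \<open>us\<close> has zero energy when it rings, so its coin decides and
  flips it to \<open>c\<close>. When the turn of \<open>u\<close> comes, exactly the sites of
  \<open>us\<close> have changed, and its energy is positive.\<close>

theorem follows_lowers:
  assumes g: "good x" "good y" "good (splice T x y)" and T: "0 \<le> T"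
    and c: "c \<in> {1, -1}" and P: "\<And>v. v \<in> slab \<Longrightarrow> v \<in> P \<longleftrightarrow> spin x v T = c"
    and d: "descends S P us u" and S: "S \<subseteq> slab"
    and B: "\<And>v. v \<in> S \<Longrightarrow> insert v (neighbors v) \<subseteq> B" "B \<subseteq> slab"
    and f: "follows B (us @ [u]) c y"
  shows "\<exists>n. lowers (splice T x y) u n \<and> rt (splice T x y) u n \<in> {T<..T + 1}"
proof -
  define z where "z = splice T x y"
  define L where "L = us @ [u]"
  let ?m = "length L"
  have gz: "good z" using g(3) by (simp add: z_def)
  have m: "?m > 0" by (simp add: L_def)
  have LS: "distinct L" "set L \<subseteq> S - P"
    using d ties_distinct[of S P us] unfolding descends_def L_def by auto
  have LB: "L ! i \<in> B" "L ! i \<in> slab" "insert (L ! i) (neighbors (L ! i)) \<subseteq> B" if "i < ?m" for i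
    using nth_mem[OF that] LS(2) B S by blast+
  define \<tau> where "\<tau> i = T + rt y (L ! i) 0" for i
  have f1: "real i / ?m < rt y (L ! i) 0" "rt y (L ! i) 0 \<le> real (Suc i) / ?m" "1 < rt y (L ! i) 1" "toss y (L ! i) 0 = c"
    if "i < ?m" for i
    using f that unfolding follows_def L_def[symmetric] by blast+
  have f2: "1 < rt y v 0" if "v \<in> B - set L" for v
    using f that unfolding follows_def L_def[symmetric] by blast
  have tau_le: "\<tau> i \<le> T + 1" if "i < ?m" for i
  proof -
    have "real (Suc i) / ?m \<le> 1" using that m by (subst divide_le_eq_1_pos) auto
    then show ?thesis using f1(2)[OF that] by (simp add: \<tau>_def)
  qed
  have tau_gt: "T < \<tau> i" if "i < ?m" for i
    using rt_pos[OF g(2) LB(2)[OF that]] by (simp add: \<tau>_def)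
  have tau_less: "\<tau> i < \<tau> j" if "i < j" "j < ?m" for i j
  proof -
    have "real (Suc i) / ?m \<le> real j / ?m" using that by (intro divide_right_mono) auto
    then show ?thesis using f1(2)[of i] f1(1)[of j] that by (simp add: \<tau>_def)
  qed
  have rings: "rt z w n \<le> T \<or> (\<exists>j. rt z w n = T + rt y w j)" if "w \<in> slab" for w n
  proof (cases "n < rings_upto x w T")
    case True
    then show ?thesis using splice_rings(1)[OF g(1) that refl True] rings_upto_iff[OF g(1) that, of n T] by (simp add: z_def)
  next
    case False
    then have "n = rings_upto x w T + (n - rings_upto x w T)" by simp
    then show ?thesis using splice_rings(3)[OF g(1) that refl] unfolding z_def by metis
  qed
  have late: "rt y w 0 \<le> rt y w j" "j = 0 \<or> rt y w 1 \<le> rt y w j" if "w \<in> slab" for w j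
    using strict_mono_less_eq[OF rt_strict_mono[OF g(2) that]] by (auto simp: Suc_le_eq)
  have rings3: "rt z w n \<le> T \<or> rt z w n = T + rt y w 0 \<or> T + rt y w 1 \<le> rt z w n"
    and rings2: "rt z w n \<le> T \<or> T + rt y w 0 \<le> rt z w n" if "w \<in> slab" for w n
  proof -
    from rings[OF that, of n] show "rt z w n \<le> T \<or> rt z w n = T + rt y w 0 \<or> T + rt y w 1 \<le> rt z w n"
    proof (elim disjE exE)
      fix j assume "rt z w n = T + rt y w j"
      then show ?thesis using late(2)[OF that, of j] by auto
    qed simp
    from rings[OF that, of n] show "rt z w n \<le> T \<or> T + rt y w 0 \<le> rt z w n"
    proof (elim disjE exE)
      fix j assume "rt z w n = T + rt y w j"
      then show ?thesis using late(1)[OF that, of j] by auto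
    qed simp
  qed
  have ring_i: "\<tau> i = rt z (L ! i) (rings_upto x (L ! i) T)" "toss z (L ! i) (rings_upto x (L ! i) T) = c" if "i < ?m" for i
    using splice_rings(3,4)[OF g(1) LB(2)[OF that] refl, where y = y and T = T and j = 0] f1(4)[OF that] by (simp_all add: z_def \<tau>_def)
  have quiet: "before z (\<tau> i) w = spin x w T" if i: "i < ?m" and w: "w \<in> B" "w \<notin> set (take i L)" for i w
  proof -
    have ws: "w \<in> slab" using w B by blast
    have no: "rt z w n \<notin> {T<..<\<tau> i}" for n
    proof (cases "w \<in> set L")
      case False
      then have "1 < rt y w 0" using f2[of w] w by blast
      then show ?thesis using rings2[OF ws, of n] tau_le[OF i] by auto
    next
      case True
      then obtain j where j: "j < ?m" "w = L ! j" by (auto simp: in_set_conv_nth)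
      have "i \<le> j" using w(2) j by (auto simp: in_set_conv_nth not_less[symmetric])
      then have "\<tau> i \<le> \<tau> j" using tau_less[of i j] j by (cases "i = j") auto
      then show ?thesis using rings2[OF ws, of n] j unfolding \<tau>_def by auto
    qed
    have "before z (\<tau> i) w = spin z w T" by (rule before_spin[OF gz ws tau_gt[OF i] no])
    then show ?thesis using spin_splice[OF g ws T] by (simp add: z_def)
  qed
  \<comment> \<open>The second conjunct, the outcome of the ring in slot \<open>i\<close>, is proved
    along with the configuration before it because the later slots rely on it.\<close>
  have conf: "before z (\<tau> i) w = (if w \<in> set (take i L) then c else spin x w T) \<and> (i < length us \<longrightarrow> spin z (L ! i) (\<tau> i) = c)"
    if i: "i < ?m" and w: "w \<in> B" for i w
    using i w
  proof (induction i arbitrary: w rule: less_induct)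
    case (less i)
    have b: "before z (\<tau> i) w = (if w \<in> set (take i L) then c else spin x w T)" if w: "w \<in> B" for w
    proof (cases "w \<in> set (take i L)")
      case False
      then show ?thesis using quiet[OF less.prems(1) w] by simp
    next
      case True
      then obtain j where j: "j < i" "w = L ! j" using less.prems(1) by (auto simp: in_set_conv_nth)
      have jm: "j < ?m" "j < length us" using j less.prems by (auto simp: L_def)
      have ws: "w \<in> slab" using LB(2)[OF jm(1)] j by simp
      have no: "rt z w n \<notin> {\<tau> j<..<\<tau> i}" for n
        using rings3[OF ws, of n] f1(3)[OF jm(1)] tau_le[OF less.prems(1)] j(2) tau_gt[OF jm(1)]
        unfolding \<tau>_def by auto
      have "before z (\<tau> i) w = spin z w (\<tau> j)"
        by (rule before_spin[OF gz ws tau_less[OF j(1) less.prems(1)] no])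
      also have "\<dots> = c" using less.IH[OF j(1) jm(1) w] jm(2) j(2) by simp
      finally show ?thesis using True by simp
    qed
    have "spin z (L ! i) (\<tau> i) = c" if ius: "i < length us"
    proof -
      have Li: "L ! i = us ! i" "take i L = take i us" using ius by (simp_all add: L_def nth_append)
      have nt: "L ! i \<notin> set (take i L)" using LS(1) less.prems(1) by (auto simp: in_set_conv_nth nth_eq_iff_index_eq)
      have "L ! i \<notin> P" using LS(2) nth_mem[OF less.prems(1)] by blast
      then have "spin x (L ! i) T = - c"
        using P[OF LB(2)[OF less.prems(1)]] spin_sign[OF g(1) LB(2)[OF less.prems(1)], of T] c by auto
      then have bi: "before z (\<tau> i) (L ! i) = - c" using b[OF LB(1)[OF less.prems(1)]] nt by simp
      have "w \<in> P \<union> set (take i us) \<longleftrightarrow> before z (\<tau> i) w = c" if "w \<in> neighbors (L ! i)" for w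
      proof -
        have "w \<in> B" "w \<in> slab" using that LB(3)[OF less.prems(1)] B(2) by blast+
        then show ?thesis using b[of w] P[of w] Li(2) by auto
      qed
      then have "{w \<in> neighbors (L ! i). before z (\<tau> i) w = c} = neighbors (L ! i) \<inter> (P \<union> set (take i us))"
        by blast
      then have "energy (before z (\<tau> i)) (L ! i) = 0"
        using energy_count[of _ _ "before z (\<tau> i)", OF LB(2)[OF less.prems(1)] c before_sign[OF gz] bi] d ties_nth[of S P us i] ius Li(1)
        unfolding descends_def by simp
      then show ?thesis
        using spin_rt[OF gz LB(2)[OF less.prems(1)], of "rings_upto x (L ! i) T"] ring_i[OF less.prems(1)]
        by (simp add: updated_spin_def)
    qed
    then show ?case using b[OF less.prems(2)] by blast
  qed
  define l where "l = length us"
  have l: "l < ?m" "L ! l = u" "take l L = us" by (simp_all add: l_def L_def)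
  have us: "u \<in> slab" "u \<in> B" "neighbors u \<subseteq> B" using LB[OF l(1)] l(2) by auto
  have up: "u \<notin> P" "u \<notin> set us" using d unfolding descends_def by auto
  have "spin x u T = - c" using P[OF us(1)] up spin_sign[OF g(1) us(1), of T] c by auto
  then have bu: "before z (\<tau> l) u = - c" using conf[OF l(1) us(2)] up l by simp
  have "w \<in> P \<union> set us \<longleftrightarrow> before z (\<tau> l) w = c" if "w \<in> neighbors u" for w
  proof -
    have "w \<in> B" "w \<in> slab" using that us B(2) by blast+
    then show ?thesis using conf[OF l(1), of w] P[of w] l(3) by auto
  qed
  then have "{w \<in> neighbors u. before z (\<tau> l) w = c} = neighbors u \<inter> (P \<union> set us)"
    by blast
  then have "energy (before z (\<tau> l)) u > 0"
    using energy_count[of _ _ "before z (\<tau> l)", OF us(1) c before_sign[OF gz] bu] d unfolding descends_def by simp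
  then have "lowers z u (rings_upto x u T)"
    using ring_i(1)[OF l(1)] l(2) unfolding lowers_def by simp
  moreover have "rt z u (rings_upto x u T) \<in> {T<..T + 1}"
    using ring_i(1)[OF l(1)] tau_gt[OF l(1)] tau_le[OF l(1)] l(2) by simp
  ultimately show ?thesis unfolding z_def by blast
qed

section \<open>Almost sure regularity of histories\<close>

lemma AE_pair_fst:
  assumes "prob_space M" "AE x in N. P x"
  shows "AE q in N \<Otimes>\<^sub>M M. P (fst q)"
proof -
  interpret prob_space M by fact
  have "AE x in distr (N \<Otimes>\<^sub>M M) N fst. P x" unfolding distr_pair_fst by fact
  then show ?thesis by (rule AE_distrD[OF measurable_fst])
qed

lemma AE_pair_snd:
  assumes "prob_space N" "prob_space M" "AE x in M. P x"
  shows "AE q in N \<Otimes>\<^sub>M M. P (snd q)"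
proof -
  interpret N: prob_space N by fact
  interpret M: prob_space M by fact
  have d: "distr (N \<Otimes>\<^sub>M M) M snd = M"
  proof (rule measure_eqI)
    fix A assume "A \<in> sets (distr (N \<Otimes>\<^sub>M M) M snd)"
    then have A: "A \<in> sets M" by simp
    have "snd -` A \<inter> space (N \<Otimes>\<^sub>M M) = space N \<times> A"
      using sets.sets_into_space[OF A] by (auto simp: space_pair_measure)
    then show "emeasure (distr (N \<Otimes>\<^sub>M M) M snd) A = emeasure M A"
      using A by (simp add: emeasure_distr M.emeasure_pair_measure_Times N.emeasure_space_1)
  qed simp
  have "AE x in distr (N \<Otimes>\<^sub>M M) M snd. P x" unfolding d by fact
  then show ?thesis by (rule AE_distrD[OF measurable_snd])
qed

lemma AE_history_site: "v \<in> slab \<Longrightarrow> AE a in site_measure p. P a \<Longrightarrow> AE x in history_measure p. P (x v)"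
  unfolding history_measure_def by (rule AE_PiM_component[OF prob_space_site])

lemma AE_site_clock: "AE \<xi> in clock_measure. P \<xi> \<Longrightarrow> AE a in site_measure p. P (snd a)"
  unfolding site_measure_def by (rule AE_pair_snd[OF measure_pmf.prob_space_axioms prob_space_clock])

lemma AE_clock_ring: "AE r in ring_measure. P r \<Longrightarrow> AE \<xi> in clock_measure. P (\<xi> n)"
  unfolding clock_measure_def by (rule AE_PiM_component[OF prob_space_ring]) auto

lemma AE_spin: "AE c in measure_pmf (spin_pmf p). c \<in> {1, -1}"
  by (auto simp: AE_measure_pmf_iff spin_pmf_def)

section \<open>Ring times of a single clock\<close>

definition ring_sum :: "(nat \<Rightarrow> real \<times> int) \<Rightarrow> nat \<Rightarrow> real" where
  "ring_sum \<xi> n = (\<Sum>k\<le>n. fst (\<xi> k))"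

lemma rt_ring_sum: "rt x v n = ring_sum (snd (x v)) n"
  by (simp add: rt_def ring_sum_def)

lemma measurable_ring_sum [measurable]: "(\<lambda>\<xi>. ring_sum \<xi> n) \<in> borel_measurable clock_measure"
proof -
  have [measurable]: "(\<lambda>\<xi>. \<xi> k) \<in> measurable clock_measure (borel \<Otimes>\<^sub>M count_space UNIV)" for k
    by (rule measurable_clock_nth) simp
  show ?thesis unfolding ring_sum_def by measurable
qed

lemma AE_positive: "AE r in ring_measure. 0 < fst r"
  unfolding ring_measure_def
proof (rule AE_pair_fst[OF measure_pmf.prob_space_axioms])
  have "AE x in lborel. x \<noteq> (0 :: real)" by (rule AE_lborel_singleton)
  then have "AE x in lborel. 0 < ennreal (exponential_density 1 x) \<longrightarrow> 0 < x"
    by eventually_elim (auto simp: exponential_density_def split: if_splits)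
  then show "AE x in density lborel (\<lambda>x. ennreal (exponential_density 1 x)). 0 < x"
    by (simp add: AE_density)
qed

lemma laplace: "(\<integral>\<^sup>+r. ennreal (exp (- fst r)) \<partial>ring_measure) = ennreal (1 / 2)"
proof -
  interpret E: prob_space "density lborel (\<lambda>x. ennreal (exponential_density 2 x))"
    by (rule prob_space_exponential_density) simp
  have "(\<integral>\<^sup>+r. ennreal (exp (- fst r)) \<partial>ring_measure) = (\<integral>\<^sup>+x. ennreal (exp (- x)) \<partial>density lborel (\<lambda>x. ennreal (exponential_density 1 x)))"
    unfolding ring_measure_def using measure_pmf.emeasure_space_1[of "spin_pmf (1/2)"]
    by (subst measure_pmf.nn_integral_fst[symmetric]) auto
  also have "\<dots> = (\<integral>\<^sup>+x. ennreal (exponential_density 1 x) * ennreal (exp (- x)) \<partial>lborel)"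
    by (subst nn_integral_density) auto
  also have "\<dots> = (\<integral>\<^sup>+x. ennreal (1 / 2) * ennreal (exponential_density 2 x) \<partial>lborel)"
  proof (rule nn_integral_cong)
    fix x :: real
    have "exponential_density 1 x * exp (- x) = 1 / 2 * exponential_density 2 x"
      by (simp add: exponential_density_def mult_exp_exp)
    then show "ennreal (exponential_density 1 x) * ennreal (exp (- x)) = ennreal (1 / 2) * ennreal (exponential_density 2 x)"
      using exponential_density_nonneg[of 1 x] exponential_density_nonneg[of 2 x]
      by (simp only: ennreal_mult[symmetric] zero_le_numeral exp_ge_zero zero_le_divide_1_iff)
  qed
  also have "\<dots> = ennreal (1 / 2) * (\<integral>\<^sup>+x. ennreal (exponential_density 2 x) \<partial>lborel)"
    by (rule nn_integral_cmult) measurable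
  also have "(\<integral>\<^sup>+x. ennreal (exponential_density 2 x) \<partial>lborel) = 1"
    using E.emeasure_space_1 by (simp add: emeasure_density)
  finally show ?thesis by simp
qed

text \<open>Exponential Markov inequality: by \<open>laplace\<close> and independence the ring time
  with index \<open>n\<close> is at most \<open>T\<close> with probability at most
  \<open>exp T * (1 / 2) ^ Suc n\<close>, and these bounds add up to \<open>exp T\<close>.\<close>

lemma expected_rings:
  "(\<integral>\<^sup>+\<xi>. (\<Sum>n. indicator {\<xi>. ring_sum \<xi> n \<le> T} \<xi>) \<partial>clock_measure) \<le> ennreal (exp T)"
proof -
  have b: "(\<integral>\<^sup>+\<xi>. indicator {\<xi>. ring_sum \<xi> n \<le> T} \<xi> \<partial>clock_measure) \<le> ennreal (exp T * (1 / 2) ^ Suc n)" for n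
  proof -
    have "(\<integral>\<^sup>+\<xi>. indicator {\<xi>. ring_sum \<xi> n \<le> T} \<xi> \<partial>clock_measure) \<le> (\<integral>\<^sup>+\<xi>. ennreal (exp T) * (\<Prod>k\<in>{..n}. ennreal (exp (- fst (\<xi> k)))) \<partial>clock_measure)"
    proof (rule nn_integral_mono)
      fix \<xi> :: "nat \<Rightarrow> real \<times> int"
      have "ennreal (exp T) * (\<Prod>k\<in>{..n}. ennreal (exp (- fst (\<xi> k)))) = ennreal (exp (T - ring_sum \<xi> n))"
        by (simp add: prod_ennreal ennreal_mult[symmetric] exp_sum[symmetric] mult_exp_exp ring_sum_def sum_negf)
      then show "indicator {\<xi>. ring_sum \<xi> n \<le> T} \<xi> \<le> ennreal (exp T) * (\<Prod>k\<in>{..n}. ennreal (exp (- fst (\<xi> k))))"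
        by (simp add: indicator_def)
    qed
    also have "\<dots> = ennreal (exp T) * (\<integral>\<^sup>+\<xi>. (\<Prod>k\<in>{..n}. ennreal (exp (- fst (\<xi> k)))) \<partial>clock_measure)"
    proof (rule nn_integral_cmult)
      have [measurable]: "(\<lambda>\<xi>. \<xi> k) \<in> measurable clock_measure (borel \<Otimes>\<^sub>M count_space UNIV)" for k
        by (rule measurable_clock_nth) simp
      show "(\<lambda>\<xi>. \<Prod>k\<in>{..n}. ennreal (exp (- fst (\<xi> k)))) \<in> borel_measurable clock_measure" by measurable
    qed
    also have "(\<integral>\<^sup>+\<xi>. (\<Prod>k\<in>{..n}. ennreal (exp (- fst (\<xi> k)))) \<partial>clock_measure) = (\<Prod>k\<in>{..n}. ennreal (1 / 2))"
      unfolding clock_measure_def laplace[symmetric] by (rule nn_integral_PiM_prod[OF prob_space_ring]) auto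
    also have "(\<Prod>k\<in>{..n}. ennreal (1 / 2)) = ennreal ((1 / 2) ^ Suc n)"
      by (subst prod_ennreal) auto
    also have "ennreal (exp T) * \<dots> = ennreal (exp T * (1 / 2) ^ Suc n)"
      by (rule ennreal_mult[symmetric]) simp_all
    finally show ?thesis .
  qed
  have "(\<integral>\<^sup>+\<xi>. (\<Sum>n. indicator {\<xi>. ring_sum \<xi> n \<le> T} \<xi>) \<partial>clock_measure) = (\<Sum>n. \<integral>\<^sup>+\<xi>. indicator {\<xi>. ring_sum \<xi> n \<le> T} \<xi> \<partial>clock_measure)"
  proof (rule nn_integral_suminf)
    fix n
    have "(\<lambda>\<xi>. indicator {..T} (ring_sum \<xi> n) :: ennreal) \<in> borel_measurable clock_measure" by measurable
    moreover have "(\<lambda>\<xi>. indicator {\<xi>. ring_sum \<xi> n \<le> T} \<xi> :: ennreal) = (\<lambda>\<xi>. indicator {..T} (ring_sum \<xi> n))"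
      by (auto simp: indicator_def)
    ultimately show "(\<lambda>\<xi>. indicator {\<xi>. ring_sum \<xi> n \<le> T} \<xi> :: ennreal) \<in> borel_measurable clock_measure" by simp
  qed
  also have "\<dots> \<le> (\<Sum>n. ennreal (exp T * (1 / 2) ^ Suc n))"
    by (intro suminf_le b) auto
  also have "\<dots> = ennreal (\<Sum>n. exp T * (1 / 2) ^ Suc n)"
    by (intro suminf_ennreal2) (auto intro!: summable_mult)
  also have "(\<Sum>n. exp T * (1 / 2) ^ Suc n) = exp T"
    using sums_mult[OF power_half_series, of "exp T"] by (simp add: sums_iff)
  finally show ?thesis .
qed

definition fine_clock :: "(nat \<Rightarrow> real \<times> int) \<Rightarrow> bool" where
  "fine_clock \<xi> \<longleftrightarrow> (\<forall>n. 0 < fst (\<xi> n)) \<and> (\<forall>n. snd (\<xi> n) \<in> {1, -1}) \<and> (\<forall>T. \<exists>n. T < ring_sum \<xi> n)"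

lemma AE_fine_clock: "AE \<xi> in clock_measure. fine_clock \<xi>"
proof -
  have 1: "AE \<xi> in clock_measure. \<forall>n. 0 < fst (\<xi> n)"
    unfolding AE_all_countable by (intro allI AE_clock_ring AE_positive)
  have "AE r in ring_measure. snd r \<in> {1, -1}"
    unfolding ring_measure_def by (rule AE_pair_snd[OF prob_space_exponential measure_pmf.prob_space_axioms AE_spin])
  then have 2: "AE \<xi> in clock_measure. \<forall>n. snd (\<xi> n) \<in> {1, -1}"
    unfolding AE_all_countable by (intro allI AE_clock_ring)
  \<comment> \<open>Ring times do not accumulate, since the expected number of rings before each
    integer time is finite.\<close>
  have 3: "AE \<xi> in clock_measure. \<forall>T::nat. \<exists>n. real T < ring_sum \<xi> n"
    unfolding AE_all_countable
  proof
    fix T :: nat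
    let ?f = "\<lambda>\<xi>. \<Sum>n. indicator {..real T} (ring_sum \<xi> n) :: ennreal"
    have "(\<integral>\<^sup>+\<xi>. ?f \<xi> \<partial>clock_measure) \<le> ennreal (exp T)"
      using expected_rings[of "real T"] by (simp add: indicator_def)
    then have "(\<integral>\<^sup>+\<xi>. ?f \<xi> \<partial>clock_measure) \<noteq> \<infinity>"
      using le_less_trans[OF _ ennreal_less_top] by fastforce
    then have "AE \<xi> in clock_measure. ?f \<xi> \<noteq> \<infinity>"
      by (intro nn_integral_noteq_infinite) measurable
    then show "AE \<xi> in clock_measure. \<exists>n. real T < ring_sum \<xi> n"
    proof eventually_elim
      case (elim \<xi>)
      show ?case
      proof (rule ccontr)
        assume "\<not> ?thesis"
        then have one: "indicator {..real T} (ring_sum \<xi> n) = (1 :: ennreal)" for n by (simp add: not_less)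
        obtain N :: nat where N: "?f \<xi> < of_nat N"
          using elim ennreal_Ex_less_of_nat[of "?f \<xi>"] by (auto simp: less_top)
        have "(\<Sum>n<N. indicator {..real T} (ring_sum \<xi> n) :: ennreal) \<le> ?f \<xi>"
          by (intro sum_le_suminf) auto
        moreover have "(\<Sum>n<N. indicator {..real T} (ring_sum \<xi> n) :: ennreal) = of_nat N"
          by (simp add: one)
        ultimately show False using N by (metis leD)
      qed
    qed
  qed
  from 1 2 3 show ?thesis
  proof eventually_elim
    case (elim \<xi>)
    have "\<exists>n. T < ring_sum \<xi> n" for T
      using elim(3) by (metis less_trans reals_Archimedean2)
    then show ?case using elim unfolding fine_clock_def by blast
  qed
qed

text \<open>With the other waiting times fixed, a single value of the first one would hit
  \<open>c\<close>, and its law has no atoms.\<close>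

lemma AE_ring_sum_neq: "AE \<xi> in clock_measure. ring_sum \<xi> n \<noteq> c"
proof -
  interpret R: prob_space ring_measure by (rule prob_space_ring)
  interpret C: prob_space clock_measure by (rule prob_space_clock)
  interpret RC: pair_sigma_finite ring_measure clock_measure ..
  have ac: "AE s in ring_measure. fst s \<noteq> b" for b
    unfolding ring_measure_def
  proof (rule AE_pair_fst[OF measure_pmf.prob_space_axioms])
    have "AE x in lborel. x \<noteq> b" by (rule AE_lborel_singleton)
    then show "AE x in density lborel (\<lambda>x. ennreal (exponential_density 1 x)). x \<noteq> b"
      by (subst AE_density) auto
  qed
  have m: "(\<lambda>\<xi>. indicator {c} (ring_sum \<xi> n) :: ennreal) \<in> borel_measurable clock_measure" by measurable
  have mc: "(\<lambda>q. indicator {c} (ring_sum (case_nat (fst q) (snd q)) n) :: ennreal) \<in> borel_measurable (ring_measure \<Otimes>\<^sub>M clock_measure)"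
    by (rule measurable_compose[OF measurable_case_nat_clock[OF m] m])
  have "(\<integral>\<^sup>+\<xi>. indicator {c} (ring_sum \<xi> n) \<partial>clock_measure)
    = (\<integral>\<^sup>+s. \<integral>\<^sup>+\<xi>. indicator {c} (ring_sum (case_nat s \<xi>) n) \<partial>clock_measure \<partial>ring_measure)"
    by (rule clock_head_tail(1)[OF m])
  also have "\<dots> = (\<integral>\<^sup>+\<xi>. \<integral>\<^sup>+s. indicator {c} (ring_sum (case_nat s \<xi>) n) \<partial>ring_measure \<partial>clock_measure)"
    using RC.Fubini[OF mc] by simp
  also have "\<dots> = (\<integral>\<^sup>+\<xi>. 0 \<partial>clock_measure)"
  proof (rule nn_integral_cong)
    fix \<xi> :: "nat \<Rightarrow> real \<times> int"
    have s: "ring_sum (case_nat s \<xi>) n = fst s + (\<Sum>k<n. fst (\<xi> k))" for s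
      unfolding ring_sum_def by (simp add: lessThan_Suc_atMost[symmetric] sum.lessThan_Suc_shift del: sum.lessThan_Suc)
    have "(\<integral>\<^sup>+s. indicator {c} (ring_sum (case_nat s \<xi>) n) \<partial>ring_measure) = (\<integral>\<^sup>+s. 0 \<partial>ring_measure)"
      using ac[of "c - (\<Sum>k<n. fst (\<xi> k))"] by (intro nn_integral_cong_AE) (auto simp: s elim!: eventually_mono)
    then show "(\<integral>\<^sup>+s. indicator {c} (ring_sum (case_nat s \<xi>) n) \<partial>ring_measure) = 0" by simp
  qed
  finally have "AE \<xi> in clock_measure. (indicator {c} (ring_sum \<xi> n) :: ennreal) = 0"
    using m by (simp add: nn_integral_0_iff_AE)
  then show ?thesis by eventually_elim (simp add: indicator_eq_0_iff)
qed

lemma measurable_site_clock: "snd \<in> measurable (site_measure p) clock_measure"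
  by (simp add: site_measure_def)

text \<open>When all vertices but \<open>v\<close> are fixed, the ring time at \<open>w\<close> is a
  constant, which the clock at \<open>v\<close> misses almost surely.\<close>

lemma AE_rt_distinct:
  assumes v: "v \<in> slab" and w: "w \<in> slab" and vw: "v \<noteq> w"
  shows "AE x in history_measure p. rt x v n \<noteq> rt x w m"
proof -
  let ?S = "site_measure p" and ?I = "slab - {v}"
  interpret S: prob_space ?S by (rule prob_space_site)
  interpret I: prob_space "PiM ?I (\<lambda>_. ?S)" by (intro prob_space_PiM prob_space_site)
  interpret P: pair_sigma_finite ?S "PiM ?I (\<lambda>_. ?S)" ..
  have ins: "insert v ?I = slab" using v by blast
  have d: "distr (?S \<Otimes>\<^sub>M PiM ?I (\<lambda>_. ?S)) (history_measure p) (\<lambda>(a, X). X(v := a)) = history_measure p"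
    using distr_pair_PiM_eq_PiM[of ?I "\<lambda>_. ?S" v] prob_space_site unfolding ins history_measure_def by simp
  have wI: "w \<in> ?I" using w vw by blast
  have mu: "(\<lambda>(a, X). X(v := a)) \<in> measurable (?S \<Otimes>\<^sub>M PiM ?I (\<lambda>_. ?S)) (history_measure p)"
  proof -
    have "(\<lambda>(f, y). f(v := y)) \<in> measurable (PiM ?I (\<lambda>_. ?S) \<Otimes>\<^sub>M ?S) (PiM (insert v ?I) (\<lambda>_. ?S))"
      by (rule measurable_add_dim)
    from measurable_compose[OF measurable_pair_swap' this] show ?thesis
      unfolding ins history_measure_def by (simp add: case_prod_unfold)
  qed
  have m1: "(\<lambda>q. ring_sum (snd (fst q)) n) \<in> borel_measurable (?S \<Otimes>\<^sub>M PiM ?I (\<lambda>_. ?S))"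
    by (intro measurable_compose[OF _ measurable_ring_sum] measurable_compose[OF _ measurable_site_clock[of p]] measurable_fst)
  have m2: "(\<lambda>q. ring_sum (snd (snd q w)) m) \<in> borel_measurable (?S \<Otimes>\<^sub>M PiM ?I (\<lambda>_. ?S))"
    by (intro measurable_compose[OF _ measurable_ring_sum] measurable_compose[OF _ measurable_site_clock[of p]]
      measurable_compose[OF measurable_snd measurable_component_singleton[OF wI]])
  have "AE q in ?S \<Otimes>\<^sub>M PiM ?I (\<lambda>_. ?S). ring_sum (snd (fst q)) n \<noteq> ring_sum (snd (snd q w)) m"
  proof -
    have S: "{q \<in> space (?S \<Otimes>\<^sub>M PiM ?I (\<lambda>_. ?S)). ring_sum (snd (fst q)) n \<noteq> ring_sum (snd (snd q w)) m} \<in> sets (?S \<Otimes>\<^sub>M PiM ?I (\<lambda>_. ?S))"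
      using m1 m2 by measurable
    have "AE X in PiM ?I (\<lambda>_. ?S). AE a in ?S. ring_sum (snd a) n \<noteq> ring_sum (snd (X w)) m"
      by (intro AE_I2 AE_site_clock AE_ring_sum_neq)
    then have "AE a in ?S. AE X in PiM ?I (\<lambda>_. ?S). ring_sum (snd a) n \<noteq> ring_sum (snd (X w)) m"
      by (subst P.AE_commute) (use S in auto)
    then show ?thesis using S by (intro P.AE_pair_measure) auto
  qed
  then have "AE q in ?S \<Otimes>\<^sub>M PiM ?I (\<lambda>_. ?S). rt ((\<lambda>(a, X). X(v := a)) q) v n \<noteq> rt ((\<lambda>(a, X). X(v := a)) q) w m"
    by eventually_elim (use vw in \<open>auto simp: rt_ring_sum case_prod_unfold\<close>)
  then have "AE x in distr (?S \<Otimes>\<^sub>M PiM ?I (\<lambda>_. ?S)) (history_measure p) (\<lambda>(a, X). X(v := a)). rt x v n \<noteq> rt x w m"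
  proof (subst AE_distr_iff[OF mu])
    have [measurable]: "(\<lambda>x. rt x u k) \<in> borel_measurable (history_measure p)" if "u \<in> slab" for u k
      unfolding rt_ring_sum history_measure_def
      by (intro measurable_compose[OF _ measurable_ring_sum] measurable_compose[OF _ measurable_site_clock[of p]] measurable_component_singleton that)
    show "{x \<in> space (history_measure p). rt x v n \<noteq> rt x w m} \<in> sets (history_measure p)"
      using v w by (intro borel_measurable_neq) auto
  qed
  then show ?thesis unfolding d .
qed

text \<open>Restarting the clock at \<open>a\<close> does not change its law, and a ring of the
  restarted clock in the window needs a fresh waiting time of at most \<delta>. The exponential
  density is at most 1.\<close>

lemma prob_window:
  assumes a: "0 \<le> a" and \<delta>: "0 \<le> \<delta>"
  shows "emeasure clock_measure {\<xi> \<in> space clock_measure. \<exists>n. ring_sum \<xi> n \<in> {a<..a + \<delta>}} \<le> ennreal \<delta>"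
proof -
  let ?C = clock_measure
  interpret C: prob_space ?C by (rule prob_space_clock)
  interpret R: prob_space ring_measure by (rule prob_space_ring)
  interpret CC: pair_prob_space ?C ?C ..
  let ?W = "{\<xi> \<in> space ?C. \<exists>n. ring_sum \<xi> n \<in> {a<..a + \<delta>}}"
  have W[measurable]: "?W \<in> sets ?C" by measurable
  have Rd: "{r \<in> space ring_measure. fst r \<le> \<delta>} \<in> sets ring_measure" by measurable
  have m: "(\<lambda>q. splice_at a (fst q) (snd q)) \<in> measurable (?C \<Otimes>\<^sub>M ?C) ?C"
    by (intro measurable_splice_at) auto
  have [measurable]: "(\<lambda>\<xi>. \<xi> k) \<in> measurable ?C (borel \<Otimes>\<^sub>M count_space UNIV)" for k
    by (rule measurable_clock_nth) simp
  have "emeasure ?C ?W = emeasure (distr (?C \<Otimes>\<^sub>M ?C) ?C (\<lambda>q. splice_at a (fst q) (snd q))) ?W"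
    unfolding distr_splice_at[OF a] ..
  also have "\<dots> = emeasure (?C \<Otimes>\<^sub>M ?C) ((\<lambda>q. splice_at a (fst q) (snd q)) -` ?W \<inter> space (?C \<Otimes>\<^sub>M ?C))"
    by (rule emeasure_distr[OF m W])
  also have "\<dots> \<le> emeasure (?C \<Otimes>\<^sub>M ?C) {q \<in> space (?C \<Otimes>\<^sub>M ?C). fst (snd q 0) \<le> \<delta>}"
  proof (rule emeasure_mono_AE)
    have "AE q in ?C \<Otimes>\<^sub>M ?C. fine_clock (fst q)" "AE q in ?C \<Otimes>\<^sub>M ?C. fine_clock (snd q)"
      by (rule AE_pair_fst[OF prob_space_clock AE_fine_clock], rule AE_pair_snd[OF prob_space_clock prob_space_clock AE_fine_clock])
    then show "AE q in ?C \<Otimes>\<^sub>M ?C. q \<in> (\<lambda>q. splice_at a (fst q) (snd q)) -` ?W \<inter> space (?C \<Otimes>\<^sub>M ?C) \<longrightarrow>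
      q \<in> {q \<in> space (?C \<Otimes>\<^sub>M ?C). fst (snd q 0) \<le> \<delta>}"
    proof eventually_elim
      case (elim q)
      show ?case
      proof
        assume q: "q \<in> (\<lambda>q. splice_at a (fst q) (snd q)) -` ?W \<inter> space (?C \<Otimes>\<^sub>M ?C)"
        define \<xi> \<zeta> where "\<xi> = fst q" and "\<zeta> = snd q"
        obtain n where n: "a < ring_sum (splice_at a \<xi> \<zeta>) n" "ring_sum (splice_at a \<xi> \<zeta>) n \<le> a + \<delta>"
          using q unfolding \<xi>_def \<zeta>_def by auto
        define K where "K = (LEAST n. a < ring_sum \<xi> n)"
        obtain k0 where "a < ring_sum \<xi> k0" using elim(1) unfolding fine_clock_def \<xi>_def by blast
        then have K: "a < ring_sum \<xi> K" unfolding K_def by (rule LeastI)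
        have lt: "ring_sum \<xi> j \<le> a" if "j < K" for j using not_less_Least[of j] that unfolding K_def by (metis not_le)
        have "K \<le> n"
        proof (rule ccontr)
          assume nK: "\<not> K \<le> n"
          have "ring_sum (splice_at a \<xi> \<zeta>) n = ring_sum \<xi> n"
            unfolding ring_sum_def splice_at_def
          proof (intro sum.cong refl arg_cong[where f = fst] restart_before)
            fix k j assume "k \<in> {..n}" "j \<le> k"
            then show "(\<Sum>i\<le>j. fst (\<xi> i)) \<le> a" using lt[of j] nK unfolding ring_sum_def by simp
          qed
          then show False using n(1) lt[of n] nK by simp
        qed
        then have "ring_sum (splice_at a \<xi> \<zeta>) n = a + ring_sum \<zeta> (n - K)"
          using restart_after[where K = K and \<xi> = \<xi> and T = a and j = "n - K" and \<zeta> = \<zeta>] lt K unfolding ring_sum_def splice_at_def by simp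
        then have "ring_sum \<zeta> (n - K) \<le> \<delta>" using n by simp
        moreover have "fst (\<zeta> 0) \<le> ring_sum \<zeta> (n - K)"
          unfolding ring_sum_def using elim(2) unfolding fine_clock_def \<zeta>_def
          by (intro member_le_sum) (auto intro: less_imp_le)
        ultimately show "q \<in> {q \<in> space (?C \<Otimes>\<^sub>M ?C). fst (snd q 0) \<le> \<delta>}" using q by (simp add: \<zeta>_def)
      qed
    qed
  qed measurable
  also have "{q \<in> space (?C \<Otimes>\<^sub>M ?C). fst (snd q 0) \<le> \<delta>} = space ?C \<times> {\<zeta> \<in> space ?C. fst (\<zeta> 0) \<le> \<delta>}"
    by (auto simp: space_pair_measure)
  also have "emeasure (?C \<Otimes>\<^sub>M ?C) \<dots> = emeasure ?C {\<zeta> \<in> space ?C. fst (\<zeta> 0) \<le> \<delta>}"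
    by (subst C.emeasure_pair_measure_Times) (auto simp: C.emeasure_space_1)
  also have "\<dots> = emeasure ring_measure {r \<in> space ring_measure. fst r \<le> \<delta>}"
  proof -
    have sp: "r \<in> space ring_measure" for r
      using sets_eq_imp_space_eq[OF sets_ring] by (simp add: space_pair_measure)
    show ?thesis
      using emeasure_PiM_box[OF prob_space_ring, of "{0}" UNIV "\<lambda>_. {r \<in> space ring_measure. fst r \<le> \<delta>}"] Rd sp
      unfolding clock_measure_def by simp
  qed
  also have "\<dots> \<le> ennreal \<delta>"
  proof -
    have "emeasure ring_measure {r \<in> space ring_measure. fst r \<le> \<delta>} = (\<integral>\<^sup>+s. indicator {..\<delta>} (fst s) \<partial>ring_measure)"
      unfolding nn_integral_indicator[OF Rd, symmetric] by (intro nn_integral_cong) (auto simp: indicator_def)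
    also have "\<dots> = (\<integral>\<^sup>+x. \<integral>\<^sup>+y. indicator {..\<delta>} x \<partial>measure_pmf (spin_pmf (1/2)) \<partial>density lborel (\<lambda>x. ennreal (exponential_density 1 x)))"
    proof -
      have "(\<lambda>q. indicator {..\<delta>} (fst q) :: ennreal) \<in> borel_measurable (density lborel (\<lambda>x. ennreal (exponential_density 1 x)) \<Otimes>\<^sub>M measure_pmf (spin_pmf (1/2)))"
        by (rule measurable_compose[OF measurable_fst]) simp
      from measure_pmf.nn_integral_fst[OF this] show ?thesis unfolding ring_measure_def by simp
    qed
    also have "\<dots> = emeasure (density lborel (\<lambda>x. ennreal (exponential_density 1 x))) {..\<delta>}"
      using measure_pmf.emeasure_space_1[of "spin_pmf (1/2)"] by simp
    also have "\<dots> = (\<integral>\<^sup>+x. ennreal (exponential_density 1 x) * indicator {..\<delta>} x \<partial>lborel)"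
      by (rule emeasure_density) auto
    also have "\<dots> \<le> (\<integral>\<^sup>+x. indicator {0..\<delta>} x \<partial>lborel)"
      by (intro nn_integral_mono) (auto simp: exponential_density_def split: split_indicator)
    also have "\<dots> = ennreal \<delta>" using \<delta> by simp
    finally show ?thesis .
  qed
  finally show ?thesis .
qed

lemma AE_history_basic:
  "AE x in history_measure p. (\<forall>v\<in>slab. fine_clock (snd (x v)) \<and> spin0 x v \<in> {1, -1})
    \<and> (\<forall>v\<in>slab. \<forall>w\<in>slab. \<forall>n m. v \<noteq> w \<longrightarrow> rt x v n \<noteq> rt x w m)"
proof -
  have 1: "AE x in history_measure p. fine_clock (snd (x v)) \<and> spin0 x v \<in> {1, -1}" if "v \<in> slab" for v
  proof -
    have "AE a in site_measure p. fine_clock (snd a)" by (rule AE_site_clock[OF AE_fine_clock])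
    moreover have "AE a in site_measure p. fst a \<in> {1, -1}"
      unfolding site_measure_def by (rule AE_pair_fst[OF prob_space_clock AE_spin])
    ultimately have "AE a in site_measure p. fine_clock (snd a) \<and> fst a \<in> {1, -1}" by eventually_elim blast
    from AE_history_site[OF that this] show ?thesis unfolding spin0_def .
  qed
  have c: "countable slab" by simp
  have "AE x in history_measure p. \<forall>v\<in>slab. fine_clock (snd (x v)) \<and> spin0 x v \<in> {1, -1}"
    unfolding AE_ball_countable[OF c] using 1 by blast
  moreover have "AE x in history_measure p. \<forall>v\<in>slab. \<forall>w\<in>slab. \<forall>n m. v \<noteq> w \<longrightarrow> rt x v n \<noteq> rt x w m"
    unfolding AE_ball_countable[OF c] AE_all_countable using AE_rt_distinct by fastforce
  ultimately show ?thesis by eventually_elim blast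
qed

section \<open>Finite clusters of ringing sites and well-founded dependencies\<close>

definition rings_in :: "history \<Rightarrow> real set \<Rightarrow> vertex \<Rightarrow> bool" where
  "rings_in x A v \<longleftrightarrow> (\<exists>n. rt x v n \<in> A)"

primrec paths :: "nat \<Rightarrow> vertex \<Rightarrow> vertex list set" where
  "paths 0 v = {[v]}"
| "paths (Suc n) v = (\<Union>w\<in>neighbors v. (#) v ` paths n w)"

lemma paths_props:
  "v \<in> slab \<Longrightarrow> finite (paths n v) \<and> card (paths n v) \<le> 6 ^ n \<and> (\<forall>L\<in>paths n v. set L \<subseteq> slab \<and> length L = Suc n)"
proof (induction n arbitrary: v)
  case (Suc n)
  have w: "w \<in> slab" if "w \<in> neighbors v" for w using neighbors_slab[OF that] .
  have IH: "finite (paths n w)" "card (paths n w) \<le> 6 ^ n" "\<forall>L\<in>paths n w. set L \<subseteq> slab \<and> length L = Suc n"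
    if "w \<in> neighbors v" for w using Suc.IH[OF w[OF that]] by blast+
  have "card (paths (Suc n) v) \<le> (\<Sum>w\<in>neighbors v. card ((#) v ` paths n w))"
    unfolding paths.simps by (rule card_UN_le[OF finite_neighbors[OF Suc.prems]])
  also have "\<dots> \<le> (\<Sum>w\<in>neighbors v. 6 ^ n)"
    using IH by (intro sum_mono) (simp add: card_image)
  finally have "card (paths (Suc n) v) \<le> 6 ^ Suc n" using card_neighbors[OF Suc.prems] by simp
  then show ?case using IH Suc.prems finite_neighbors[OF Suc.prems] by auto
qed simp

lemma paths_take: "L \<in> paths n v \<Longrightarrow> m \<le> n \<Longrightarrow> take (Suc m) L \<in> paths m v"
proof (induction n arbitrary: m v L)
  case (Suc n)
  obtain w L' where L: "w \<in> neighbors v" "L' \<in> paths n w" "L = v # L'" using Suc.prems by auto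
  show ?case
  proof (cases m)
    case (Suc k)
    then have "take (Suc k) L' \<in> paths k w" using Suc.IH[OF L(2)] Suc.prems(2) by simp
    then show ?thesis using L Suc by auto
  qed (simp add: L)
qed simp

lemma rtrancl_path_paths:
  "rtrancl_path (\<lambda>u w. w \<in> neighbors u \<and> R w) v xs y \<Longrightarrow> v # xs \<in> paths (length xs) v \<and> (\<forall>w\<in>set xs. R w) \<and> y \<in> set (v # xs)"
  by (induction rule: rtrancl_path.induct) auto

text \<open>There are at most \<open>6 ^ n\<close> paths of \<open>n\<close> steps, and each site
  rings in the window with probability at most 1/12, so a self-avoiding path of \<open>n\<close>
  ringing steps exists with probability at most \<open>(1 / 2) ^ n\<close>. Any window shorter than
  1/6 would do.\<close>

lemma AE_finite_clusters:
  assumes a: "0 \<le> a" and v: "v \<in> slab"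
  shows "AE x in history_measure p. finite {w. (\<lambda>u w. w \<in> neighbors u \<and> rings_in x {a<..a + 1 / 12} w)\<^sup>*\<^sup>* v w}"
proof -
  let ?H = "history_measure p" and ?A = "{a<..a + 1 / 12}"
  interpret H: prob_space ?H by (rule prob_space_history)
  define q where "q = emeasure clock_measure {\<xi> \<in> space clock_measure. \<exists>n. ring_sum \<xi> n \<in> ?A}"
  have q: "q \<le> ennreal (1 / 12)" unfolding q_def by (rule prob_window[OF a]) simp
  define F where "F = {b \<in> space (site_measure p). \<exists>n. ring_sum (snd b) n \<in> ?A}"
  have W: "{\<xi> \<in> space clock_measure. \<exists>n. ring_sum \<xi> n \<in> ?A} \<in> sets clock_measure" by measurable
  have Feq: "F = snd -` {\<xi> \<in> space clock_measure. \<exists>n. ring_sum \<xi> n \<in> ?A} \<inter> space (site_measure p)"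
    unfolding F_def using measurable_space[OF measurable_site_clock[of p]] by auto
  then have FS: "F \<in> sets (site_measure p)"
    using measurable_sets[OF measurable_site_clock[of p] W] by simp
  have FE: "emeasure (site_measure p) F = q"
  proof -
    interpret C: prob_space clock_measure by (rule prob_space_clock)
    have "F = space (measure_pmf (spin_pmf p)) \<times> {\<xi> \<in> space clock_measure. \<exists>n. ring_sum \<xi> n \<in> ?A}"
      unfolding F_def site_measure_def by (auto simp: space_pair_measure)
    then show ?thesis unfolding site_measure_def q_def
      using W measure_pmf.emeasure_space_1[of "spin_pmf p"] by (simp add: C.emeasure_pair_measure_Times)
  qed
  \<comment> \<open>The start of a path need not ring, hence \<open>tl\<close>; this leaves exactly
    \<open>n\<close> distinct, independent sites.\<close>
  define E where "E n = (\<Union>L\<in>{L \<in> paths n v. distinct L}. {x \<in> space ?H. \<forall>u\<in>set (tl L). x u \<in> F})" for n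
  have fin: "finite {L \<in> paths n v. distinct L}" for n using paths_props[OF v, of n] by simp
  have box: "{x \<in> space ?H. \<forall>u\<in>set (tl L). x u \<in> F} \<in> sets ?H" "emeasure ?H {x \<in> space ?H. \<forall>u\<in>set (tl L). x u \<in> F} \<le> ennreal ((1 / 12) ^ n)"
    if L: "L \<in> {L \<in> paths n v. distinct L}" for L n
  proof -
    have "set L \<subseteq> slab" using paths_props[OF v, of n] L by blast
    then have sub: "set (tl L) \<subseteq> slab" by (cases L) auto
    show "{x \<in> space ?H. \<forall>u\<in>set (tl L). x u \<in> F} \<in> sets ?H"
      unfolding history_measure_def by (rule sets_PiM_box[OF sub _ FS]) simp
    have card: "card (set (tl L)) = n"
      using paths_props[OF v, of n] L by (auto simp: distinct_card distinct_tl)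
    have "emeasure ?H {x \<in> space ?H. \<forall>u\<in>set (tl L). x u \<in> F} = (\<Prod>u\<in>set (tl L). emeasure (site_measure p) F)"
      unfolding history_measure_def by (rule emeasure_PiM_box[OF prob_space_site sub _ FS]) simp
    also have "\<dots> = q ^ n" unfolding FE by (simp add: card)
    also have "\<dots> \<le> ennreal (1 / 12) ^ n" by (intro power_mono q) auto
    also have "\<dots> = ennreal ((1 / 12) ^ n)" by (rule ennreal_power) simp
    finally show "emeasure ?H {x \<in> space ?H. \<forall>u\<in>set (tl L). x u \<in> F} \<le> ennreal ((1 / 12) ^ n)" .
  qed
  have ES: "E n \<in> sets ?H" for n unfolding E_def by (intro sets.finite_UN fin box(1))
  have EE: "emeasure ?H (E n) \<le> ennreal ((1 / 2) ^ n)" for n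
  proof -
    have "emeasure ?H (E n) \<le> (\<Sum>L\<in>{L \<in> paths n v. distinct L}. emeasure ?H {x \<in> space ?H. \<forall>u\<in>set (tl L). x u \<in> F})"
      unfolding E_def by (intro emeasure_subadditive_finite fin) (use box(1) in auto)
    also have "\<dots> \<le> (\<Sum>L\<in>{L \<in> paths n v. distinct L}. ennreal ((1 / 12) ^ n))"
      by (intro sum_mono box(2))
    also have "\<dots> = ennreal (card {L \<in> paths n v. distinct L} * (1 / 12) ^ n)"
      by (simp add: ennreal_of_nat_eq_real_of_nat ennreal_mult)
    also have "\<dots> \<le> ennreal ((1 / 2) ^ n)"
    proof (rule ennreal_leI)
      have "card {L \<in> paths n v. distinct L} \<le> card (paths n v)"
        using paths_props[OF v, of n] by (intro card_mono) auto
      then have "real (card {L \<in> paths n v. distinct L}) \<le> 6 ^ n"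
        using paths_props[OF v, of n] of_nat_mono[of "card {L \<in> paths n v. distinct L}" "6 ^ n"] by simp
      then have "card {L \<in> paths n v. distinct L} * (1 / 12) ^ n \<le> 6 ^ n * (1 / 12 :: real) ^ n"
        by (intro mult_right_mono) auto
      also have "\<dots> = (1 / 2) ^ n" by (simp add: power_mult_distrib[symmetric])
      finally show "card {L \<in> paths n v. distinct L} * (1 / 12) ^ n \<le> (1 / 2 :: real) ^ n" .
    qed
    finally show ?thesis .
  qed
  have "emeasure ?H (\<Inter>n. E n) = 0"
  proof -
    have "emeasure ?H (\<Inter>n. E n) \<le> ennreal ((1 / 2) ^ n)" for n
      using EE[of n] emeasure_mono[of "\<Inter>n. E n" "E n" ?H] ES by (meson INF_lower UNIV_I order_trans)
    moreover have "(\<lambda>n. ennreal ((1 / 2) ^ n)) \<longlonglongrightarrow> ennreal 0"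
      by (intro tendsto_ennrealI LIMSEQ_realpow_zero) auto
    ultimately have "emeasure ?H (\<Inter>n. E n) \<le> ennreal 0" by (intro LIMSEQ_le_const) auto
    then show ?thesis by simp
  qed
  then have "(\<Inter>n. E n) \<in> null_sets ?H" using ES by auto
  from AE_not_in[OF this] AE_space show ?thesis
  proof eventually_elim
    case (elim x)
    then obtain n where n: "x \<notin> E n" by blast
    let ?R = "rings_in x ?A"
    have "{w. (\<lambda>u w. w \<in> neighbors u \<and> ?R w)\<^sup>*\<^sup>* v w} \<subseteq> (\<Union>m<n. \<Union>L\<in>paths m v. set L)"
    proof
      fix w assume "w \<in> {w. (\<lambda>u w. w \<in> neighbors u \<and> ?R w)\<^sup>*\<^sup>* v w}"
      then obtain ys where "rtrancl_path (\<lambda>u w. w \<in> neighbors u \<and> ?R w) v ys w"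
        by (auto simp: rtranclp_eq_rtrancl_path)
      then obtain xs where xs: "rtrancl_path (\<lambda>u w. w \<in> neighbors u \<and> ?R w) v xs w" "distinct (v # xs)"
        by (rule rtrancl_path_distinct)
      note P = rtrancl_path_paths[OF xs(1)]
      have "length xs < n"
      proof (rule ccontr)
        assume "\<not> length xs < n"
        then have t: "take (Suc n) (v # xs) \<in> paths n v" using P by (intro paths_take) auto
        have d: "distinct (take (Suc n) (v # xs))" using xs(2) by (rule distinct_take)
        have "x u \<in> F" if "u \<in> set (tl (take (Suc n) (v # xs)))" for u
        proof -
          have ux: "u \<in> set xs" using that by (auto dest: in_set_takeD)
          then have "?R u" using P by blast
          moreover have "set (v # xs) \<subseteq> slab" using P paths_props[OF v, of "length xs"] by blast
          then have "x u \<in> space (site_measure p)" using elim(2) ux unfolding history_measure_def space_PiM by (auto simp: PiE_iff simp del: split_paired_All)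
          ultimately show ?thesis unfolding F_def rings_in_def rt_ring_sum by simp
        qed
        then have "x \<in> E n" unfolding E_def using t d elim(2) by blast
        then show False using n by blast
      qed
      then show "w \<in> (\<Union>m<n. \<Union>L\<in>paths m v. set L)" using P by blast
    qed
    moreover have "finite (\<Union>m<n. \<Union>L\<in>paths m v. set L)" using paths_props[OF v] by blast
    ultimately show ?case by (rule finite_subset)
  qed
qed

text \<open>Ring times decrease along an infinite backward chain, so it ends up in a single window
  of length 1/12. From then on it stays within one finite cluster, whose sites have only finitely
  many rings before the chain's current time.\<close>

lemma wf_precedesI:
  assumes fine: "\<And>v. v \<in> slab \<Longrightarrow> fine_clock (snd (x v))"
    and fin: "\<And>v k. v \<in> slab \<Longrightarrow> finite {w. (\<lambda>u w. w \<in> neighbors u \<and> rings_in x {real k * (1 / 12)<..real k * (1 / 12) + 1 / 12} w)\<^sup>*\<^sup>* v w}"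
  shows "wf (precedes x)"
  unfolding wf_iff_no_infinite_down_chain
proof
  assume "\<exists>f. \<forall>i. (f (Suc i), f i) \<in> precedes x"
  then obtain f where f: "\<And>i. (f (Suc i), f i) \<in> precedes x" by blast
  define s t where "s i = fst (f i)" and "t i = rt x (fst (f i)) (snd (f i))" for i
  have st: "s i \<in> slab" "s (Suc i) \<in> insert (s i) (neighbors (s i))" "t (Suc i) < t i" for i
    using f[of i] unfolding precedes_def s_def t_def by auto
  have tpos: "0 < t i" for i
    unfolding t_def rt_def using fine[OF st(1)[of i]] unfolding fine_clock_def s_def by (intro sum_pos) auto
  \<comment> \<open>The windows are open on the left, hence ceiling minus one instead of
    floor.\<close>
  define k where "k i = nat (\<lceil>t i * 12\<rceil> - 1)" for i
  have kt: "t i \<in> {real (k i) * (1 / 12)<..real (k i) * (1 / 12) + 1 / 12}" for i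
  proof -
    have "0 < \<lceil>t i * 12\<rceil>" using tpos[of i] by simp
    then have "real (k i) = of_int \<lceil>t i * 12\<rceil> - 1" unfolding k_def by simp
    moreover have "of_int \<lceil>t i * 12\<rceil> - 1 < t i * 12" "t i * 12 \<le> of_int \<lceil>t i * 12\<rceil>"
      using ceiling_correct[of "t i * 12"] by simp_all
    ultimately show ?thesis by (auto simp: field_simps)
  qed
  have kdec: "k j \<le> k i" if "i \<le> j" for i j
  proof -
    have "t j \<le> t i" using that by (rule lift_Suc_antimono_le[rotated]) (simp add: st(3) less_imp_le)
    then have "\<lceil>t j * 12\<rceil> \<le> \<lceil>t i * 12\<rceil>" by (intro ceiling_mono) simp
    then show ?thesis unfolding k_def by simp
  qed
  obtain i0 where i0: "\<And>j. k i0 \<le> k j" using ex_has_least_nat[of "\<lambda>_. True" 0 k] by blast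
  define A where "A = {real (k i0) * (1 / 12)<..real (k i0) * (1 / 12) + 1 / 12}"
  have tA: "t i \<in> A" if "i0 \<le> i" for i
    using kt[of i] kdec[OF that] i0[of i] unfolding A_def by simp
  let ?E = "\<lambda>u w. w \<in> neighbors u \<and> rings_in x A w"
  have reach: "?E\<^sup>*\<^sup>* (s i0) (s (i0 + j))" for j
  proof (induction j)
    case (Suc j)
    have "rings_in x A (s (i0 + Suc j))"
      unfolding rings_in_def s_def using tA[of "i0 + Suc j"] unfolding t_def by auto
    then have "s (i0 + Suc j) = s (i0 + j) \<or> ?E (s (i0 + j)) (s (i0 + Suc j))"
      using st(2)[of "i0 + j"] by auto
    then show ?case using Suc by (auto intro: rtranclp.rtrancl_into_rtrancl)
  qed simp
  define Rch where "Rch = {w. ?E\<^sup>*\<^sup>* (s i0) w}"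
  have "finite Rch" unfolding Rch_def A_def by (rule fin[OF st(1)])
  moreover have "finite {n. rt x w n \<le> t i0}" if w: "w \<in> slab" for w
  proof -
    obtain n where n: "t i0 < rt x w n" using fine[OF w] unfolding fine_clock_def rt_ring_sum by blast
    have "m < n" if "rt x w m \<le> t i0" for m
    proof (rule ccontr)
      assume "\<not> m < n"
      then have "rt x w n \<le> rt x w m"
        unfolding rt_def using fine[OF w] unfolding fine_clock_def
        by (intro sum_mono2) (auto intro: less_imp_le)
      then show False using n that by simp
    qed
    then have "{m. rt x w m \<le> t i0} \<subseteq> {..<n}" by blast
    then show ?thesis by (rule finite_subset) simp
  qed
  ultimately have fS: "finite (Sigma (Rch \<inter> slab) (\<lambda>w. {n. rt x w n \<le> t i0}))"
    by (intro finite_SigmaI) auto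
  have ta: "t (i0 + j) \<le> t i0" for j
    by (rule lift_Suc_antimono_le[of t]) (simp_all add: st(3) less_imp_le)
  have "f (i0 + j) \<in> Sigma (Rch \<inter> slab) (\<lambda>w. {n. rt x w n \<le> t i0})" for j
    using reach[of j] st(1)[of "i0 + j"] ta[of j] unfolding Rch_def s_def t_def
    by (cases "f (i0 + j)") auto
  moreover have "inj (\<lambda>j. f (i0 + j))"
  proof (rule injI)
    fix a b assume "f (i0 + a) = f (i0 + b)"
    then have "t (i0 + a) = t (i0 + b)" by (simp add: t_def)
    moreover have "t (i0 + b) < t (i0 + a)" if "a < b" for a b
      using lift_Suc_mono_less[of "\<lambda>i. - t i" "i0 + a" "i0 + b"] st(3) that by simp
    ultimately show "a = b" by (metis linorder_neqE_nat less_irrefl)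
  qed
  ultimately have "finite (UNIV :: nat set)"
    using fS by (meson finite_imageD finite_subset image_subsetI)
  then show False by simp
qed

theorem AE_good: "AE x in history_measure p. good x"
proof -
  have "AE x in history_measure p. \<forall>v\<in>slab. \<forall>k :: nat.
    finite {w. (\<lambda>u w. w \<in> neighbors u \<and> rings_in x {real k * (1 / 12)<..real k * (1 / 12) + 1 / 12} w)\<^sup>*\<^sup>* v w}"
    unfolding AE_ball_countable[OF countableI_type[of slab]] AE_all_countable by (intro ballI allI AE_finite_clusters) auto
  with AE_history_basic[of p] show ?thesis
  proof eventually_elim
    case (elim x)
    have fine: "\<And>v. v \<in> slab \<Longrightarrow> fine_clock (snd (x v))" and init: "\<And>v. v \<in> slab \<Longrightarrow> spin0 x v \<in> {1, -1}"
      and dist: "\<forall>v\<in>slab. \<forall>w\<in>slab. \<forall>n m. v \<noteq> w \<longrightarrow> rt x v n \<noteq> rt x w m"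
      using elim(1) by blast+
    have "wf (precedes x)" by (rule wf_precedesI[OF fine elim(2)[rule_format]])
    moreover have "(\<forall>n. 0 < fst (snd (x v) n)) \<and> (\<forall>T. \<exists>n. T < rt x v n) \<and> spin0 x v \<in> {1, -1} \<and> (\<forall>n. toss x v n \<in> {1, -1})"
      if "v \<in> slab" for v
      using fine[OF that] init[OF that] unfolding fine_clock_def toss_def rt_ring_sum by blast
    ultimately show ?case using dist unfolding good_def by blast
  qed
qed

section \<open>Expected number of energy-lowering rings\<close>

lemma measurable_updated_spin:
  assumes v: "v \<in> slab" and A: "\<And>w. w \<in> insert v (neighbors v) \<Longrightarrow> A w \<in> measurable M (count_space UNIV)"
    and c: "c \<in> measurable M (count_space UNIV)"
  shows "(\<lambda>q. updated_spin (\<lambda>w. A w q) v (c q)) \<in> measurable M (count_space UNIV)"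
proof -
  have A': "(\<lambda>q. real_of_int (A w q)) \<in> borel_measurable M" if "w \<in> insert v (neighbors v)" for w
    by (rule measurable_compose[OF A[OF that]]) simp
  have e: "(\<lambda>q. real_of_int (energy (\<lambda>w. A w q) v)) \<in> borel_measurable M"
    unfolding energy_def of_int_minus of_int_sum of_int_mult
    by (intro borel_measurable_uminus borel_measurable_sum borel_measurable_times A') auto
  have p: "Measurable.pred M (\<lambda>q. 0 < energy (\<lambda>w. A w q) v)" "Measurable.pred M (\<lambda>q. energy (\<lambda>w. A w q) v = 0)"
  proof -
    have "Measurable.pred M (\<lambda>q. 0 < real_of_int (energy (\<lambda>w. A w q) v))" using e by measurable
    then show "Measurable.pred M (\<lambda>q. 0 < energy (\<lambda>w. A w q) v)" by simp
    have "Measurable.pred M (\<lambda>q. real_of_int (energy (\<lambda>w. A w q) v) = 0)" using e by measurable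
    then show "Measurable.pred M (\<lambda>q. energy (\<lambda>w. A w q) v = 0)" by simp
  qed
  have av: "A v \<in> measurable M (count_space UNIV)" by (rule A) simp
  have "(\<lambda>q. - A v q) \<in> measurable M (count_space UNIV)"
    by (rule measurable_compose[OF av]) simp
  then show ?thesis unfolding updated_spin_def using p c av by measurable
qed

lemma measurable_site_value: "v \<in> slab \<Longrightarrow> (\<lambda>x. x v) \<in> measurable (history_measure p) (site_measure p)"
  unfolding history_measure_def by (rule measurable_component_singleton)

lemma measurable_rt: "v \<in> slab \<Longrightarrow> (\<lambda>x. rt x v n) \<in> borel_measurable (history_measure p)"
  unfolding rt_ring_sum
  by (rule measurable_compose[OF measurable_compose[OF measurable_site_value measurable_site_clock] measurable_ring_sum])

lemma measurable_toss: "v \<in> slab \<Longrightarrow> (\<lambda>x. toss x v n) \<in> measurable (history_measure p) (count_space UNIV)"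
proof -
  assume v: "v \<in> slab"
  have "(\<lambda>x. snd (x v) n) \<in> measurable (history_measure p) (borel \<Otimes>\<^sub>M count_space UNIV)"
    by (rule measurable_clock_nth[OF measurable_compose[OF measurable_site_value[OF v] measurable_site_clock]])
  from measurable_compose[OF this measurable_snd] show ?thesis unfolding toss_def .
qed

lemma measurable_spin0: "v \<in> slab \<Longrightarrow> (\<lambda>x. spin0 x v) \<in> measurable (history_measure p) (count_space UNIV)"
proof -
  assume v: "v \<in> slab"
  have "fst \<in> measurable (site_measure p) (count_space UNIV)" unfolding site_measure_def by measurable
  from measurable_compose[OF measurable_site_value[OF v] this] show ?thesis unfolding spin0_def .
qed

lemma measurable_approx:
  "v \<in> slab \<Longrightarrow> (\<lambda>q. approx k (fst q) v (snd q)) \<in> measurable (history_measure p \<Otimes>\<^sub>M borel) (count_space UNIV)"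
proof (induction k arbitrary: v)
  case 0
  show ?case unfolding approx.simps by (rule measurable_compose[OF measurable_fst measurable_spin0[OF 0]])
next
  case (Suc k)
  let ?M = "history_measure p \<Otimes>\<^sub>M (borel :: real measure)"
  note v = Suc.prems
  have [measurable]: "(\<lambda>q. rt (fst q) v n) \<in> borel_measurable ?M" for n
    by (rule measurable_compose[OF measurable_fst measurable_rt[OF v]])
  have rb: "(\<lambda>q. rings_before (fst q) v (snd q)) \<in> measurable ?M (count_space UNIV)"
    unfolding rings_before_def by measurable
  have step: "(\<lambda>q. case n of 0 \<Rightarrow> spin0 (fst q) v | Suc n \<Rightarrow> updated_spin (\<lambda>w. approx k (fst q) w (rt (fst q) v n)) v (toss (fst q) v n))
    \<in> measurable ?M (count_space UNIV)" for n
  proof (cases n)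
    case 0
    then show ?thesis by (simp add: measurable_compose[OF measurable_fst measurable_spin0[OF v]])
  next
    case (Suc m)
    have pair: "(\<lambda>q. (fst q, rt (fst q) v m)) \<in> measurable ?M ?M" by measurable
    have "(\<lambda>q. updated_spin (\<lambda>w. approx k (fst q) w (rt (fst q) v m)) v (toss (fst q) v m)) \<in> measurable ?M (count_space UNIV)"
    proof (rule measurable_updated_spin[OF v])
      fix w assume "w \<in> insert v (neighbors v)"
      from measurable_compose[OF pair Suc.IH[OF near_slab[OF v this]]]
      show "(\<lambda>q. approx k (fst q) w (rt (fst q) v m)) \<in> measurable ?M (count_space UNIV)" by simp
    qed (rule measurable_compose[OF measurable_fst measurable_toss[OF v]])
    then show ?thesis using Suc by simp
  qed
  show ?case unfolding approx.simps by (rule measurable_compose_countable[OF step rb])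
qed

lemma measurable_before:
  assumes "v \<in> slab"
  shows "(\<lambda>q. before (fst q) (snd q) v) \<in> measurable (history_measure p \<Otimes>\<^sub>M borel) (count_space UNIV)"
proof -
  note [measurable] = measurable_approx[OF assms]
  show ?thesis unfolding before_def by measurable
qed

lemma measurable_before_rt:
  assumes v: "v \<in> slab" and w: "w \<in> slab"
  shows "(\<lambda>x. before x (rt x v n) w) \<in> measurable (history_measure p) (count_space UNIV)"
proof -
  have "(\<lambda>x. (x, rt x v n)) \<in> measurable (history_measure p) (history_measure p \<Otimes>\<^sub>M borel)"
    using measurable_rt[OF v] by measurable
  from measurable_compose[OF this measurable_before[OF w]] show ?thesis by simp
qed

lemma measurable_lowers:
  assumes v: "v \<in> slab"
  shows "Measurable.pred (history_measure p) (\<lambda>x. lowers x v n)"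
proof -
  have A: "(\<lambda>x. real_of_int (before x (rt x v n) w)) \<in> borel_measurable (history_measure p)" if "w \<in> insert v (neighbors v)" for w
    by (rule measurable_compose[OF measurable_before_rt[OF v near_slab[OF v that]]]) simp
  have e: "(\<lambda>x. real_of_int (energy (before x (rt x v n)) v)) \<in> borel_measurable (history_measure p)"
    unfolding energy_def of_int_minus of_int_sum of_int_mult
    by (intro borel_measurable_uminus borel_measurable_sum borel_measurable_times A) auto
  then have "Measurable.pred (history_measure p) (\<lambda>x. 0 < real_of_int (energy (before x (rt x v n)) v))" by measurable
  then show ?thesis unfolding lowers_def by simp
qed

lemma measurable_spin:
  assumes v: "v \<in> slab"
  shows "(\<lambda>x. spin x v t) \<in> measurable (history_measure p) (count_space UNIV)"
proof -
  note [measurable] = measurable_rt[OF v]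
  have ru: "(\<lambda>x. rings_upto x v t) \<in> measurable (history_measure p) (count_space UNIV)"
    unfolding rings_upto_def by measurable
  have step: "(\<lambda>x. case n of 0 \<Rightarrow> spin0 x v | Suc n \<Rightarrow> updated_spin (before x (rt x v n)) v (toss x v n))
    \<in> measurable (history_measure p) (count_space UNIV)" for n
  proof (cases n)
    case 0
    then show ?thesis by (simp add: measurable_spin0[OF v])
  next
    case (Suc m)
    have "(\<lambda>x. updated_spin (\<lambda>w. before x (rt x v m) w) v (toss x v m)) \<in> measurable (history_measure p) (count_space UNIV)"
      by (rule measurable_updated_spin[OF v measurable_before_rt[OF v near_slab[OF v]] measurable_toss[OF v]])
    then show ?thesis using Suc by simp
  qed
  show ?thesis unfolding spin_def by (rule measurable_compose_countable[OF step ru])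
qed

section \<open>Expected numbers of rings and of lowering rings\<close>

definition lowerings :: "vertex \<Rightarrow> real \<Rightarrow> history \<Rightarrow> ennreal" where
  "lowerings v t x = (\<Sum>n. indicator {x. lowers x v n \<and> rt x v n \<le> t} x)"

lemma measurable_lowerings:
  assumes v: "v \<in> slab"
  shows "lowerings v t \<in> borel_measurable (history_measure p)"
proof -
  note [measurable] = measurable_rt[OF v] measurable_lowers[OF v]
  have "(\<lambda>x. indicator {x. lowers x v n \<and> rt x v n \<le> t} x :: ennreal) \<in> borel_measurable (history_measure p)" for n
    unfolding indicator_def mem_Collect_eq by measurable
  then show ?thesis unfolding lowerings_def[abs_def] by measurable
qed

lemma suminf_indicator_card:
  fixes A :: "nat set"
  assumes "finite A"
  shows "(\<Sum>n. indicator A n :: ennreal) = of_nat (card A)"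
proof -
  have "(\<Sum>n. indicator A n :: ennreal) = (\<Sum>n\<in>A. indicator A n)"
    by (rule suminf_finite[OF assms]) simp
  then show ?thesis by simp
qed

lemma lowerings_card:
  assumes g: "good x" and v: "v \<in> slab"
  shows "lowerings v t x = of_nat (card {n. n < rings_upto x v t \<and> lowers x v n})"
proof -
  have "(indicator {x. lowers x v n \<and> rt x v n \<le> t} x :: ennreal) = indicator {n. n < rings_upto x v t \<and> lowers x v n} n" for n
    using rings_upto_iff[OF g v, of n t] by (auto simp: indicator_def)
  then show ?thesis unfolding lowerings_def by (simp add: suminf_indicator_card)
qed

lemma expected_rings_site:
  assumes v: "v \<in> slab"
  shows "(\<integral>\<^sup>+x. of_nat (rings_upto x v t) \<partial>history_measure p) \<le> ennreal (exp t)"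
proof -
  have H: "distr (history_measure p) (site_measure p) (\<lambda>x. x v) = site_measure p"
    unfolding history_measure_def by (rule distr_PiM_component[OF prob_space_site v])
  let ?f = "\<lambda>\<xi>. \<Sum>n. indicator {..t} (ring_sum \<xi> n) :: ennreal"
  have f: "?f \<in> borel_measurable clock_measure" by measurable
  have fs: "(\<lambda>a. ?f (snd a)) \<in> borel_measurable (site_measure p)"
    by (rule measurable_compose[OF measurable_site_clock f])
  interpret C: prob_space clock_measure by (rule prob_space_clock)
  have "AE x in history_measure p. of_nat (rings_upto x v t) = ?f (snd (x v))"
    using AE_good[of p]
  proof eventually_elim
    case (elim x)
    have "(indicator {..t} (ring_sum (snd (x v)) n) :: ennreal) = indicator {..<rings_upto x v t} n" for n
      using rings_upto_iff[OF elim v, of n t] by (simp add: indicator_def rt_ring_sum)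
    then show ?case by (simp add: suminf_indicator_card)
  qed
  then have "(\<integral>\<^sup>+x. of_nat (rings_upto x v t) \<partial>history_measure p) = (\<integral>\<^sup>+x. ?f (snd (x v)) \<partial>history_measure p)"
    by (rule nn_integral_cong_AE)
  also have "\<dots> = (\<integral>\<^sup>+a. ?f (snd a) \<partial>site_measure p)"
    using nn_integral_distr[OF measurable_site_value[OF v], of "\<lambda>a. ?f (snd a)" p] fs unfolding H by simp
  also have "\<dots> = (\<integral>\<^sup>+s. \<integral>\<^sup>+\<xi>. ?f \<xi> \<partial>clock_measure \<partial>measure_pmf (spin_pmf p))"
    using C.nn_integral_fst[OF fs[unfolded site_measure_def]] unfolding site_measure_def by simp
  also have "\<dots> = (\<integral>\<^sup>+\<xi>. ?f \<xi> \<partial>clock_measure)"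
    using measure_pmf.emeasure_space_1[of "spin_pmf p"] by simp
  also have "\<dots> \<le> ennreal (exp t)" using expected_rings[of t] by (simp add: indicator_def)
  finally show ?thesis .
qed

lemma distr_shift: "distr (history_measure p) (history_measure p) (shift i j) = history_measure p"
  and measurable_shift: "shift i j \<in> measurable (history_measure p) (history_measure p)"
proof -
  show "distr (history_measure p) (history_measure p) (shift i j) = history_measure p"
    unfolding history_measure_def shift_def[abs_def]
    by (rule distr_PiM_reindex[OF prob_space_site inj_tr]) (simp add: tr_slab)
  show "shift i j \<in> measurable (history_measure p) (history_measure p)"
    unfolding history_measure_def shift_def[abs_def]
    by (intro measurable_restrict measurable_component_singleton) (simp add: tr_slab)
qed

lemma expected_lowerings_tr:
  assumes v: "v \<in> slab"
  shows "(\<integral>\<^sup>+x. lowerings (tr i j v) t x \<partial>history_measure p) = (\<integral>\<^sup>+x. lowerings v t x \<partial>history_measure p)"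
proof -
  have "lowerings v t (shift i j x) = lowerings (tr i j v) t x" for x
    unfolding lowerings_def by (simp add: indicator_def lowers_shift[OF v] shift_site(1)[OF v])
  then show ?thesis
    using nn_integral_distr[OF measurable_shift, of "lowerings v t" p i j] measurable_lowerings[OF v] unfolding distr_shift by simp
qed

lemma box_interior:
  "{v \<in> {1..int L} \<times> {1..int L} \<times> {0, 1, 2}. neighbors v \<subseteq> {1..int L} \<times> {1..int L} \<times> {0, 1, 2}} \<supseteq> {2..int L - 1} \<times> {2..int L - 1} \<times> {0, 1, 2}"
proof
  fix v assume "v \<in> {2..int L - 1} \<times> {2..int L - 1} \<times> {0, 1, 2 :: int}"
  then obtain a b c where v: "v = (a, b, c)" "a \<in> {2..int L - 1}" "b \<in> {2..int L - 1}" "c \<in> {0, 1, 2}" by blast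
  show "v \<in> {v \<in> {1..int L} \<times> {1..int L} \<times> {0, 1, 2}. neighbors v \<subseteq> {1..int L} \<times> {1..int L} \<times> {0, 1, 2}}"
    unfolding v(1) mem_Collect_eq neighbors_eq[OF v(4)] using v(2-4) by auto
qed

text \<open>In a box of side \<open>L\<close> the energy is of the order of the number of sites,
  while the rings near the boundary contribute only order \<open>L\<close>. The expectation is the
  same at all sites of a layer, so dividing by their number and letting \<open>L\<close> grow
  removes the boundary term and with it the dependence on \<open>t\<close>.\<close>

theorem expected_lowerings:
  assumes v: "v \<in> slab" and t: "0 \<le> t"
  shows "(\<integral>\<^sup>+x. lowerings v t x \<partial>history_measure p) \<le> ennreal (9 / 2)"
proof -
  let ?H = "history_measure p" and ?a = "\<integral>\<^sup>+x. lowerings v t x \<partial>history_measure p"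
  interpret prob_space ?H by (rule prob_space_history)
  obtain a b c where abc: "v = (a, b, c)" "c \<in> {0, 1, 2}" using v by (cases v) (auto simp: slab_iff)
  \<comment> \<open>18 is 6 per site times three layers, and 144 is 12 times the boundary count
    \<open>12 * L\<close>. The left side sums over the layer of \<open>v\<close> only, because
    translations are horizontal. The limit is therefore 18/4.\<close>
  have bound: "ennreal (4 * (real L - 2)^2) * ?a \<le> ennreal (18 * (real L)^2 + 144 * real L * exp t)" if L: "3 \<le> L" for L :: nat
  proof -
    let ?B = "{1..int L} \<times> {1..int L} \<times> {0, 1, 2 :: int}"
    let ?J = "{2..int L - 1} \<times> {2..int L - 1} \<times> {0, 1, 2 :: int}"
    let ?K = "{2..int L - 1} \<times> {2..int L - 1} \<times> {c}"
    define I where "I = {v \<in> ?B. neighbors v \<subseteq> ?B}"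
    have B: "finite ?B" "?B \<subseteq> slab" by (auto simp: slab_def)
    have JI: "?J \<subseteq> I" unfolding I_def by (rule box_interior)
    have KI: "?K \<subseteq> I" using JI abc(2) by blast
    have cB: "card ?B = 3 * L^2" by (simp add: card_cartesian_product power2_eq_square)
    have cJ: "card ?J = 3 * (L - 2)^2" using L by (simp add: card_cartesian_product power2_eq_square nat_diff_distrib')
    have cK: "card ?K = (L - 2)^2" using L by (simp add: card_cartesian_product power2_eq_square nat_diff_distrib')
    have cd: "card (?B - I) \<le> 12 * L"
    proof -
      have "card (?B - I) \<le> card (?B - ?J)" using JI by (intro card_mono) auto
      also have "\<dots> = 3 * L^2 - 3 * (L - 2)^2"
        unfolding cB[symmetric] cJ[symmetric] by (rule card_Diff_subset) auto
      also have "\<dots> \<le> 12 * L"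
      proof -
        have "L = 2 + (L - 2)" using L by simp
        then obtain k where "L = 2 + k" by blast
        then show ?thesis by (simp add: power2_eq_square algebra_simps)
      qed
      finally show ?thesis .
    qed
    have path: "AE x in ?H. 4 * (\<Sum>u\<in>?K. lowerings u t x) \<le> ennreal (18 * (real L)^2) + 12 * (\<Sum>u\<in>?B - I. of_nat (rings_upto x u t))"
      using AE_good[of p]
    proof eventually_elim
      case (elim x)
      have "4 * (\<Sum>u\<in>?K. int (card {n. n < rings_upto x u t \<and> lowers x u n})) \<le> 4 * (\<Sum>u\<in>I. int (card {n. n < rings_upto x u t \<and> lowers x u n}))"
        by (intro mult_left_mono sum_mono2) (use KI in \<open>auto simp: I_def\<close>)
      also have "\<dots> \<le> 6 * int (card ?B) + 12 * (\<Sum>u\<in>?B - I. int (rings_upto x u t))"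
        using lowers_bound[OF elim B t] unfolding I_def .
      finally have "int (4 * (\<Sum>u\<in>?K. card {n. n < rings_upto x u t \<and> lowers x u n})) \<le> int (18 * L^2 + 12 * (\<Sum>u\<in>?B - I. rings_upto x u t))"
        unfolding cB by simp
      then have nat: "4 * (\<Sum>u\<in>?K. card {n. n < rings_upto x u t \<and> lowers x u n}) \<le> 18 * L^2 + 12 * (\<Sum>u\<in>?B - I. rings_upto x u t)"
        by (simp only: of_nat_le_iff)
      have "4 * (\<Sum>u\<in>?K. lowerings u t x) = of_nat (4 * (\<Sum>u\<in>?K. card {n. n < rings_upto x u t \<and> lowers x u n}))"
      proof -
        have "?K \<subseteq> slab" using abc(2) by (auto simp: slab_def)
        then have "(\<Sum>u\<in>?K. lowerings u t x) = (\<Sum>u\<in>?K. of_nat (card {n. n < rings_upto x u t \<and> lowers x u n}))"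
          by (intro sum.cong refl lowerings_card[OF elim]) blast
        then show ?thesis by simp
      qed
      also have "\<dots> \<le> (of_nat (18 * L^2 + 12 * (\<Sum>u\<in>?B - I. rings_upto x u t)) :: ennreal)"
        using nat by (rule of_nat_mono)
      also have "\<dots> = ennreal (18 * (real L)^2) + 12 * (\<Sum>u\<in>?B - I. of_nat (rings_upto x u t))"
        by (simp add: ennreal_of_nat_eq_real_of_nat[symmetric] ennreal_mult ennreal_power[symmetric])
      finally show ?case .
    qed
    have mr: "(\<lambda>x. of_nat (rings_upto x u t) :: ennreal) \<in> borel_measurable ?H" if "u \<in> slab" for u
    proof -
      note [measurable] = measurable_rt[OF that]
      have "(\<lambda>x. rings_upto x u t) \<in> measurable ?H (count_space UNIV)" unfolding rings_upto_def by measurable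
      then show ?thesis by (rule measurable_compose) simp
    qed
    have ml: "lowerings u t \<in> borel_measurable ?H" if "u \<in> ?K" for u
      using that abc(2) by (intro measurable_lowerings) (auto simp: slab_def)
    have same: "(\<integral>\<^sup>+x. lowerings u t x \<partial>?H) = ?a" if u: "u \<in> ?K" for u
    proof -
      have "u = tr (fst u - a) (fst (snd u) - b) v" using u abc(1) by (auto simp: tr_def)
      then show ?thesis using expected_lowerings_tr[OF v, where i = "fst u - a" and j = "fst (snd u) - b" and t = t and p = p] by simp
    qed
    have "ennreal (4 * (real L - 2)^2) * ?a = 4 * (\<Sum>u\<in>?K. \<integral>\<^sup>+x. lowerings u t x \<partial>?H)"
    proof -
      have "(\<Sum>u\<in>?K. \<integral>\<^sup>+x. lowerings u t x \<partial>?H) = of_nat (card ?K) * ?a" by (simp add: same)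
      moreover have "ennreal (4 * (real L - 2)^2) = 4 * of_nat (card ?K)"
        unfolding cK using L by (simp add: ennreal_of_nat_eq_real_of_nat ennreal_mult of_nat_diff)
      ultimately show ?thesis by (simp add: mult.assoc)
    qed
    also have "\<dots> = (\<integral>\<^sup>+x. 4 * (\<Sum>u\<in>?K. lowerings u t x) \<partial>?H)"
      using ml by (subst nn_integral_cmult) (auto intro!: borel_measurable_sum simp: nn_integral_sum)
    also have "\<dots> \<le> (\<integral>\<^sup>+x. ennreal (18 * (real L)^2) + 12 * (\<Sum>u\<in>?B - I. of_nat (rings_upto x u t)) \<partial>?H)"
      by (rule nn_integral_mono_AE[OF path])
    also have "\<dots> = ennreal (18 * (real L)^2) + 12 * (\<Sum>u\<in>?B - I. \<integral>\<^sup>+x. of_nat (rings_upto x u t) \<partial>?H)"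
    proof -
      have m: "(\<lambda>x. \<Sum>u\<in>?B - I. of_nat (rings_upto x u t) :: ennreal) \<in> borel_measurable ?H"
        using mr B(2) by (intro borel_measurable_sum) blast
      have "(\<integral>\<^sup>+x. (\<Sum>u\<in>?B - I. of_nat (rings_upto x u t)) \<partial>?H) = (\<Sum>u\<in>?B - I. \<integral>\<^sup>+x. of_nat (rings_upto x u t) \<partial>?H)"
        using mr B(2) by (intro nn_integral_sum) blast
      then show ?thesis using m by (simp add: nn_integral_add nn_integral_cmult emeasure_space_1)
    qed
    also have "\<dots> \<le> ennreal (18 * (real L)^2) + 12 * (\<Sum>u\<in>?B - I. ennreal (exp t))"
      using B(2) by (intro add_left_mono mult_left_mono sum_mono expected_rings_site) auto
    also have "\<dots> = ennreal (18 * (real L)^2 + 12 * (real (card (?B - I)) * exp t))"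
      by (simp add: ennreal_of_nat_eq_real_of_nat ennreal_mult[symmetric] ennreal_plus[symmetric] ennreal_numeral[symmetric] del: ennreal_plus ennreal_numeral)
    also have "\<dots> \<le> ennreal (18 * (real L)^2 + 144 * real L * exp t)"
    proof (rule ennreal_leI)
      have "real (card (?B - I)) \<le> 12 * real L" using cd by linarith
      then have "real (card (?B - I)) * exp t \<le> 12 * real L * exp t" by (intro mult_right_mono) auto
      then show "18 * (real L)^2 + 12 * (real (card (?B - I)) * exp t) \<le> 18 * (real L)^2 + 144 * real L * exp t" by linarith
    qed
    finally show ?thesis .
  qed
  \<comment> \<open>For \<open>L = 3\<close> there is one site on the left side, enough to exclude
    an infinite expectation before any division.\<close>
  have "?a \<noteq> \<top>"
  proof
    assume "?a = \<top>"
    then have "\<top> \<le> ennreal (18 * (real 3)^2 + 144 * real 3 * exp t)"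
      using bound[of 3] by (simp add: ennreal_mult_top)
    then show False by (simp add: top_unique)
  qed
  then obtain r where r: "?a = ennreal r" "0 \<le> r" by (cases ?a) auto
  have "r \<le> (18 * (real L)^2 + 144 * real L * exp t) / (4 * (real L - 2)^2)" if "3 \<le> L" for L :: nat
  proof -
    have "ennreal (4 * (real L - 2)^2 * r) \<le> ennreal (18 * (real L)^2 + 144 * real L * exp t)"
      using bound[OF that] unfolding r(1) by (simp add: ennreal_mult[OF _ r(2)])
    then have "4 * (real L - 2)^2 * r \<le> 18 * (real L)^2 + 144 * real L * exp t"
      by (subst (asm) ennreal_le_iff) auto
    moreover have "0 < 4 * (real L - 2)^2" using that by simp
    ultimately show ?thesis by (simp add: pos_le_divide_eq mult.commute)
  qed
  moreover have "(\<lambda>L. (18 * (real L)^2 + 144 * real L * exp t) / (4 * (real L - 2)^2)) \<longlonglongrightarrow> 9 / 2"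
    by real_asymp
  ultimately have "r \<le> 9 / 2" by (intro LIMSEQ_le_const) blast+
  then show ?thesis unfolding r(1) by (rule ennreal_leI)
qed

section \<open>Finiteness of the time with reachable descents\<close>

lemma prob_rings_soon:
  assumes v: "v \<in> slab" and \<delta>: "0 \<le> \<delta>"
  shows "emeasure (history_measure p) {y \<in> space (history_measure p). \<exists>n. rt y v n \<in> {0<..\<delta>}} \<le> ennreal \<delta>"
proof -
  let ?H = "history_measure p" and ?W = "{\<xi> \<in> space clock_measure. \<exists>n. ring_sum \<xi> n \<in> {0<..0 + \<delta>}}"
  interpret C: prob_space clock_measure by (rule prob_space_clock)
  have D: "distr ?H (site_measure p) (\<lambda>x. x v) = site_measure p"
    unfolding history_measure_def by (rule distr_PiM_component[OF prob_space_site v])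
  have W: "?W \<in> sets clock_measure" by measurable
  have S: "space (measure_pmf (spin_pmf p)) \<times> ?W \<in> sets (site_measure p)"
    unfolding site_measure_def using W by (intro pair_measureI) auto
  have "{y \<in> space ?H. \<exists>n. rt y v n \<in> {0<..\<delta>}} = (\<lambda>x. x v) -` (space (measure_pmf (spin_pmf p)) \<times> ?W) \<inter> space ?H"
    using measurable_space[OF measurable_site_value[OF v, of p]] unfolding site_measure_def
    by (auto simp: space_pair_measure rt_ring_sum mem_Times_iff)
  then have "emeasure ?H {y \<in> space ?H. \<exists>n. rt y v n \<in> {0<..\<delta>}} = emeasure (site_measure p) (space (measure_pmf (spin_pmf p)) \<times> ?W)"
    using emeasure_distr[OF measurable_site_value[OF v, of p] S] unfolding D by simp
  also have "\<dots> = emeasure clock_measure ?W"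
    unfolding site_measure_def using W measure_pmf.emeasure_space_1[of "spin_pmf p"] by (simp add: C.emeasure_pair_measure_Times)
  also have "\<dots> \<le> ennreal \<delta>" by (rule prob_window) (use \<delta> in auto)
  finally show ?thesis .
qed

section \<open>Positive probability of a prescribed pattern of rings\<close>

lemma ring_positive:
  assumes "0 \<le> a" "a < b" "c \<in> {1, -1}"
  shows "0 < emeasure ring_measure ({a<..b} \<times> {c})"
proof -
  have "0 < ennreal (exp (- b)) * emeasure lborel {a<..b}"
    using assms by (simp add: ennreal_zero_less_mult_iff)
  also have "\<dots> = (\<integral>\<^sup>+x. ennreal (exp (- b)) * indicator {a<..b} x \<partial>lborel)"
    by (rule nn_integral_cmult_indicator[symmetric]) simp
  also have "\<dots> \<le> (\<integral>\<^sup>+x. ennreal (exponential_density 1 x) * indicator {a<..b} x \<partial>lborel)"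
    using assms by (intro nn_integral_mono) (auto simp: exponential_density_def split: split_indicator)
  also have "\<dots> = emeasure (density lborel (\<lambda>x. ennreal (exponential_density 1 x))) {a<..b}"
    by (rule emeasure_density[symmetric]) auto
  finally have 1: "0 < emeasure (density lborel (\<lambda>x. ennreal (exponential_density 1 x))) {a<..b}" .
  have "c \<in> set_pmf (spin_pmf (1 / 2))" using assms(3) by (auto simp: spin_pmf_def)
  then have "0 < emeasure (measure_pmf (spin_pmf (1 / 2))) {c}"
    by (simp add: emeasure_pmf_single pmf_positive)
  with 1 show ?thesis
    unfolding ring_measure_def by (subst measure_pmf.emeasure_pair_measure_Times) (auto simp: ennreal_zero_less_mult_iff)
qed

text \<open>Both entries of the clock are confined to boxes of the kind treated in
  \<open>ring_positive\<close>; a second waiting time above 1 puts the second ring beyond time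
  1.\<close>

definition prompt :: "real \<Rightarrow> real \<Rightarrow> real \<Rightarrow> int \<Rightarrow> (int \<times> (nat \<Rightarrow> real \<times> int)) set" where
  "prompt p a b c = {q \<in> space (site_measure p). snd q 0 \<in> {a<..b} \<times> {c} \<and> snd q 1 \<in> {1<..2} \<times> {1}}"

lemma prompt_positive:
  assumes "0 \<le> a" "a < b" "c \<in> {1, -1}"
  shows "prompt p a b c \<in> sets (site_measure p)" "0 < emeasure (site_measure p) (prompt p a b c)"
proof -
  interpret C: prob_space clock_measure by (rule prob_space_clock)
  let ?F = "\<lambda>j :: nat. if j = 0 then {a<..b} \<times> {c} else {1<..2} \<times> {1}"
  let ?W = "{\<xi> \<in> space clock_measure. \<forall>j\<in>{0, 1}. \<xi> j \<in> ?F j}"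
  have F: "?F j \<in> sets ring_measure" for j unfolding sets_ring by auto
  have W: "?W \<in> sets clock_measure"
    unfolding clock_measure_def by (rule sets_PiM_box[OF _ _ F]) auto
  have "emeasure clock_measure ?W = (\<Prod>j\<in>{0, 1}. emeasure ring_measure (?F j))"
    unfolding clock_measure_def by (rule emeasure_PiM_box[OF prob_space_ring _ _ F]) auto
  also have "\<dots> > 0"
    using ring_positive[OF assms] ring_positive[of 1 2 1] by (simp add: ennreal_zero_less_mult_iff)
  finally have pos: "0 < emeasure clock_measure ?W" .
  have eq: "prompt p a b c = space (measure_pmf (spin_pmf p)) \<times> ?W"
    unfolding prompt_def site_measure_def by (auto simp: space_pair_measure)
  show "prompt p a b c \<in> sets (site_measure p)"
    unfolding eq site_measure_def using W by (intro pair_measureI) auto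
  show "0 < emeasure (site_measure p) (prompt p a b c)"
    unfolding eq site_measure_def using W pos measure_pmf.emeasure_space_1[of "spin_pmf p"] by (simp add: C.emeasure_pair_measure_Times)
qed

text \<open>The condition concerns at most two rings at each of finitely many vertices, whose clocks
  are independent.\<close>

lemma follows_positive:
  assumes B: "finite B" "B \<subseteq> slab" and L: "distinct L" "set L \<subseteq> B" and c: "c \<in> {1, -1}"
  shows "\<exists>A\<in>sets (history_measure p). 0 < emeasure (history_measure p) A \<and> (\<forall>y\<in>A. follows B L c y)"
proof -
  let ?m = "real (length L)"
  define idx where "idx v = (THE i. i < length L \<and> L ! i = v)" for v
  have idx: "idx (L ! i) = i" if "i < length L" for i
    unfolding idx_def using L(1) that by (auto simp: nth_eq_iff_index_eq)
  define F where "F v = (if v \<in> set L then prompt p (idx v / ?m) (Suc (idx v) / ?m) c else prompt p 1 2 1)" for v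
  define A where "A = {y \<in> space (history_measure p). \<forall>v\<in>B. y v \<in> F v}"
  have F: "F v \<in> sets (site_measure p)" "0 < emeasure (site_measure p) (F v)" for v
  proof -
    have "0 < ?m" if "v \<in> set L" using that by (cases L) auto
    then have "idx v / ?m < Suc (idx v) / ?m" if "v \<in> set L" using that by (intro divide_strict_right_mono) auto
    then show "F v \<in> sets (site_measure p)" "0 < emeasure (site_measure p) (F v)"
      unfolding F_def using prompt_positive[OF _ _ c] prompt_positive[of 1 2 1] by auto
  qed
  have "A \<in> sets (history_measure p)"
    unfolding A_def history_measure_def by (rule sets_PiM_box[OF B(2,1) F(1)])
  moreover have "0 < emeasure (history_measure p) A"
  proof -
    have "emeasure (history_measure p) A = (\<Prod>v\<in>B. emeasure (site_measure p) (F v))"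
      unfolding A_def history_measure_def by (rule emeasure_PiM_box[OF prob_space_site B(2,1) F(1)])
    moreover have "(\<Prod>v\<in>B. emeasure (site_measure p) (F v)) \<noteq> 0"
      using B(1) F(2) by (simp add: less_le)
    ultimately show ?thesis by (simp add: zero_less_iff_neq_zero)
  qed
  moreover have "follows B L c y" if y: "y \<in> A" for y
    unfolding follows_def
  proof (intro conjI ballI allI impI)
    fix v assume v: "v \<in> B - set L"
    then have "y v \<in> prompt p 1 2 1" using y unfolding A_def F_def by auto
    then show "1 < rt y v 0" unfolding prompt_def rt_def by auto
  next
    fix i assume i: "i < length L"
    have "L ! i \<in> B" using nth_mem[OF i] L(2) by blast
    then have "y (L ! i) \<in> F (L ! i)" using y unfolding A_def by blast
    then have q: "y (L ! i) \<in> prompt p (i / ?m) (Suc i / ?m) c"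
      using nth_mem[OF i] idx[OF i] unfolding F_def by simp
    then show "i / ?m < rt y (L ! i) 0" "rt y (L ! i) 0 \<le> Suc i / ?m" "toss y (L ! i) 0 = c"
      unfolding prompt_def rt_def toss_def by auto
    have "0 \<le> i / ?m" by simp
    moreover have "i / ?m < fst (snd (y (L ! i)) 0)" "1 < fst (snd (y (L ! i)) 1)"
      using q unfolding prompt_def by auto
    ultimately have "0 < fst (snd (y (L ! i)) 0)" "1 < fst (snd (y (L ! i)) 1)" by linarith+
    then show "1 < rt y (L ! i) 1" unfolding rt_def by simp
  qed
  ultimately show ?thesis by blast
qed

lemma ties_restrict:
  assumes "\<And>s. s \<in> Q \<Longrightarrow> insert s (neighbors s) \<subseteq> V"
  shows "ties Q P us \<longleftrightarrow> ties Q (P \<inter> V) us"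
proof (induction us arbitrary: P)
  case (Cons u us)
  show ?case
  proof (cases "u \<in> Q")
    case True
    have "insert u P \<inter> V = insert u (P \<inter> V)" "neighbors u \<inter> (P \<inter> V) = neighbors u \<inter> P" "u \<in> V"
      using assms[OF True] by blast+
    then show ?thesis using Cons.IH[of "insert u P"] by simp
  qed simp
qed simp

text \<open>Only the spins of the sites of \<open>Q\<close> and their neighbours are consulted. For
  finite \<open>Q\<close> this makes the event of a descent a finite union of cylinders, hence
  measurable.\<close>

lemma descends_restrict:
  assumes V: "\<And>s. s \<in> Q \<Longrightarrow> insert s (neighbors s) \<subseteq> V" and eq: "P \<inter> V = P' \<inter> V"
  shows "descends Q P us u \<longleftrightarrow> descends Q P' us u"
proof -
  have *: "descends Q P us u \<longleftrightarrow> descends Q (P \<inter> V) us u" for P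
  proof (cases "ties Q P us \<and> u \<in> Q")
    case True
    then have "set us \<subseteq> V" using ties_distinct[of Q P us] V by blast
    then have "neighbors u \<inter> (P \<inter> V \<union> set us) = neighbors u \<inter> (P \<union> set us)" "u \<in> P \<inter> V \<union> set us \<longleftrightarrow> u \<in> P \<union> set us"
      using V True by blast+
    then show ?thesis unfolding descends_def using ties_restrict[OF V, where P = P and us = us] by simp
  next
    case False
    then show ?thesis unfolding descends_def using ties_restrict[OF V, where P = P and us = us] by auto
  qed
  show ?thesis using *[of P] *[of P'] eq by simp
qed

section \<open>Events that a descent is reachable or performed\<close>

definition descent_event :: "real \<Rightarrow> vertex set \<Rightarrow> real \<Rightarrow> int \<times> vertex list \<times> vertex \<Rightarrow> history set" where
  "descent_event p S T = (\<lambda>(c, us, u). {x \<in> space (history_measure p). descends S {v \<in> slab. spin x v T = c} us u})"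

definition lowering_event :: "real \<Rightarrow> vertex \<Rightarrow> real \<Rightarrow> real \<Rightarrow> history set" where
  "lowering_event p u s t = {x \<in> space (history_measure p). \<exists>n. lowers x u n \<and> rt x u n \<in> {s<..t}}"

lemma sets_descent_event:
  assumes S: "finite S" "S \<subseteq> slab"
  shows "descent_event p S T r \<in> sets (history_measure p)"
proof -
  obtain c us u where r: "r = (c, us, u)" by (metis prod_cases3)
  let ?H = "history_measure p"
  define V where "V = S \<union> \<Union> (neighbors ` S)"
  have V: "finite V" "V \<subseteq> slab" using S finite_neighbors neighbors_slab unfolding V_def by blast+
  have Vn: "insert s (neighbors s) \<subseteq> V" if "s \<in> S" for s using that unfolding V_def by blast
  have cell: "{x \<in> space ?H. \<forall>v\<in>V. spin x v T = c \<longleftrightarrow> v \<in> W} \<in> sets ?H" for W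
  proof (rule sets.sets_Collect_finite_All[OF _ V(1)])
    fix v assume "v \<in> V"
    then have "(\<lambda>x. spin x v T) \<in> measurable ?H (count_space UNIV)" using V(2) by (intro measurable_spin) blast
    then have "Measurable.pred ?H (\<lambda>x. spin x v T = c)" by measurable
    then show "{x \<in> space ?H. spin x v T = c \<longleftrightarrow> v \<in> W} \<in> sets ?H" by measurable
  qed
  have "descent_event p S T r = (\<Union>W\<in>{W \<in> Pow V. descends S W us u}. {x \<in> space ?H. \<forall>v\<in>V. spin x v T = c \<longleftrightarrow> v \<in> W})"
    (is "?l = ?r")
  proof (intro set_eqI iffI)
    fix x assume x: "x \<in> ?l"
    let ?W = "{v \<in> V. spin x v T = c}"
    have "{v \<in> slab. spin x v T = c} \<inter> V = ?W \<inter> V" using V(2) by blast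
    then have "descends S ?W us u"
      using x descends_restrict[OF Vn, where P = "{v \<in> slab. spin x v T = c}" and P' = ?W and us = us and u = u] unfolding descent_event_def r by simp
    then show "x \<in> ?r" using x unfolding descent_event_def r by (intro UN_I[of ?W]) auto
  next
    fix x assume "x \<in> ?r"
    then obtain W where W: "W \<subseteq> V" "descends S W us u" "x \<in> space ?H" "\<forall>v\<in>V. spin x v T = c \<longleftrightarrow> v \<in> W" by blast
    have "{v \<in> slab. spin x v T = c} \<inter> V = W \<inter> V" using W V(2) by blast
    then show "x \<in> ?l"
      using W descends_restrict[OF Vn, where P = "{v \<in> slab. spin x v T = c}" and P' = W and us = us and u = u] unfolding descent_event_def r by simp
  qed
  moreover have "?r \<in> sets ?H" using V(1) cell by (intro sets.finite_UN) auto
  ultimately show ?thesis by simp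
qed

lemma sets_lowering_event: "u \<in> slab \<Longrightarrow> lowering_event p u s t \<in> sets (history_measure p)"
proof -
  assume u: "u \<in> slab"
  note [measurable] = measurable_rt[OF u] measurable_lowers[OF u]
  show ?thesis unfolding lowering_event_def by measurable
qed

lemma AE_good_splice:
  assumes "0 \<le> T"
  shows "AE q in history_measure p \<Otimes>\<^sub>M history_measure p. good (fst q) \<and> good (snd q) \<and> good (splice T (fst q) (snd q))"
proof -
  have "AE q in history_measure p \<Otimes>\<^sub>M history_measure p. good (fst q)"
    by (rule AE_pair_fst[OF prob_space_history AE_good])
  moreover have "AE q in history_measure p \<Otimes>\<^sub>M history_measure p. good (snd q)"
    by (rule AE_pair_snd[OF prob_space_history prob_space_history AE_good])
  moreover have "AE q in history_measure p \<Otimes>\<^sub>M history_measure p. good (splice T (fst q) (snd q))"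
    by (rule AE_distrD[OF measurable_splice[OF assms]]) (simp only: distr_splice[OF assms] AE_good)
  ultimately show ?thesis by eventually_elim blast
qed

lemma emeasure_splice:
  assumes "0 \<le> T" "A \<in> sets (history_measure p)"
  shows "emeasure (history_measure p) A = emeasure (history_measure p \<Otimes>\<^sub>M history_measure p)
    ((\<lambda>q. splice T (fst q) (snd q)) -` A \<inter> space (history_measure p \<Otimes>\<^sub>M history_measure p))"
  using emeasure_distr[OF measurable_splice[OF assms(1)] assms(2)] unfolding distr_splice[OF assms(1)] .

text \<open>The factor \<pi> is the probability that the fresh clocks follow the pattern. It is the
  same for all \<open>T\<close>, because after splicing at \<open>T\<close> these clocks are
  independent of the configuration at \<open>T\<close>.\<close>

lemma one_step:
  assumes S: "finite S" "S \<subseteq> slab" and c: "c \<in> {1, -1}"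
  shows "\<exists>\<pi>>0. \<forall>T\<ge>0. measure (history_measure p) (descent_event p S T (c, us, u)) * \<pi> \<le> measure (history_measure p) (lowering_event p u T (T + 1))"
proof (cases "distinct (us @ [u]) \<and> set (us @ [u]) \<subseteq> S")
  case False
  have "descent_event p S T (c, us, u) = {}" for T
    using False ties_distinct[of S _ us] unfolding descent_event_def descends_def by auto
  then show ?thesis by (intro exI[of _ 1]) simp
next
  case True
  let ?H = "history_measure p"
  interpret H: prob_space ?H by (rule prob_space_history)
  define B where "B = S \<union> \<Union> (neighbors ` S)"
  have B: "finite B" "B \<subseteq> slab" using S finite_neighbors neighbors_slab unfolding B_def by blast+
  have nB: "insert v (neighbors v) \<subseteq> B" if "v \<in> S" for v using that unfolding B_def by blast
  have LB: "distinct (us @ [u])" "set (us @ [u]) \<subseteq> B" using True unfolding B_def by blast+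
  obtain A where A: "A \<in> sets ?H" "0 < emeasure ?H A" "\<And>y. y \<in> A \<Longrightarrow> follows B (us @ [u]) c y"
    using follows_positive[OF B LB c, of p] by blast
  have us: "u \<in> slab" using True S by auto
  have "measure ?H (descent_event p S T (c, us, u)) * measure ?H A \<le> measure ?H (lowering_event p u T (T + 1))" if T: "0 \<le> T" for T
  proof -
    let ?D = "descent_event p S T (c, us, u)" and ?Lo = "lowering_event p u T (T + 1)"
    have D: "?D \<in> sets ?H" by (rule sets_descent_event[OF S])
    have Lo: "?Lo \<in> sets ?H" by (rule sets_lowering_event[OF us])
    have "emeasure ?H ?D * emeasure ?H A = emeasure (?H \<Otimes>\<^sub>M ?H) (?D \<times> A)"
      by (rule H.emeasure_pair_measure_Times[OF D A(1), symmetric])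
    also have "\<dots> \<le> emeasure (?H \<Otimes>\<^sub>M ?H) ((\<lambda>q. splice T (fst q) (snd q)) -` ?Lo \<inter> space (?H \<Otimes>\<^sub>M ?H))"
    proof (rule emeasure_mono_AE)
      show "AE q in ?H \<Otimes>\<^sub>M ?H. q \<in> ?D \<times> A \<longrightarrow> q \<in> (\<lambda>q. splice T (fst q) (snd q)) -` ?Lo \<inter> space (?H \<Otimes>\<^sub>M ?H)"
        using AE_good_splice[OF T, of p] AE_space
      proof eventually_elim
        case (elim q)
        show ?case
        proof
          assume q: "q \<in> ?D \<times> A"
          then have d: "descends S {v \<in> slab. spin (fst q) v T = c} us u" and f: "follows B (us @ [u]) c (snd q)"
            using A(3) unfolding descent_event_def by (auto simp: mem_Times_iff)
          have "\<exists>n. lowers (splice T (fst q) (snd q)) u n \<and> rt (splice T (fst q) (snd q)) u n \<in> {T<..T + 1}"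
            by (rule follows_lowers[OF _ _ _ T c _ d S(2) nB B(2) f]) (use elim in auto)
          moreover have "splice T (fst q) (snd q) \<in> space ?H"
            using measurable_space[OF measurable_splice[OF T] elim(2)] .
          ultimately show "q \<in> (\<lambda>q. splice T (fst q) (snd q)) -` ?Lo \<inter> space (?H \<Otimes>\<^sub>M ?H)"
            using elim(2) unfolding lowering_event_def by blast
        qed
      qed
      show "(\<lambda>q. splice T (fst q) (snd q)) -` ?Lo \<inter> space (?H \<Otimes>\<^sub>M ?H) \<in> sets (?H \<Otimes>\<^sub>M ?H)"
        by (rule measurable_sets[OF measurable_splice[OF T] Lo])
    qed
    also have "\<dots> = emeasure ?H ?Lo" by (rule emeasure_splice[OF T Lo, symmetric])
    finally show ?thesis
      unfolding H.emeasure_eq_measure by (simp add: ennreal_mult[symmetric] measure_nonneg)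
  qed
  moreover have "0 < measure ?H A" using A(2) unfolding H.emeasure_eq_measure by simp
  ultimately show ?thesis by blast
qed

definition patterns :: "vertex set \<Rightarrow> (int \<times> vertex list \<times> vertex) set" where
  "patterns S = {1, -1} \<times> {us. set us \<subseteq> S \<and> length us \<le> card S} \<times> S"

lemma finite_patterns: "finite S \<Longrightarrow> finite (patterns S)"
  unfolding patterns_def by (intro finite_cartesian_product finite_lists_length_le) auto

definition reducible_event :: "real \<Rightarrow> vertex set \<Rightarrow> real \<Rightarrow> history set" where
  "reducible_event p S T = (\<Union>r\<in>patterns S. descent_event p S T r)"

lemma sets_reducible_event: "finite S \<Longrightarrow> S \<subseteq> slab \<Longrightarrow> reducible_event p S T \<in> sets (history_measure p)"
  unfolding reducible_event_def by (intro sets.finite_UN finite_patterns sets_descent_event)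

text \<open>Every pattern ends at a site of \<open>S\<close>, so all of them are charged to one
  finite sum of lowering probabilities; \<open>C\<close> adds up the reciprocals of the pattern
  probabilities.\<close>

lemma reducible_bound:
  assumes S: "finite S" "S \<subseteq> slab"
  shows "\<exists>C\<ge>0. \<forall>T\<ge>0. measure (history_measure p) (reducible_event p S T) \<le> C * (\<Sum>u\<in>S. measure (history_measure p) (lowering_event p u T (T + 1)))"
proof -
  let ?H = "history_measure p"
  interpret H: prob_space ?H by (rule prob_space_history)
  have "\<forall>r\<in>patterns S. \<exists>\<pi>>0. \<forall>T\<ge>0. measure ?H (descent_event p S T r) * \<pi> \<le> measure ?H (lowering_event p (snd (snd r)) T (T + 1))"
    using one_step[OF S] unfolding patterns_def by auto
  then obtain \<pi> where \<pi>: "\<And>r. r \<in> patterns S \<Longrightarrow> 0 < \<pi> r"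
    "\<And>r T. r \<in> patterns S \<Longrightarrow> 0 \<le> T \<Longrightarrow> measure ?H (descent_event p S T r) * \<pi> r \<le> measure ?H (lowering_event p (snd (snd r)) T (T + 1))"
    by metis
  define C where "C = (\<Sum>r\<in>patterns S. 1 / \<pi> r)"
  have "measure ?H (reducible_event p S T) \<le> C * (\<Sum>u\<in>S. measure ?H (lowering_event p u T (T + 1)))" if T: "0 \<le> T" for T
  proof -
    have "measure ?H (reducible_event p S T) \<le> (\<Sum>r\<in>patterns S. measure ?H (descent_event p S T r))"
      unfolding reducible_event_def by (rule H.finite_measure_subadditive_finite[OF finite_patterns[OF S(1)]]) (use sets_descent_event[OF S] in auto)
    also have "\<dots> \<le> (\<Sum>r\<in>patterns S. 1 / \<pi> r * (\<Sum>u\<in>S. measure ?H (lowering_event p u T (T + 1))))"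
    proof (rule sum_mono)
      fix r assume r: "r \<in> patterns S"
      have "snd (snd r) \<in> S" using r unfolding patterns_def by auto
      then have "measure ?H (lowering_event p (snd (snd r)) T (T + 1)) \<le> (\<Sum>u\<in>S. measure ?H (lowering_event p u T (T + 1)))"
        using S(1) by (intro member_le_sum) auto
      then have "measure ?H (descent_event p S T r) * \<pi> r \<le> (\<Sum>u\<in>S. measure ?H (lowering_event p u T (T + 1)))"
        using \<pi>(2)[OF r T] by linarith
      then show "measure ?H (descent_event p S T r) \<le> 1 / \<pi> r * (\<Sum>u\<in>S. measure ?H (lowering_event p u T (T + 1)))"
        using \<pi>(1)[OF r] by (simp add: field_simps)
    qed
    also have "\<dots> = C * (\<Sum>u\<in>S. measure ?H (lowering_event p u T (T + 1)))"
      unfolding C_def by (simp add: sum_distrib_right)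
    finally show ?thesis .
  qed
  moreover have "0 \<le> C" unfolding C_def using \<pi>(1) by (intro sum_nonneg) (simp add: less_imp_le)
  ultimately show ?thesis by blast
qed

section \<open>Rings at times with a reachable descent\<close>

definition ring_event :: "real \<Rightarrow> vertex \<Rightarrow> real \<Rightarrow> real \<Rightarrow> history set" where
  "ring_event p v s t = {x \<in> space (history_measure p). \<exists>n. rt x v n \<in> {s<..t}}"

lemma sets_ring_event: "v \<in> slab \<Longrightarrow> ring_event p v s t \<in> sets (history_measure p)"
proof -
  assume v: "v \<in> slab"
  note [measurable] = measurable_rt[OF v]
  show ?thesis unfolding ring_event_def by measurable
qed

text \<open>After splicing at \<open>T\<close>, reachability is decided by the old history and the
  ring by the fresh one, so the probabilities multiply.\<close>

lemma reducible_ring: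
  assumes S: "finite S" "S \<subseteq> slab" and v: "v \<in> slab" and T: "0 \<le> T" and \<delta>: "0 \<le> \<delta>"
  shows "measure (history_measure p) (reducible_event p S T \<inter> ring_event p v T (T + \<delta>)) \<le> \<delta> * measure (history_measure p) (reducible_event p S T)"
proof -
  let ?H = "history_measure p" and ?R = "reducible_event p S T" and ?W = "ring_event p v T (T + \<delta>)" and ?A = "ring_event p v 0 \<delta>"
  interpret H: prob_space ?H by (rule prob_space_history)
  have R: "?R \<in> sets ?H" and W: "?W \<in> sets ?H" and A: "?A \<in> sets ?H"
    by (rule sets_reducible_event[OF S], rule sets_ring_event[OF v], rule sets_ring_event[OF v])
  have "emeasure ?H (?R \<inter> ?W) = emeasure (?H \<Otimes>\<^sub>M ?H) ((\<lambda>q. splice T (fst q) (snd q)) -` (?R \<inter> ?W) \<inter> space (?H \<Otimes>\<^sub>M ?H))"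
    using R W by (intro emeasure_splice[OF T]) auto
  also have "\<dots> \<le> emeasure (?H \<Otimes>\<^sub>M ?H) (?R \<times> ?A)"
  proof (rule emeasure_mono_AE)
    show "?R \<times> ?A \<in> sets (?H \<Otimes>\<^sub>M ?H)" using R A by (rule pair_measureI)
    show "AE q in ?H \<Otimes>\<^sub>M ?H. q \<in> (\<lambda>q. splice T (fst q) (snd q)) -` (?R \<inter> ?W) \<inter> space (?H \<Otimes>\<^sub>M ?H) \<longrightarrow> q \<in> ?R \<times> ?A"
      using AE_good_splice[OF T, of p] AE_space
    proof eventually_elim
      case (elim q)
      define x y z where "x = fst q" and "y = snd q" and "z = splice T (fst q) (snd q)"
      have g: "good x" "good y" "good z" using elim unfolding x_def y_def z_def by blast+
      have sp: "x \<in> space ?H" "y \<in> space ?H" using elim(2) unfolding x_def y_def by (auto simp: space_pair_measure)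
      show ?case
      proof
        assume "q \<in> (\<lambda>q. splice T (fst q) (snd q)) -` (?R \<inter> ?W) \<inter> space (?H \<Otimes>\<^sub>M ?H)"
        then have z: "z \<in> ?R" "z \<in> ?W" unfolding z_def by auto
        have "{u \<in> slab. spin z u T = c} = {u \<in> slab. spin x u T = c}" for c
          using spin_splice[of x y T] g T unfolding x_def y_def z_def by auto
        then have "z \<in> descent_event p S T r \<Longrightarrow> x \<in> descent_event p S T r" for r
          using sp(1) unfolding descent_event_def by (cases r) simp
        then have "x \<in> ?R" using z(1) unfolding reducible_event_def by blast
        moreover have "y \<in> ?A"
        proof -
          obtain n where n: "T < rt z v n" "rt z v n \<le> T + \<delta>" using z(2) unfolding ring_event_def by auto
          let ?K = "rings_upto x v T"
          note sr = splice_rings[OF g(1) v refl, where y = y and T = T]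
          have "\<not> n < ?K"
          proof
            assume "n < ?K"
            then have "rt z v n = rt x v n" using sr(1) unfolding z_def x_def y_def by blast
            then show False using n(1) rings_upto_iff[OF g(1) v, of n T] \<open>n < ?K\<close> by simp
          qed
          then have "rt z v n = T + rt y v (n - ?K)"
            using sr(3)[of "n - ?K"] unfolding z_def x_def y_def by simp
          then have "rt y v (n - ?K) \<in> {0<..\<delta>}" using n by simp
          then show ?thesis using sp(2) unfolding ring_event_def by blast
        qed
        ultimately show "q \<in> ?R \<times> ?A" unfolding x_def y_def by (simp add: mem_Times_iff)
      qed
    qed
  qed
  also have "\<dots> = emeasure ?H ?R * emeasure ?H ?A" by (rule H.emeasure_pair_measure_Times[OF R A])
  also have "\<dots> \<le> emeasure ?H ?R * ennreal \<delta>"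
    using prob_rings_soon[OF v \<delta>, of p] unfolding ring_event_def by (intro mult_left_mono) auto
  finally have "ennreal (measure ?H (?R \<inter> ?W)) \<le> ennreal (measure ?H ?R * \<delta>)"
    unfolding H.emeasure_eq_measure using \<delta> by (simp add: ennreal_mult[symmetric] measure_nonneg)
  then show ?thesis using \<delta> by (simp add: ennreal_le_iff mult.commute measure_nonneg)
qed

text \<open>A flip in a short subinterval of \<open>{n<..n + 1}\<close> can be seen from the left endpoint of the
  subinterval, provided that it is shorter than the time since the previous ring at the site or a
  neighbour. That time depends on the history, hence the limit over ever finer subdivisions.\<close>

definition bad_event :: "real \<Rightarrow> vertex set \<Rightarrow> vertex \<Rightarrow> nat \<Rightarrow> nat \<Rightarrow> history set" where
  "bad_event p S v n m = (\<Union>j\<in>{..m}. reducible_event p S (real n + real j / real (Suc m)) \<inter>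
     ring_event p v (real n + real j / real (Suc m)) (real n + real j / real (Suc m) + 1 / real (Suc m)))"

definition bad_limit :: "real \<Rightarrow> vertex set \<Rightarrow> vertex \<Rightarrow> nat \<Rightarrow> history set" where
  "bad_limit p S v n = (\<Union>M. \<Inter>m\<in>{M..}. bad_event p S v n m)"

lemma sets_bad_event:
  assumes "finite S" "S \<subseteq> slab" "v \<in> slab"
  shows "bad_event p S v n m \<in> sets (history_measure p)"
  unfolding bad_event_def by (intro sets.finite_UN sets.Int sets_reducible_event sets_ring_event assms) auto

lemma sets_bad_tail:
  assumes "finite S" "S \<subseteq> slab" "v \<in> slab"
  shows "(\<Inter>m\<in>{M..}. bad_event p S v n m) \<in> sets (history_measure p)"
  by (rule sets.countable_INT') (use sets_bad_event[OF assms] in auto)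

lemma sets_bad_limit:
  assumes "finite S" "S \<subseteq> slab" "v \<in> slab"
  shows "bad_limit p S v n \<in> sets (history_measure p)"
  unfolding bad_limit_def by (intro sets.countable_UN image_subsetI sets_bad_tail[OF assms])

text \<open>Each of the \<open>m + 1\<close> pieces costs at most its length times \<open>b\<close>,
  so the total does not depend on \<open>m\<close> and survives the limit. The interval from
  \<open>n\<close> to \<open>n + 2\<close> contains the unit of time after every left endpoint
  between \<open>n\<close> and \<open>n + 1\<close>.\<close>

lemma bad_limit_bound:
  assumes S: "finite S" "S \<subseteq> slab" and v: "v \<in> slab"
  shows "\<exists>C\<ge>0. \<forall>n. measure (history_measure p) (bad_limit p S v n)
    \<le> C * (\<Sum>u\<in>S. measure (history_measure p) (lowering_event p u (real n) (real n + 2)))"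
proof -
  let ?H = "history_measure p"
  interpret H: prob_space ?H by (rule prob_space_history)
  obtain C where C: "0 \<le> C" "\<And>T. 0 \<le> T \<Longrightarrow> measure ?H (reducible_event p S T) \<le> C * (\<Sum>u\<in>S. measure ?H (lowering_event p u T (T + 1)))"
    using reducible_bound[OF S, of p] by blast
  have "measure ?H (bad_limit p S v n) \<le> C * (\<Sum>u\<in>S. measure ?H (lowering_event p u (real n) (real n + 2)))" for n
  proof -
    define b where "b = C * (\<Sum>u\<in>S. measure ?H (lowering_event p u (real n) (real n + 2)))"
    have bad: "measure ?H (bad_event p S v n m) \<le> b" for m
    proof -
      let ?T = "\<lambda>j. real n + real j / real (Suc m)" and ?\<delta> = "1 / real (Suc m)"
      have piece: "measure ?H (reducible_event p S (?T j) \<inter> ring_event p v (?T j) (?T j + ?\<delta>)) \<le> ?\<delta> * b" if j: "j \<in> {..m}" for j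
      proof -
        have T: "0 \<le> ?T j" by simp
        have "real j / real (Suc m) \<le> 1" using j by simp
        moreover have "{s + a<..s + a + 1} \<subseteq> {s<..s + 2}" if "0 \<le> a" "a \<le> 1" for s a :: real using that by auto
        ultimately have "{?T j<..?T j + 1} \<subseteq> {real n<..real n + 2}" by simp
        then have sub: "lowering_event p u (?T j) (?T j + 1) \<subseteq> lowering_event p u (real n) (real n + 2)" for u
          unfolding lowering_event_def by blast
        have "measure ?H (reducible_event p S (?T j) \<inter> ring_event p v (?T j) (?T j + ?\<delta>)) \<le> ?\<delta> * measure ?H (reducible_event p S (?T j))"
          by (rule reducible_ring[OF S v T]) simp
        also have "\<dots> \<le> ?\<delta> * (C * (\<Sum>u\<in>S. measure ?H (lowering_event p u (?T j) (?T j + 1))))"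
          by (rule mult_left_mono[OF C(2)[OF T]]) simp
        also have "\<dots> \<le> ?\<delta> * b"
          unfolding b_def
          by (intro mult_left_mono sum_mono H.finite_measure_mono sub sets_lowering_event) (use C(1) S(2) in auto)
        finally show ?thesis .
      qed
      have "measure ?H (bad_event p S v n m) \<le> (\<Sum>j\<in>{..m}. measure ?H (reducible_event p S (?T j) \<inter> ring_event p v (?T j) (?T j + ?\<delta>)))"
        unfolding bad_event_def
        by (rule H.finite_measure_subadditive_finite) (auto intro!: sets.Int sets_reducible_event[OF S] sets_ring_event[OF v])
      also have "\<dots> \<le> (\<Sum>j\<in>{..m}. ?\<delta> * b)" by (rule sum_mono[OF piece])
      also have "\<dots> = b" by simp
      finally show ?thesis .
    qed
    let ?A = "\<lambda>M. \<Inter>m\<in>{M..}. bad_event p S v n m"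
    have "(\<lambda>M. measure ?H (?A M)) \<longlonglongrightarrow> measure ?H (\<Union>M. ?A M)"
    proof (rule H.finite_Lim_measure_incseq)
      show "range ?A \<subseteq> sets ?H" using sets_bad_tail[OF S v] by blast
      show "incseq ?A" unfolding incseq_def by (intro allI impI INT_anti_mono) auto
    qed
    moreover have "measure ?H (?A M) \<le> b" for M
    proof -
      have "measure ?H (?A M) \<le> measure ?H (bad_event p S v n M)"
        by (rule H.finite_measure_mono) (auto intro: sets_bad_event[OF S v])
      with bad[of M] show ?thesis by linarith
    qed
    ultimately have "measure ?H (\<Union>M. ?A M) \<le> b" by (intro LIMSEQ_le_const2) auto
    then show ?thesis unfolding bad_limit_def b_def .
  qed
  with C(1) show ?thesis by blast
qed

text \<open>A lowering ring lies in at most two of the intervals from \<open>n\<close> to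
  \<open>n + 2\<close>, so the sum is at most twice the expected number of such rings; this gives
  9.\<close>

lemma summable_lowering:
  assumes u: "u \<in> slab"
  shows "summable (\<lambda>n. measure (history_measure p) (lowering_event p u (real n) (real n + 2)))"
proof (rule summableI_nonneg_bounded)
  let ?H = "history_measure p" and ?L = "\<lambda>n :: nat. lowering_event p u (real n) (real n + 2)"
  interpret H: prob_space ?H by (rule prob_space_history)
  fix N :: nat
  have L: "?L n \<in> sets ?H" for n by (rule sets_lowering_event[OF u])
  have "ennreal (\<Sum>n<N. measure ?H (?L n)) = (\<Sum>n<N. emeasure ?H (?L n))"
    by (simp add: H.emeasure_eq_measure)
  also have "\<dots> = (\<integral>\<^sup>+x. (\<Sum>n<N. indicator (?L n) x) \<partial>?H)"
    using L by (subst nn_integral_sum) auto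
  also have "\<dots> \<le> (\<integral>\<^sup>+x. 2 * lowerings u (real N + 2) x \<partial>?H)"
  proof (rule nn_integral_mono_AE)
    show "AE x in ?H. (\<Sum>n<N. indicator (?L n) x) \<le> 2 * lowerings u (real N + 2) x"
      using AE_good[of p]
    proof eventually_elim
      case (elim x)
      define K where "K = {k. k < rings_upto x u (real N + 2) \<and> lowers x u k}"
      have K: "finite K" unfolding K_def by simp
      let ?I = "\<lambda>k. {n :: nat. real n < rt x u k \<and> rt x u k \<le> real n + 2}"
      have I: "?I k \<subseteq> {nat (\<lceil>rt x u k\<rceil> - 1), nat (\<lceil>rt x u k\<rceil> - 2)}" for k
      proof
        fix n assume "n \<in> ?I k"
        then have "int n < \<lceil>rt x u k\<rceil>" "\<lceil>rt x u k\<rceil> \<le> int n + 2" by (simp_all add: less_ceiling_iff ceiling_le_iff)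
        then have "int n = \<lceil>rt x u k\<rceil> - 1 \<or> int n = \<lceil>rt x u k\<rceil> - 2" by linarith
        then have "n = nat (\<lceil>rt x u k\<rceil> - 1) \<or> n = nat (\<lceil>rt x u k\<rceil> - 2)" by linarith
        then show "n \<in> {nat (\<lceil>rt x u k\<rceil> - 1), nat (\<lceil>rt x u k\<rceil> - 2)}" by blast
      qed
      have I2: "card (?I k) \<le> 2" for k
      proof -
        have "card (?I k) \<le> card {nat (\<lceil>rt x u k\<rceil> - 1), nat (\<lceil>rt x u k\<rceil> - 2)}" by (rule card_mono[OF _ I]) simp
        also have "\<dots> \<le> 2" by (rule card_2_iff'[THEN iffD2, THEN eq_imp_le] card_insert_le_m1 | simp add: card_insert_if)+
        finally show ?thesis .
      qed
      have "{n \<in> {..<N}. x \<in> ?L n} \<subseteq> (\<Union>k\<in>K. ?I k)"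
      proof
        fix n assume "n \<in> {n \<in> {..<N}. x \<in> ?L n}"
        then obtain k where n: "n < N" and k: "lowers x u k" "real n < rt x u k" "rt x u k \<le> real n + 2"
          unfolding lowering_event_def by auto
        then have "rt x u k \<le> real N + 2" by linarith
        then have "k \<in> K" using k(1) rings_upto_iff[OF elim u] unfolding K_def by simp
        then show "n \<in> (\<Union>k\<in>K. ?I k)" using k by blast
      qed
      then have "card {n \<in> {..<N}. x \<in> ?L n} \<le> card (\<Union>k\<in>K. ?I k)"
        by (rule card_mono[rotated]) (use K finite_subset[OF I] in blast)
      also have "\<dots> \<le> (\<Sum>k\<in>K. card (?I k))" by (rule card_UN_le[OF K])
      also have "\<dots> \<le> (\<Sum>k\<in>K. 2)" by (rule sum_mono[OF I2])
      also have "\<dots> = 2 * card K" by simp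
      finally have "of_nat (card {n \<in> {..<N}. x \<in> ?L n}) \<le> (of_nat (2 * card K) :: ennreal)" by (rule of_nat_mono)
      moreover have "(\<Sum>n<N. indicator (?L n) x :: ennreal) = of_nat (card {n \<in> {..<N}. x \<in> ?L n})"
        unfolding indicator_def by (simp add: Int_def)
      moreover have "lowerings u (real N + 2) x = of_nat (card K)" unfolding K_def by (rule lowerings_card[OF elim u])
      ultimately show ?case by simp
    qed
  qed
  also have "\<dots> = 2 * (\<integral>\<^sup>+x. lowerings u (real N + 2) x \<partial>?H)" by (rule nn_integral_cmult[OF measurable_lowerings[OF u]])
  also have "\<dots> \<le> 2 * ennreal (9 / 2)" by (rule mult_left_mono[OF expected_lowerings[OF u]]) auto
  also have "\<dots> = ennreal 9" by (simp add: ennreal_mult'[symmetric] flip: ennreal_numeral)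
  finally show "(\<Sum>n<N. measure ?H (?L n)) \<le> 9" by (simp add: ennreal_le_iff flip: ennreal_numeral)
qed (rule measure_nonneg)

lemma AE_not_bad_limit:
  assumes S: "finite S" "S \<subseteq> slab" and v: "v \<in> slab"
  shows "AE x in history_measure p. eventually (\<lambda>n. x \<notin> bad_limit p S v n) sequentially"
proof -
  let ?H = "history_measure p"
  interpret H: prob_space ?H by (rule prob_space_history)
  obtain C where C: "\<And>n. measure ?H (bad_limit p S v n) \<le> C * (\<Sum>u\<in>S. measure ?H (lowering_event p u (real n) (real n + 2)))"
    using bad_limit_bound[OF assms, of p] by blast
  have "summable (\<lambda>n. C * (\<Sum>u\<in>S. measure ?H (lowering_event p u (real n) (real n + 2))))"
    using S(2) by (intro summable_mult summable_sum summable_lowering) blast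
  then have "summable (\<lambda>n. measure ?H (bad_limit p S v n))"
    by (rule summable_comparison_test'[where N = 0]) (use C in simp)
  then have "AE x in ?H. eventually (\<lambda>n. x \<in> space ?H - bad_limit p S v n) sequentially"
    by (intro borel_cantelli_AE1 sets_bad_limit[OF assms]) (simp_all add: H.emeasure_eq_measure)
  then show ?thesis by eventually_elim (auto elim: eventually_mono)
qed

lemma window_index:
  assumes "0 < (q :: real)"
  shows "real (nat (\<lceil>q\<rceil> - 1)) < q" "q \<le> real (nat (\<lceil>q\<rceil> - 1)) + 1"
proof -
  have "0 < \<lceil>q\<rceil>" using assms by simp
  then have "real (nat (\<lceil>q\<rceil> - 1)) = of_int \<lceil>q\<rceil> - 1" by simp
  then show "real (nat (\<lceil>q\<rceil> - 1)) < q" "q \<le> real (nat (\<lceil>q\<rceil> - 1)) + 1" using ceiling_correct[of q] by linarith+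
qed

text \<open>Between \<open>s'\<close>, past which no ring near the site precedes the flip time
  \<open>r\<close>, and \<open>r\<close> itself the neighbourhood is constant, so a descent is
  reachable at each time in between. Once the mesh is below \<open>r - s'\<close>, the left end of
  the cell containing \<open>r\<close> is such a time.\<close>

lemma flip_bad_limit:
  assumes g: "good x" and x: "x \<in> space (history_measure p)" and fin: "finite Q"
    and en: "enclosed (sturdy {v \<in> slab. spin0 x v = 1}) Q w" and l: "l \<in> {0, 1, 2}"
    and flip: "spin x (site_of w l) (rt x (site_of w l) k) \<noteq> before x (rt x (site_of w l) k) (site_of w l)"
    and r: "real n < rt x (site_of w l) k" "rt x (site_of w l) k \<le> real n + 1"
  shows "x \<in> bad_limit p (case_prod site_of ` (Q \<times> {0, 1, 2})) (site_of w l) n"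
proof -
  define v where "v = site_of w l"
  define r where "r = rt x v k"
  define S where "S = case_prod site_of ` (Q \<times> {0, 1, 2})"
  have v: "v \<in> slab" unfolding v_def by (rule site_of_slab[OF l])
  have S: "finite S" "S \<subseteq> slab" using fin site_of_slab unfolding S_def by auto
  have rn: "real n < r" "r \<le> real n + 1" using r unfolding r_def v_def .
  have r0: "0 < r" unfolding r_def by (rule rt_pos[OF g v])
  let ?N = "insert v (neighbors v)"
  have "\<forall>u\<in>?N. \<exists>s. s < r \<and> (\<forall>m. rt x u m \<notin> {s<..<r})"
  proof
    fix u assume "u \<in> ?N"
    then have "u \<in> slab" by (rule near_slab[OF v])
    from gap[OF g this r0] obtain s where "s < r" "\<And>m. rt x u m \<notin> {s<..<r}" by metis
    then show "\<exists>s. s < r \<and> (\<forall>m. rt x u m \<notin> {s<..<r})" by blast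
  qed
  then obtain s where s: "\<And>u. u \<in> ?N \<Longrightarrow> s u < r" "\<And>u m. u \<in> ?N \<Longrightarrow> rt x u m \<notin> {s u<..<r}" by metis
  define s' where "s' = Max (s ` ?N)"
  have N: "finite ?N" using finite_neighbors[OF v] by simp
  have s': "s' < r" unfolding s'_def using N s(1) by (subst Max_less_iff) auto
  have su: "s u \<le> s'" if "u \<in> ?N" for u unfolding s'_def using N that by (intro Max_ge) auto
  have reducible: "x \<in> reducible_event p S T" if T: "s' \<le> T" "T < r" for T
  proof -
    have clear: "rt x u m \<notin> {T<..<r}" if "u \<in> ?N" for u m
    proof -
      have "s u \<le> T" using su[OF that] T(1) by linarith
      then show ?thesis using s(2)[OF that, of m] by simp
    qed
    have "flippable x T (site_of w l)"
      using flip_flippable[OF g v, of k T] flip T(2) clear unfolding v_def r_def by blast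
    from descent_exists[OF g fin en l this] obtain c P us u
      where c: "c \<in> {1, -1}" and d: "descends S P us u" and P: "\<forall>v\<in>slab. v \<in> P \<longleftrightarrow> spin x v T = c"
      unfolding S_def by blast
    let ?P = "{v \<in> slab. spin x v T = c}"
    have V: "insert a (neighbors a) \<subseteq> slab" if "a \<in> S" for a using near_slab that S(2) by blast
    have "P \<inter> slab = ?P \<inter> slab" using P by blast
    then have d': "descends S ?P us u"
      using d descends_restrict[OF V, where P = P and P' = ?P and us = us and u = u] by simp
    then have t: "distinct us" "set us \<subseteq> S" and u: "u \<in> S"
      using ties_distinct[of S ?P us] unfolding descends_def by blast+
    have "length us \<le> card S" using distinct_card[OF t(1)] card_mono[OF S(1) t(2)] by simp
    then have "(c, us, u) \<in> patterns S" using c t(2) u unfolding patterns_def by simp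
    moreover have "x \<in> descent_event p S T (c, us, u)" using d' x unfolding descent_event_def by simp
    ultimately show ?thesis unfolding reducible_event_def by blast
  qed
  have "0 < r - s'" using s' by simp
  then obtain M :: nat where M: "1 / Suc M < r - s'" using nat_approx_posE by blast
  have "x \<in> bad_event p S v n m" if m: "M \<le> m" for m
  proof -
    \<comment> \<open>This measures the time since \<open>n\<close> in units of the mesh; as the
      cells are open on the left, the index of the cell is ceiling minus one.\<close>
    define q where "q = (r - n) * Suc m"
    define j where "j = nat (\<lceil>q\<rceil> - 1)"
    have "0 < q" using rn(1) unfolding q_def by simp
    then have j: "real j < q" "q \<le> real j + 1" using window_index unfolding j_def by blast+
    have "q \<le> 1 * real (Suc m)" unfolding q_def by (rule mult_right_mono) (use rn in auto)
    then have "q \<le> real (Suc m)" by (simp only: mult_1_left)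
    with j(1) have "real j < real (Suc m)" by (rule less_le_trans)
    then have jm: "j \<le> m" by (simp only: of_nat_less_iff less_Suc_eq_le)
    have rq: "r = n + q / Suc m" unfolding q_def by simp
    have T: "n + j / Suc m < r" "r \<le> n + j / Suc m + 1 / Suc m"
      using j divide_strict_right_mono[OF j(1), of "real (Suc m)"] divide_right_mono[OF j(2), of "real (Suc m)"]
      unfolding rq by (simp_all add: add_divide_distrib)
    have "1 / real (Suc m) \<le> 1 / real (Suc M)" using m by (intro divide_left_mono) auto
    then have "s' \<le> n + j / Suc m" using M T(2) by linarith
    then have "x \<in> reducible_event p S (n + j / Suc m)" using reducible T(1) by blast
    moreover have "x \<in> ring_event p v (n + j / Suc m) (n + j / Suc m + 1 / Suc m)"
      using T x unfolding ring_event_def r_def by auto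
    ultimately show ?thesis using jm unfolding bad_event_def by blast
  qed
  then show ?thesis unfolding bad_limit_def S_def v_def by blast
qed

text \<open>Induction on the number of rings: the last ring up to \<open>t\<close> changes nothing,
  so one may step back to a time before it that is still not before \<open>N\<close>.\<close>

lemma no_flips_const:
  assumes g: "good x" and v: "v \<in> slab" and still: "\<And>k. N < rt x v k \<Longrightarrow> spin x v (rt x v k) = before x (rt x v k) v"
  shows "N \<le> t \<Longrightarrow> spin x v t = spin x v N"
proof (induction "rings_upto x v t" arbitrary: t rule: less_induct)
  case less
  show ?case
  proof (cases "\<exists>n. rt x v n \<in> {N<..t}")
    case False
    then show ?thesis using spin_const[OF g v less.prems] by blast
  next
    case True
    then obtain n where n: "N < rt x v n" "rt x v n \<le> t" by auto
    note up = rings_upto_iff[OF g v]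
    have mono: "a \<le> b \<Longrightarrow> rt x v a \<le> rt x v b" for a b
      using rt_strict_mono[OF g v] by (simp add: strict_mono_less_eq)
    define k where "k = rings_upto x v t - 1"
    have nk: "n < rings_upto x v t" using n(2) up by blast
    then have k: "k < rings_upto x v t" "n \<le> k" unfolding k_def by linarith+
    have rk: "N < rt x v k" "rt x v k \<le> t" using n(1) mono[OF k(2)] k(1) up[of k t] by linarith+
    have "rt x v m \<notin> {rt x v k<..t}" for m
    proof
      assume m: "rt x v m \<in> {rt x v k<..t}"
      then have "m < rings_upto x v t" using up by simp
      then have "m \<le> k" unfolding k_def by linarith
      then show False using mono[of m k] m by simp
    qed
    then have "spin x v t = spin x v (rt x v k)" by (rule spin_const[OF g v rk(2)])
    also have "\<dots> = before x (rt x v k) v" by (rule still[OF rk(1)])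
    also obtain s0 where s0: "s0 < rt x v k" "\<And>m. rt x v m \<notin> {s0<..<rt x v k}"
      using gap[OF g v rt_pos[OF g v, of k]] by metis
    have "rt x v m \<notin> {max N s0<..<rt x v k}" for m using s0(2)[of m] by simp
    then have "before x (rt x v k) v = spin x v (max N s0)"
      by (intro before_spin[OF g v]) (use s0(1) rk(1) in simp_all)
    also have "\<dots> = spin x v N"
    proof (rule less.hyps)
      have "\<not> k < rings_upto x v (max N s0)" using up[of k "max N s0"] s0(1) rk(1) by simp
      then show "rings_upto x v (max N s0) < rings_upto x v t" using k(1) by linarith
    qed simp
    finally show ?thesis .
  qed
qed

section \<open>Fixation\<close>

lemma ray_eq: "ray y d n = (fst y + int n * fst d, snd y + int n * snd d)"
  by (induction n) (simp_all add: prod_eq_iff algebra_simps)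

lemma block_sturdy:
  assumes "{a, a + 1} \<times> {b, b + 1} \<times> {0, 1, 2} \<subseteq> P"
  shows "(a, b) \<in> sturdy P"
proof -
  let ?B = "{a, a + 1} \<times> {b, b + 1} \<times> {0, 1, 2 :: int}"
  have "4 \<le> card (neighbors v \<inter> ?B)" if "v \<in> ?B" for v
  proof -
    obtain i j l where v: "v = (i, j, l)" "i \<in> {a, a + 1}" "j \<in> {b, b + 1}" and l: "l \<in> {0, 1, 2}"
      using \<open>v \<in> ?B\<close> by (cases v) auto
    \<comment> \<open>The respective other elements of \<open>{a, a + 1}\<close> and
      \<open>{b, b + 1}\<close>, that is, the horizontal neighbours within the block.\<close>
    define i' j' where "i' = 2 * a + 1 - i" and "j' = 2 * b + 1 - j"
    have i': "i' \<in> {a, a + 1}" "i' = i + 1 \<or> i' = i - 1" using v(2) unfolding i'_def by auto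
    have j': "j' \<in> {b, b + 1}" "j' = j + 1 \<or> j' = j - 1" using v(3) unfolding j'_def by auto
    have "\<exists>l1 l2. l1 \<noteq> l2 \<and> l1 \<in> {0, 1, 2} - {l} \<and> l2 \<in> {0, 1, 2} - {l}"
      using l by (elim insertE emptyE) (rule exI[of _ 1] exI[of _ 0], rule exI[of _ 2] exI[of _ 1]; simp)+
    then obtain l1 l2 where ll: "l1 \<noteq> l2" "l1 \<in> {0, 1, 2} - {l}" "l2 \<in> {0, 1, 2} - {l}" by blast
    let ?W = "{(i', j, l), (i, j', l), (i, j, l1), (i, j, l2)}"
    have "?W \<subseteq> neighbors v" unfolding v(1) neighbors_eq[OF l] using i'(2) j'(2) ll by blast
    moreover have "?W \<subseteq> ?B" using i'(1) j'(1) ll v l by blast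
    moreover have "card ?W = 4" using i'(2) j'(2) ll by auto
    moreover have "finite (neighbors v \<inter> ?B)" by simp
    ultimately show ?thesis using card_mono[of "neighbors v \<inter> ?B" ?W] by simp
  qed
  moreover have "?B \<subseteq> slab" unfolding slab_def by blast
  moreover have "\<forall>l\<in>{0, 1, 2}. site_of (a, b) l \<in> ?B" unfolding site_of_def by simp
  ultimately show ?thesis using assms unfolding sturdy_def by blast
qed

lemma AE_PiM_hit:
  assumes N: "prob_space N" and G: "G \<in> sets N" "0 < emeasure N G"
  shows "AE z in PiM UNIV (\<lambda>_ :: nat. N). \<exists>k. z k \<in> G"
proof -
  let ?M = "PiM UNIV (\<lambda>_ :: nat. N)"
  interpret N: prob_space N by fact
  interpret M: prob_space ?M by (intro prob_space_PiM N)
  define box where "box K = {z \<in> space ?M. \<forall>k\<in>{..<K}. z k \<in> space N - G}" for K :: nat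
  have B: "box K \<in> sets ?M" for K unfolding box_def by (rule sets_PiM_box) (use G in auto)
  have "emeasure ?M (box K) = (\<Prod>k\<in>{..<K}. emeasure N (space N - G))" for K
    unfolding box_def by (rule emeasure_PiM_box[OF N]) (use G in auto)
  then have eq: "measure ?M (box K) = measure N (space N - G) ^ K" for K
    unfolding N.emeasure_eq_measure M.emeasure_eq_measure by (simp add: ennreal_power measure_nonneg)
  have "0 < measure N G" using G(2) unfolding N.emeasure_eq_measure by simp
  then have "measure N (space N - G) < 1" using N.prob_compl[OF G(1)] by simp
  then have lim: "(\<lambda>K. measure N (space N - G) ^ K) \<longlonglongrightarrow> 0" by (intro LIMSEQ_power_zero) (simp add: measure_nonneg)
  have A: "(\<Inter>K. box K) \<in> sets ?M" using B by auto
  have "measure ?M (\<Inter>K. box K) \<le> measure N (space N - G) ^ K" for K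
    unfolding eq[symmetric] by (rule M.finite_measure_mono[OF _ B]) blast
  then have "measure ?M (\<Inter>K. box K) \<le> 0" by (intro LIMSEQ_le_const[OF lim]) auto
  then have "measure ?M (\<Inter>K. box K) = 0" using measure_nonneg[of ?M] by (simp add: order_antisym)
  then have "(\<Inter>K. box K) \<in> null_sets ?M" using A by (auto simp: null_sets_def M.emeasure_eq_measure)
  then show ?thesis
  proof (rule AE_I')
    show "{z \<in> space ?M. \<not> (\<exists>k. z k \<in> G)} \<subseteq> (\<Inter>K. box K)" unfolding box_def by (auto simp: space_PiM PiE_iff)
  qed
qed

text \<open>Blocks based at every second point of the ray are disjoint, so they are independent
  trials with a common positive probability.\<close>

lemma AE_sturdy_ray:
  assumes p: "0 < p" "p < 1" and d: "d \<in> dirs"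
  shows "AE x in history_measure p. \<exists>k. ray y d k \<in> sturdy {v \<in> slab. spin0 x v = 1}"
proof -
  let ?B = "{0, 1 :: int} \<times> {0, 1 :: int} \<times> {0, 1, 2 :: int}" and ?S = "site_measure p"
  define f :: "nat \<times> int \<times> int \<times> int \<Rightarrow> vertex" where
    "f = (\<lambda>(k, a, b, l). (fst y + 2 * int k * fst d + a, snd y + 2 * int k * snd d + b, l))"
  have inj: "inj_on f ((UNIV :: nat set) \<times> ?B)"
  proof (rule inj_onI)
    fix q q' assume q: "q \<in> (UNIV :: nat set) \<times> ?B" "q' \<in> (UNIV :: nat set) \<times> ?B" "f q = f q'"
    obtain k a b l where qa: "q = (k, a, b, l)" by (metis prod_cases4)
    obtain k' a' b' l' where qb: "q' = (k', a', b', l')" by (metis prod_cases4)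
    have ab: "a = 0 \<or> a = 1" "b = 0 \<or> b = 1" "a' = 0 \<or> a' = 1" "b' = 0 \<or> b' = 1"
      using q(1,2) unfolding qa qb by auto
    have e: "2 * int k * fst d + a = 2 * int k' * fst d + a'" "2 * int k * snd d + b = 2 * int k' * snd d + b'" "l = l'"
      using q(3) unfolding qa qb f_def by auto
    \<comment> \<open>Base points of blocks move by even amounts and offsets are 0 or 1, so a
      coordinate determines both.\<close>
    have parity: "i = i' \<and> c = c'" if "2 * i + c = 2 * i' + c'" "c = 0 \<or> c = 1" "c' = 0 \<or> c' = 1" for i i' c c' :: int
      using that by presburger
    have "int k * fst d = int k' * fst d \<and> a = a'" by (rule parity) (use e(1) ab in \<open>simp_all add: mult.assoc\<close>)
    moreover have "int k * snd d = int k' * snd d \<and> b = b'" by (rule parity) (use e(2) ab in \<open>simp_all add: mult.assoc\<close>)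
    moreover have "fst d \<noteq> 0 \<or> snd d \<noteq> 0" using d unfolding dirs_def by auto
    ultimately have "k = k' \<and> a = a' \<and> b = b'" by auto
    then show "q = q'" using e(3) unfolding qa qb by simp
  qed
  have fs: "f \<in> (UNIV :: nat set) \<times> ?B \<rightarrow> slab" unfolding f_def slab_def by auto
  let ?N = "PiM ?B (\<lambda>_. ?S)"
  have N: "prob_space ?N" by (intro prob_space_PiM prob_space_site)
  interpret C: prob_space clock_measure by (rule prob_space_clock)
  define U where "U = {1 :: int} \<times> space clock_measure"
  have U: "U \<in> sets ?S" unfolding U_def site_measure_def by (intro pair_measureI) auto
  have "(1 :: int) \<in> set_pmf (spin_pmf p)" using p by (simp add: spin_pmf_def set_pmf_bernoulli)
  then have "0 < emeasure ?S U"
    unfolding U_def site_measure_def by (simp add: C.emeasure_pair_measure_Times C.emeasure_space_1 emeasure_pmf_single pmf_positive)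
  define G where "G = {z \<in> space ?N. \<forall>j\<in>?B. z j \<in> U}"
  have G: "G \<in> sets ?N" unfolding G_def by (rule sets_PiM_box) (use U in auto)
  have "emeasure ?N G = (\<Prod>j\<in>?B. emeasure ?S U)"
    unfolding G_def by (rule emeasure_PiM_box[OF prob_space_site]) (use U in auto)
  also have "\<dots> \<noteq> 0" using \<open>0 < emeasure ?S U\<close> by simp
  finally have "0 < emeasure ?N G" by (simp add: zero_less_iff_neq_zero)
  then have 1: "AE z in PiM UNIV (\<lambda>_ :: nat. ?N). \<exists>k. z k \<in> G" by (rule AE_PiM_hit[OF N G])
  let ?c = "\<lambda>x. \<lambda>i\<in>UNIV. \<lambda>j\<in>?B. x (i :: nat, j)"
  have c: "?c \<in> measurable (PiM ((UNIV :: nat set) \<times> ?B) (\<lambda>_. ?S)) (PiM UNIV (\<lambda>_. ?N))"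
  proof (rule measurable_restrict, rule measurable_restrict)
    fix i :: nat and j assume "j \<in> ?B"
    then show "(\<lambda>x. x (i, j)) \<in> measurable (PiM ((UNIV :: nat set) \<times> ?B) (\<lambda>_. ?S)) ?S" by (intro measurable_component_singleton) blast
  qed
  have "AE z in PiM ((UNIV :: nat set) \<times> ?B) (\<lambda>_. ?S). \<exists>k. ?c z k \<in> G"
    by (rule AE_distrD[OF c]) (simp only: distr_PiM_curry[OF prob_space_site] 1)
  then have 2: "AE z in PiM ((UNIV :: nat set) \<times> ?B) (\<lambda>_. ?S). \<exists>k. \<forall>j\<in>?B. z (k, j) \<in> U"
    by eventually_elim (auto simp: G_def)
  let ?r = "\<lambda>x. \<lambda>q\<in>(UNIV :: nat set) \<times> ?B. x (f q)"
  have r: "?r \<in> measurable (history_measure p) (PiM ((UNIV :: nat set) \<times> ?B) (\<lambda>_. ?S))"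
    unfolding history_measure_def
  proof (rule measurable_restrict)
    fix q assume "q \<in> (UNIV :: nat set) \<times> ?B"
    then show "(\<lambda>x. x (f q)) \<in> measurable (PiM slab (\<lambda>_. ?S)) ?S" using fs by (intro measurable_component_singleton) blast
  qed
  have "distr (history_measure p) (PiM ((UNIV :: nat set) \<times> ?B) (\<lambda>_. ?S)) ?r = PiM ((UNIV :: nat set) \<times> ?B) (\<lambda>_. ?S)"
    unfolding history_measure_def by (rule distr_PiM_reindex[OF prob_space_site inj fs])
  then have "AE x in history_measure p. \<exists>k. \<forall>j\<in>?B. ?r x (k, j) \<in> U"
    by (intro AE_distrD[OF r]) (simp only: 2)
  then show ?thesis
  proof eventually_elim
    case (elim x)
    then obtain k where "\<forall>j\<in>?B. ?r x (k, j) \<in> U" by blast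
    then have k: "spin0 x (f (k, j)) = 1" if "j \<in> ?B" for j
      using that unfolding U_def spin0_def by auto
    define a b where "a = fst y + 2 * int k * fst d" and "b = snd y + 2 * int k * snd d"
    have "{a, a + 1} \<times> {b, b + 1} \<times> {0, 1, 2} \<subseteq> {v \<in> slab. spin0 x v = 1}"
    proof
      fix v assume v: "v \<in> {a, a + 1} \<times> {b, b + 1} \<times> {0, 1, 2 :: int}"
      obtain i j l where ijl: "v = (i, j, l)" by (metis prod_cases3)
      have ij: "i \<in> {a, a + 1}" "j \<in> {b, b + 1}" "l \<in> {0, 1, 2}" using v unfolding ijl mem_Sigma_iff by blast+
      have "i - a \<in> {0, 1}" "j - b \<in> {0, 1}" using ij(1,2) by (elim insertE emptyE; simp)+
      with ij(3) have "(i - a, j - b, l) \<in> ?B" by (intro SigmaI)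
      moreover have "f (k, (i - a, j - b, l)) = v" unfolding f_def ijl a_def b_def by simp
      ultimately have "spin0 x v = 1" using k[of "(i - a, j - b, l)"] by simp
      then show "v \<in> {v \<in> slab. spin0 x v = 1}" using v unfolding slab_def by blast
    qed
    then have "(a, b) \<in> sturdy {v \<in> slab. spin0 x v = 1}" by (rule block_sturdy)
    moreover have "ray y d (2 * k) = (a, b)" unfolding ray_eq a_def b_def by simp
    ultimately show ?case by metis
  qed
qed

text \<open>\<open>Z\<close> consists of the rays from \<open>w\<close> and the rays from their
  points, each followed up to a chosen hit of \<open>F\<close>. Adding \<open>A\<close> leaves room
  for two steps around each column, as \<open>deep\<close> demands.\<close>

lemma enclosed_exists:
  assumes "\<And>y d. d \<in> dirs \<Longrightarrow> \<exists>k. ray y d k \<in> F"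
  shows "\<exists>Q. finite Q \<and> enclosed F Q w"
proof -
  have "\<forall>y. \<forall>d\<in>dirs. \<exists>k. ray y d k \<in> F" using assms by blast
  then obtain K where K: "\<And>y d. d \<in> dirs \<Longrightarrow> ray y d (K y d) \<in> F" by metis
  define near where "near y = (\<Union>d\<in>dirs. ray y d ` {..K y d})" for y
  define Z where "Z = near w \<union> \<Union> (near ` near w)"
  define A where "A = {-2..2 :: int} \<times> {-2..2 :: int}"
  define Q where "Q = (\<lambda>(z, a). z + a) ` (Z \<times> A)"
  have fd: "finite dirs" unfolding dirs_def by simp
  have "finite (near y)" for y unfolding near_def using fd by simp
  then have "finite Z" unfolding Z_def by simp
  then have Q: "finite Q" unfolding Q_def A_def by simp
  have mem: "z + a \<in> Q" if "z \<in> Z" "a \<in> A" for z a using that unfolding Q_def by force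
  have dA: "d \<in> A" "d + e \<in> A" "0 \<in> A" if "d \<in> dirs" "e \<in> dirs" for d e
    using that unfolding dirs_def A_def by (auto simp: zero_prod_def)
  have deep: "deep Q (Suc (Suc 0)) z" if z: "z \<in> Z" for z
  proof -
    have "(1, 0) \<in> dirs" unfolding dirs_def by simp
    then have "z \<in> Q" using mem[OF z dA(3)] by simp
    moreover have "z + d \<in> Q" if "d \<in> dirs" for d using mem[OF z dA(1)] that by blast
    moreover have "z + d + e \<in> Q" if "d \<in> dirs" "e \<in> dirs" for d e
      using mem[OF z dA(2)[OF that]] by (simp only: add.assoc)
    ultimately show ?thesis by simp
  qed
  have n: "ray y d j \<in> near y" if "d \<in> dirs" "j \<le> K y d" for y d j using that unfolding near_def by blast
  have Z1: "ray w d j \<in> Z" if "d \<in> dirs" "j \<le> K w d" for d j using n[OF that] unfolding Z_def by blast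
  have Z2: "ray (ray w d j) e i \<in> Z" if "d \<in> dirs" "j \<le> K w d" "e \<in> dirs" "i \<le> K (ray w d j) e" for d j e i
    using n[OF that(1,2)] n[OF that(3,4)] unfolding Z_def by blast
  have "enclosed F Q w"
    unfolding enclosed_def
  proof (rule ballI)
    fix d assume d: "d \<in> dirs"
    show "\<exists>k. ray w d k \<in> F \<and> (\<forall>j\<le>k. deep Q (Suc (Suc 0)) (ray w d j) \<and>
      (\<forall>e\<in>dirs. \<exists>i. ray (ray w d j) e i \<in> F \<and> (\<forall>l\<le>i. deep Q (Suc (Suc 0)) (ray (ray w d j) e l))))"
      using K deep[OF Z1[OF d]] deep[OF Z2[OF d]] d by (intro exI[of _ "K w d"]) blast
  qed
  with Q show ?thesis by blast
qed

lemma AE_history_fixation: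
  assumes p: "0 < p" "p < 1"
  shows "AE x in history_measure p. good x \<and> (\<forall>v\<in>slab. \<exists>N :: nat. \<forall>t\<ge>real N. spin x v t = spin x v (real N))"
proof -
  let ?H = "history_measure p"
  \<comment> \<open>The region enclosing a site depends on the history, so the exceptional null sets
    are collected over all finite regions beforehand; there are only countably many.\<close>
  have "countable {S. finite S \<and> S \<subseteq> slab}" by (rule countable_Collect_finite_subset) simp
  then have "AE x in ?H. \<forall>S\<in>{S. finite S \<and> S \<subseteq> slab}. \<forall>v\<in>slab. eventually (\<lambda>n. x \<notin> bad_limit p S v n) sequentially"
    using AE_not_bad_limit by (subst AE_ball_countable) (auto simp: AE_ball_countable[OF countableI_type[of slab]])
  moreover have "AE x in ?H. \<forall>y. \<forall>d\<in>dirs. \<exists>k. ray y d k \<in> sturdy {v \<in> slab. spin0 x v = 1}"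
    unfolding AE_all_countable AE_ball_countable[OF countableI_type[of dirs]] using AE_sturdy_ray[OF p] by blast
  ultimately show ?thesis using AE_good[of p] AE_space
  proof eventually_elim
    case (elim x)
    let ?F = "sturdy {v \<in> slab. spin0 x v = 1}"
    have "\<exists>N :: nat. \<forall>t\<ge>real N. spin x v t = spin x v (real N)" if v: "v \<in> slab" for v
    proof -
      obtain a b l where abl: "v = (a, b, l)" "l \<in> {0, 1, 2}" using v unfolding slab_def by blast
      have vw: "v = site_of (a, b) l" unfolding abl(1) site_of_def by simp
      obtain Q where Q: "finite Q" "enclosed ?F Q (a, b)" using enclosed_exists[of ?F "(a, b)"] elim(2) by blast
      let ?S = "case_prod site_of ` (Q \<times> {0, 1, 2})"
      have "finite ?S" "?S \<subseteq> slab" using Q(1) site_of_slab by auto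
      then have "eventually (\<lambda>n. x \<notin> bad_limit p ?S v n) sequentially" using elim(1) v by blast
      then obtain N where N: "\<And>n. N \<le> n \<Longrightarrow> x \<notin> bad_limit p ?S v n" unfolding eventually_sequentially by blast
      have still: "spin x v (rt x v k) = before x (rt x v k) v" if k: "real N < rt x v k" for k
      proof (rule ccontr)
        assume flip: "spin x v (rt x v k) \<noteq> before x (rt x v k) v"
        define n where "n = nat (\<lceil>rt x v k\<rceil> - 1)"
        have n: "real n < rt x v k" "rt x v k \<le> real n + 1"
          unfolding n_def using window_index[OF rt_pos[OF elim(3) v, of k]] by blast+
        have "real N < real (Suc n)" using k n(2) by simp
        then have "N \<le> n" by (simp only: of_nat_less_iff less_Suc_eq_le)
        moreover have "x \<in> bad_limit p ?S v n"
          using flip_bad_limit[OF elim(3,4) Q abl(2), where k = k and n = n] flip n unfolding vw by blast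
        ultimately show False using N by blast
      qed
      have "spin x v t = spin x v (real N)" if "real N \<le> t" for t
        using no_flips_const[OF elim(3) v, where N = "real N"] still that by blast
      then show ?thesis by blast
    qed
    then show ?case using elim(3) by blast
  qed
qed

theorem theorem1p1:
  fixes p :: real
  assumes "0 < p" and "p < 1"
  shows "AE \<omega> in glauber_measure p.
           \<forall>v\<in>slab. \<exists>T\<ge>0. \<forall>t\<ge>T. glauber \<omega> v t = glauber \<omega> v T"
proof -
  have "AE \<omega> in glauber_measure p. good (history \<omega>) \<and>
      (\<forall>v\<in>slab. \<exists>N :: nat. \<forall>t\<ge>real N. spin (history \<omega>) v t = spin (history \<omega>) v (real N))"
    by (rule AE_distrD[OF measurable_history]) (simp only: distr_history AE_history_fixation[OF assms])
  then show ?thesis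
  proof eventually_elim
    case (elim \<omega>)
    have "\<exists>T\<ge>0. \<forall>t\<ge>T. glauber \<omega> v t = glauber \<omega> v T" if v: "v \<in> slab" for v
    proof -
      obtain N :: nat where N: "\<forall>t\<ge>real N. spin (history \<omega>) v t = spin (history \<omega>) v (real N)" using elim v by blast
      have eq: "glauber \<omega> v t = spin (history \<omega>) v t" if "real N \<le> t" for t
        using glauber_eq_spin[of \<omega> v t] elim v that of_nat_0_le_iff[of N] by linarith
      have "glauber \<omega> v t = glauber \<omega> v (real N)" if t: "real N \<le> t" for t
      proof -
        have "spin (history \<omega>) v t = spin (history \<omega>) v (real N)" using N t by blast
        then show ?thesis by (rule trans[OF trans[OF eq[OF t]] eq[OF order_refl, symmetric]])
      qed
      then show ?thesis using of_nat_0_le_iff[of N] by blast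
    qed
    then show ?case by blast
  qed
qed

end
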